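(* The rank problem for $\mathsf{COR}(n)$ is NP-hard (under polynomial-time many-one, i.e. Karp, reductions): given a positive integer $\rho$ and a symmetric $n\times n$ rational matrix $\Gamma$ that is promised to belong to $\mathsf{COR}(n)$, decide whether there exists $p\in\mathbb{R}^{2^n}$ with $p\ge 0$ such that $\|p\|_0\le\rho$, $\sum_{0\le k\le P_n}p_k=1$ and $\Gamma=\sum_{0\le k\le P_n}p_k\,x_kx_k^{\top}$.
   Context: For an integer $n\ge 1$ let $P_n=2^n-1$, and for $0\le k\le P_n$ let $x_k\in\{0,1\}^n$ be the vector giving the base-2 representation of $k$ (so $x_0,\dots,x_{P_n}$ enumerate $\{0,1\}^n$). The correlation polytope $\mathsf{COR}(n)$ is the convex hull of $\{x_kx_k^{\top} : 0\le k\le P_n\}$. $\|p\|_0$ denotes the number of nonzero components of $p$. The promise that $\Gamma\in\mathsf{COR}(n)$ means that every instance satisfies $\Gamma\in\mathsf{COR}(n)$, but the weights of a decomposition are not part of the input; a promise problem is NP-hard if every language in NP has a polynomial-time many-one reduction to it whose outputs always satisfy the promise. *)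

theory Defs
  imports "Jordan_Normal_Form.Matrix" "HOL-Computational_Algebra.Polynomial"
begin

section \<open>Turing machines, NP and polynomial-time many-one reductions\<close>

text \<open>
  Multi-tape, possibly nondeterministic Turing machines with two-way infinite tapes.  States and
  tape symbols are natural numbers; only the finitely many that occur in the transition set
  matter.  Symbol 0 is the blank.  A transition \<open>(q, rs, q', as)\<close> applies in state \<open>q\<close> when the
  heads read the symbols \<open>rs\<close>; it changes to state \<open>q'\<close>, and \<open>as\<close> lists for each tape the symbol
  to write and the head displacement.
\<close>

record tm =
  tapes :: nat
  start :: nat
  accepting :: "nat set"
  trans :: "(nat \<times> nat list \<times> nat \<times> (nat \<times> int) list) set"

definition wf_tm :: "tm \<Rightarrow> bool" where
  "wf_tm M \<longleftrightarrow> tapes M \<ge> 1 \<and> finite (trans M) \<and>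
     (\<forall>(q, rs, q', as) \<in> trans M. length rs = tapes M \<and> length as = tapes M \<and>
        (\<forall>(s, d) \<in> set as. d \<in> {-1, 0, 1}))"

definition deterministic :: "tm \<Rightarrow> bool" where
  "deterministic M \<longleftrightarrow> (\<forall>q rs q1 as1 q2 as2.
     (q, rs, q1, as1) \<in> trans M \<longrightarrow> (q, rs, q2, as2) \<in> trans M \<longrightarrow> q1 = q2 \<and> as1 = as2)"

text \<open>A tape is a pair of a head position and the cell contents.\<close>

type_synonym tape = "int \<times> (int \<Rightarrow> nat)"
type_synonym config = "nat \<times> tape list"

fun read_tape :: "tape \<Rightarrow> nat" where
  "read_tape (h, f) = f h"

fun act :: "nat \<times> int \<Rightarrow> tape \<Rightarrow> tape" where
  "act (s, d) (h, f) = (h + d, f(h := s))"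

definition step :: "tm \<Rightarrow> config \<Rightarrow> config \<Rightarrow> bool" where
  "step M c c' \<longleftrightarrow> (\<exists>as. (fst c, map read_tape (snd c), fst c', as) \<in> trans M \<and>
     snd c' = map2 act as (snd c))"

definition halted :: "tm \<Rightarrow> config \<Rightarrow> bool" where
  "halted M c \<longleftrightarrow> (\<nexists>c'. step M c c')"

text \<open>A bit string occupies the cells 0, 1, 2 and so on, with 1 for \<open>False\<close> and 2 for \<open>True\<close>.\<close>

definition word_cells :: "bool list \<Rightarrow> int \<Rightarrow> nat" where
  "word_cells w i =
     (if 0 \<le> i \<and> nat i < length w then (if w ! nat i then 2 else 1) else 0)"

definition init_config :: "tm \<Rightarrow> bool list \<Rightarrow> config" where
  "init_config M w = (start M, (0, word_cells w) # replicate (tapes M - 1) (0, \<lambda>_. 0))"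

text \<open>The bound is on all computations, so in particular every computation halts.\<close>

definition poly_time :: "tm \<Rightarrow> bool" where
  "poly_time M \<longleftrightarrow> (\<exists>b :: nat poly. \<forall>w t c.
     (step M ^^ t) (init_config M w) c \<longrightarrow> t \<le> poly b (length w))"

definition accepts :: "tm \<Rightarrow> bool list \<Rightarrow> bool" where
  "accepts M w \<longleftrightarrow>
     (\<exists>c. (step M)\<^sup>*\<^sup>* (init_config M w) c \<and> halted M c \<and> fst c \<in> accepting M)"

definition NP :: "bool list set set" where
  "NP = {L. \<exists>M. wf_tm M \<and> poly_time M \<and> L = {w. accepts M w}}"

text \<open>The output is read from the last tape, which for a one-tape machine is also the input tape.\<close>

definition computes :: "tm \<Rightarrow> (bool list \<Rightarrow> bool list) \<Rightarrow> bool" where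
  "computes M f \<longleftrightarrow> (\<forall>w. \<exists>c. (step M)\<^sup>*\<^sup>* (init_config M w) c \<and> halted M c \<and>
     snd (last (snd c)) = word_cells (f w))"

definition poly_time_computable :: "(bool list \<Rightarrow> bool list) \<Rightarrow> bool" where
  "poly_time_computable f \<longleftrightarrow>
     (\<exists>M. wf_tm M \<and> deterministic M \<and> poly_time M \<and> computes M f)"

text \<open>
  A promise problem is given by the set of strings satisfying the promise and the set of
  yes-instances.
\<close>

definition NP_hard_promise :: "bool list set \<Rightarrow> bool list set \<Rightarrow> bool" where
  "NP_hard_promise promise yes \<longleftrightarrow> (\<forall>L \<in> NP. \<exists>f. poly_time_computable f \<and>
     (\<forall>w. f w \<in> promise \<and> (w \<in> L \<longleftrightarrow> f w \<in> yes)))"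


section \<open>The correlation polytope\<close>

text \<open>Component \<open>i\<close> of \<open>x\<^sub>k\<close> is the binary digit of \<open>k\<close> of weight \<open>2 ^ i\<close>.\<close>

definition xvec :: "nat \<Rightarrow> nat \<Rightarrow> real vec" where
  "xvec n k = vec n (\<lambda>i. of_bool (bit k i))"

definition outer :: "real vec \<Rightarrow> real mat" where
  "outer x = mat (dim_vec x) (dim_vec x) (\<lambda>(i, j). x $ i * x $ j)"

definition P :: "nat \<Rightarrow> nat" where
  "P n = 2 ^ n - 1"

text \<open>
  The type of matrices with explicit dimensions is not a real vector space, so convexity is spelled
  out on the carrier; the generic hull operator then gives the convex hull.
\<close>

definition convex_mat :: "nat \<Rightarrow> real mat set \<Rightarrow> bool" where
  "convex_mat n S \<longleftrightarrow> S \<subseteq> carrier_mat n n \<and>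
     (\<forall>A \<in> S. \<forall>B \<in> S. \<forall>u \<ge> 0. \<forall>v \<ge> 0. u + v = 1 \<longrightarrow> u \<cdot>\<^sub>m A + v \<cdot>\<^sub>m B \<in> S)"

definition COR :: "nat \<Rightarrow> real mat set" where
  "COR n = convex_mat n hull {outer (xvec n k) | k. k \<le> P n}"


section \<open>The rank problem\<close>

definition norm0 :: "real vec \<Rightarrow> nat" where
  "norm0 p = card {k. k < dim_vec p \<and> p $ k \<noteq> 0}"

definition is_decomposition :: "nat \<Rightarrow> real mat \<Rightarrow> real vec \<Rightarrow> bool" where
  "is_decomposition n G p \<longleftrightarrow> p \<in> carrier_vec (2 ^ n) \<and> (\<forall>k \<le> P n. 0 \<le> p $ k) \<and>
     (\<Sum>k \<le> P n. p $ k) = 1 \<and>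
     G = mat n n (\<lambda>(i, j). \<Sum>k \<le> P n. p $ k * outer (xvec n k) $$ (i, j))"

text \<open>Instances are triples \<open>(n, \<rho>, \<Gamma>)\<close>.\<close>

definition COR_promise :: "(nat \<times> nat \<times> rat mat) set" where
  "COR_promise = {(n, \<rho>, \<Gamma>). n \<ge> 1 \<and> \<rho> \<ge> 1 \<and> \<Gamma> \<in> carrier_mat n n \<and>
     transpose_mat \<Gamma> = \<Gamma> \<and> map_mat of_rat \<Gamma> \<in> COR n}"

definition COR_rank_yes :: "(nat \<times> nat \<times> rat mat) set" where
  "COR_rank_yes = {(n, \<rho>, \<Gamma>). (n, \<rho>, \<Gamma>) \<in> COR_promise \<and>
     (\<exists>p. is_decomposition n (map_mat of_rat \<Gamma>) p \<and> norm0 p \<le> \<rho>)}"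


section \<open>Encoding of instances as bit strings\<close>

text \<open>
  Numbers are written in binary, most significant digit first, each digit preceded by \<open>True\<close>; a
  single \<open>False\<close> terminates the number.  Rationals are in lowest terms with positive denominator.
\<close>

fun binary :: "nat \<Rightarrow> bool list" where
  "binary n = (if n = 0 then [] else binary (n div 2) @ [odd n])"

declare binary.simps [simp del]

definition enc_nat :: "nat \<Rightarrow> bool list" where
  "enc_nat n = concat (map (\<lambda>b. [True, b]) (binary n)) @ [False]"

definition enc_int :: "int \<Rightarrow> bool list" where
  "enc_int z = (z < 0) # enc_nat (nat \<bar>z\<bar>)"

definition enc_rat :: "rat \<Rightarrow> bool list" where
  "enc_rat r = (case quotient_of r of (a, b) \<Rightarrow> enc_int a @ enc_nat (nat b))"

text \<open>The matrix entries are listed row by row.\<close>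

fun enc_instance :: "nat \<times> nat \<times> rat mat \<Rightarrow> bool list" where
  "enc_instance (n, \<rho>, \<Gamma>) = enc_nat n @ enc_nat \<rho> @
     concat (map (\<lambda>(i, j). enc_rat (\<Gamma> $$ (i, j))) (List.product [0..<n] [0..<n]))"

text \<open>The encoding is injective, so that the promise problem is well defined on strings.\<close>

lemma binary_inj: "binary m = binary n \<Longrightarrow> m = n"
proof (induction m arbitrary: n rule: less_induct)
  case (less m)
  show ?case
  proof (cases "m = 0 \<or> n = 0")
    case True
    then show ?thesis using less.prems
      by (auto simp: binary.simps[of m] binary.simps[of n] split: if_splits)
  next
    case False
    then have "binary (m div 2) = binary (n div 2)" "odd m = odd n"
      using less.prems by (auto simp: binary.simps[of m] binary.simps[of n])
    with less.IH[of "m div 2" "n div 2"] False have "m div 2 = n div 2" "odd m = odd n" by auto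
    then show ?thesis by (metis odd_two_times_div_two_succ even_two_times_div_two)
  qed
qed

lemma enc_nat_append: "enc_nat m @ u = enc_nat n @ v \<Longrightarrow> m = n \<and> u = v"
proof -
  assume eq: "enc_nat m @ u = enc_nat n @ v"
  have "concat (map (\<lambda>b. [True, b]) xs) @ False # u = concat (map (\<lambda>b. [True, b]) ys) @ False # v
        \<Longrightarrow> xs = ys \<and> u = v" for xs ys
  proof (induction xs arbitrary: ys)
    case Nil
    then show ?case by (cases ys) auto
  next
    case (Cons x xs)
    then show ?case by (cases ys) auto
  qed
  from this[of "binary m" "binary n"] eq have "binary m = binary n \<and> u = v"
    by (simp add: enc_nat_def)
  then show "m = n \<and> u = v" using binary_inj by blast
qed

lemma enc_rat_append:
  assumes "enc_rat r @ u = enc_rat s @ v"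
  shows "r = s \<and> u = v"
proof -
  obtain a b where r: "quotient_of r = (a, b)" by fastforce
  obtain c d where s: "quotient_of s = (c, d)" by fastforce
  have pos: "b > 0" "d > 0" using quotient_of_denom_pos r s by blast+
  have 1: "(a < 0) = (c < 0)"
    and "enc_nat (nat \<bar>a\<bar>) @ (enc_nat (nat b) @ u) = enc_nat (nat \<bar>c\<bar>) @ (enc_nat (nat d) @ v)"
    using assms r s by (auto simp: enc_rat_def enc_int_def)
  from enc_nat_append[OF this(2)] have 2: "nat \<bar>a\<bar> = nat \<bar>c\<bar>"
    and "enc_nat (nat b) @ u = enc_nat (nat d) @ v" by auto
  from enc_nat_append[OF this(2)] have 3: "nat b = nat d" "u = v" by auto
  from 1 2 3 pos have "a = c" "b = d" by auto
  with r s have "r = s" by (metis quotient_of_inject)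
  with 3 show ?thesis by simp
qed

lemma inj_on_enc_instance: "inj_on enc_instance {(n, \<rho>, \<Gamma>). \<Gamma> \<in> carrier_mat n n}"
proof (rule inj_onI)
  fix x y :: "nat \<times> nat \<times> rat mat"
  assume x: "x \<in> {(n, \<rho>, \<Gamma>). \<Gamma> \<in> carrier_mat n n}"
    and y: "y \<in> {(n, \<rho>, \<Gamma>). \<Gamma> \<in> carrier_mat n n}" and "enc_instance x = enc_instance y"
  then obtain n \<rho> G m \<sigma> H where xy: "x = (n, \<rho>, G)" "y = (m, \<sigma>, H)"
    and G: "G \<in> carrier_mat n n" and H: "H \<in> carrier_mat m m"
    and eq: "enc_instance (n, \<rho>, G) = enc_instance (m, \<sigma>, H)"
    by (cases x; cases y) auto
  note 1 = enc_nat_append[OF eq[unfolded enc_instance.simps]]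
  note 2 = enc_nat_append[OF conjunct2[OF 1]]
  have nm: "n = m" using 1 by blast
  have rs: "\<rho> = \<sigma>" using 2 by blast
  have list: "concat (map (\<lambda>x. enc_rat (f x)) xs) = concat (map (\<lambda>x. enc_rat (g x)) xs)
      \<Longrightarrow> \<forall>x \<in> set xs. f x = g x" for f g :: "nat \<times> nat \<Rightarrow> rat" and xs
    by (induction xs) (auto dest: enc_rat_append)
  let ?xs = "List.product [0..<n] [0..<n]"
  have "concat (map (\<lambda>x. enc_rat (G $$ x)) ?xs) = concat (map (\<lambda>x. enc_rat (H $$ x)) ?xs)"
    using conjunct2[OF 2] nm by (simp add: case_prod_unfold)
  then have "\<forall>x \<in> set ?xs. G $$ x = H $$ x"
    by (rule list)
  then have "G = H" using G H nm by (intro eq_matI) auto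
  with nm rs xy show "x = y" by simp
qed

end

theory Submission
  imports Defs "HOL-Library.Countable" "HOL-Library.Nat_Bijection"
begin

text \<open>
  An arbitrary NP computation is turned into a binary constraint problem, this into a colouring problem, and this
  into a rank problem.  In a decomposition of \<open>\<Gamma>\<close>, view the atoms \<open>x\<^sub>k\<close> as sets of indices.  A zero entry
  keeps two indices from occurring in a common atom, and an entry \<open>\<epsilon>\<close> between a special index \<open>z\<close> and every
  vertex \<open>i\<close> makes the atoms that contain \<open>z\<close> cover the vertices; with zero entries for the conflicting pairs
  these atoms are colour classes.  The other entries must not depend on the colouring.  For that, every
  pair \<open>{i, j}\<close> of vertices gets an index \<open>y\<close> with diagonal entry \<open>2 \<epsilon>\<close> and entries \<open>\<epsilon>\<close> at \<open>i\<close> and \<open>j\<close>: it can be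
  decomposed into \<open>{y, i}\<close> and \<open>{y, j}\<close>, or into \<open>{y, i, j}\<close> and \<open>{y}\<close>, which takes two atoms either
  way but contributes 0 or \<open>\<epsilon>\<close> to the entry of \<open>i\<close> and \<open>j\<close>.  Large diagonal entries make the singletons
  \<open>{i}\<close> and \<open>{z}\<close> unavoidable, and a small trace the empty atom.  Hence the rank is the chromatic number plus
  a known constant, while the trivial colouring shows that \<open>\<Gamma>\<close> always lies in the polytope.

  All entries are 0 or \<open>1 / q\<close> with \<open>q\<close> polynomially bounded, so that the reduction can be computed by nested
  loops over registers in unary notation.
\<close>

section \<open>A register language compiled to Turing machines\<close>

text \<open>The promise shapes the construction: the matrix must lie in the polytope also when the
  computation rejects, so its entries may use the conflict graph but no colouring. Giving a gadget
  index to conflicting pairs as well makes the number of gadgets a function of |V| alone: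
  \<open>2 * card Y + card V\<close> is the square of |V|, and the rank bound m + |V|^2 + 2
  expresses m-colourability without counting edges. The intermediate problem has variables with many
  values instead of Boolean ones. One value can then hold all that happens at one moment on one
  tape, and the correctness of a computation becomes a set of conditions on pairs of variables,
  which is what edges of a graph can express. Polynomially many values suffice because the contents
  of a tape are never stored: a symbol that is read is traced back to the one earlier moment at
  which it was written.\<close>

datatype test = NZ nat | InGe nat
datatype instr = Inc nat | Dec nat | InR | InL | Out bool
datatype cmd = Skip | Do instr | Seq cmd cmd | If test cmd cmd | While test cmd

text \<open>Countability lets a list of commands, encoded by \<open>to_nat\<close>, serve as the
  state of a Turing machine.\<close>

instance test :: countable by countable_datatype
instance instr :: countable by countable_datatype
instance cmd :: countable by countable_datatype

text \<open>Register contents, position of the input head, and output so far.\<close>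

type_synonym state = "(nat \<Rightarrow> nat) \<times> nat \<times> bool list"

context
  fixes w :: "bool list"
begin

text \<open>As 0 is the blank, \<open>InGe 1\<close> asks whether the head is still on the input,
  and \<open>InGe 2\<close> whether the scanned bit is \<open>True\<close>.\<close>

fun holds :: "test \<Rightarrow> state \<Rightarrow> bool" where
  "holds (NZ i) (r, p, u) = (r i \<noteq> 0)"
| "holds (InGe a) (r, p, u) = (word_cells w (int p) \<ge> a)"

text \<open>The guards keep the input head and the register heads, whose positions are the register
  values, at natural numbers.\<close>

fun enabled :: "instr \<Rightarrow> state \<Rightarrow> bool" where
  "enabled (Dec i) (r, p, u) = (r i \<noteq> 0)"
| "enabled InL (r, p, u) = (p \<noteq> 0)"
| "enabled _ _ = True"

fun effect :: "instr \<Rightarrow> state \<Rightarrow> state" where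
  "effect (Inc i) (r, p, u) = (r(i := Suc (r i)), p, u)"
| "effect (Dec i) (r, p, u) = (r(i := r i - 1), p, u)"
| "effect InR (r, p, u) = (r, Suc p, u)"
| "effect InL (r, p, u) = (r, p - 1, u)"
| "effect (Out b) (r, p, u) = (r, p, u @ [b])"

text \<open>The time is exact: each unfolding of a command costs one unit, which corresponds to one
  machine step.\<close>

inductive exec :: "cmd \<Rightarrow> state \<Rightarrow> nat \<Rightarrow> state \<Rightarrow> bool" where
  Skip: "exec Skip s 1 s"
| Do: "enabled a s \<Longrightarrow> exec (Do a) s 1 (effect a s)"
| Seq: "exec c s t s' \<Longrightarrow> exec d s' t' s'' \<Longrightarrow> exec (Seq c d) s (Suc (t + t')) s''"
| IfT: "holds b s \<Longrightarrow> exec c s t s' \<Longrightarrow> exec (If b c d) s (Suc t) s'"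
| IfF: "\<not> holds b s \<Longrightarrow> exec d s t s' \<Longrightarrow> exec (If b c d) s (Suc t) s'"
| WhileT: "holds b s \<Longrightarrow> exec c s t s' \<Longrightarrow> exec (While b c) s' t' s'' \<Longrightarrow>
    exec (While b c) s (Suc (t + t')) s''"
| WhileF: "\<not> holds b s \<Longrightarrow> exec (While b c) s 1 s"

end

section \<open>The machine that executes a register program\<close>

fun test_reg :: "test \<Rightarrow> nat" where
  "test_reg (NZ i) = i"
| "test_reg (InGe a) = 0"

fun instr_reg :: "instr \<Rightarrow> nat" where
  "instr_reg (Inc i) = i"
| "instr_reg (Dec i) = i"
| "instr_reg _ = 0"

fun max_reg :: "cmd \<Rightarrow> nat" where
  "max_reg Skip = 0"
| "max_reg (Do a) = instr_reg a"
| "max_reg (Seq c d) = max (max_reg c) (max_reg d)"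
| "max_reg (If b c d) = max (test_reg b) (max (max_reg c) (max_reg d))"
| "max_reg (While b c) = max (test_reg b) (max_reg c)"

text \<open>
  Tape 0 is the input, tape \<open>Suc i\<close> is register \<open>i\<close>, whose value is the head position and whose
  cell 0 carries a mark, and the last tape is the output.
\<close>

fun sees :: "test \<Rightarrow> nat list \<Rightarrow> bool" where
  "sees (NZ i) rs = (rs ! Suc i = 0)"
| "sees (InGe a) rs = (rs ! 0 \<ge> a)"

definition stay :: "nat list \<Rightarrow> (nat \<times> int) list" where
  "stay rs = map (\<lambda>s. (s, 0)) rs"

fun moves :: "instr \<Rightarrow> nat list \<Rightarrow> (nat \<times> int) list" where
  "moves (Inc i) rs = (stay rs)[Suc i := (rs ! Suc i, 1)]"
| "moves (Dec i) rs = (stay rs)[Suc i := (rs ! Suc i, -1)]"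
| "moves InR rs = (stay rs)[0 := (rs ! 0, 1)]"
| "moves InL rs = (stay rs)[0 := (rs ! 0, -1)]"
| "moves (Out b) rs = (stay rs)[length rs - 1 := (if b then 2 else 1, 1)]"

text \<open>A control state is the list of commands that remain to be executed.\<close>

fun next_ctrl :: "cmd list \<Rightarrow> nat list \<Rightarrow> cmd list \<times> (nat \<times> int) list" where
  "next_ctrl [] rs = ([], stay rs)"
| "next_ctrl (Skip # k) rs = (k, stay rs)"
| "next_ctrl (Do a # k) rs = (k, moves a rs)"
| "next_ctrl (Seq c d # k) rs = (c # d # k, stay rs)"
| "next_ctrl (If b c d # k) rs = ((if sees b rs then c else d) # k, stay rs)"
| "next_ctrl (While b c # k) rs = ((if sees b rs then c # While b c # k else k), stay rs)"

text \<open>The control states met while \<open>c\<close> is executed before \<open>k\<close>. A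
  loop body has the loop itself as continuation, which keeps the set finite.\<close>

fun conts :: "cmd \<Rightarrow> cmd list \<Rightarrow> cmd list set" where
  "conts Skip k = {Skip # k}"
| "conts (Do a) k = {Do a # k}"
| "conts (Seq c d) k = insert (Seq c d # k) (conts c (d # k) \<union> conts d k)"
| "conts (If b c d) k = insert (If b c d # k) (conts c k \<union> conts d k)"
| "conts (While b c) k = insert (While b c # k) (conts c (While b c # k))"

lemma finite_conts: "finite (conts c k)"
  by (induction c arbitrary: k) auto

lemma Nil_notin_conts: "[] \<notin> conts c k"
  by (induction c arbitrary: k) auto

definition words :: "nat \<Rightarrow> nat list set" where
  "words l = {rs. set rs \<subseteq> {0, 1, 2} \<and> length rs = l}"

lemma finite_words: "finite (words l)"
  unfolding words_def by (rule finite_lists_length_eq) simp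

context
  fixes c0 :: cmd and R :: nat
  assumes R: "max_reg c0 < R"
begin

text \<open>State 0 performs one preparatory step, which marks cell 0 of every register tape; the
  codes of command lists are shifted by \<open>Suc\<close> to leave it free. The empty list has no
  transition, so the machine halts when the program is finished.\<close>

definition machine :: tm where
  "machine = \<lparr>tapes = R + 2, start = 0, accepting = {},
     trans = (\<lambda>s. (0, s # replicate (R + 1) 0, Suc (to_nat [c0]),
                (s, 0) # replicate R (1, 0) @ [(0, 0)])) ` {0, 1, 2} \<union>
       (\<lambda>(q, rs). (Suc (to_nat q), rs, Suc (to_nat (fst (next_ctrl q rs))), snd (next_ctrl q rs)))
         ` (conts c0 [] \<times> words (R + 2))\<rparr>"

lemma length_stay [simp]: "length (stay rs) = length rs"
  by (simp add: stay_def)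

lemma length_moves [simp]: "length (moves a rs) = length rs"
  by (cases a) auto

lemma length_next_ctrl [simp]: "length (snd (next_ctrl q rs)) = length rs"
  by (cases "(q, rs)" rule: next_ctrl.cases) auto

lemma moves_range: "(s, d) \<in> set (stay rs) \<Longrightarrow> d \<in> {-1, 0, 1}"
  "(s, d) \<in> set (moves a rs) \<Longrightarrow> d \<in> {-1, 0, 1}"
  "(s, d) \<in> set (snd (next_ctrl q rs)) \<Longrightarrow> d \<in> {-1, 0, 1}"
proof -
  show 1: "d \<in> {-1, 0, 1}" if "(s, d) \<in> set (stay rs)" for s d
    using that by (auto simp: stay_def)
  show 2: "d \<in> {-1, 0, 1}" if "(s, d) \<in> set (moves a rs)" for a s d
    using that 1[of s d] by (cases a) (auto dest!: set_update_subset_insert[THEN subsetD])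
  show "d \<in> {-1, 0, 1}" if "(s, d) \<in> set (snd (next_ctrl q rs))"
    using that 1[of s d] 2[of s d] by (cases "(q, rs)" rule: next_ctrl.cases) auto
qed

lemma wf_machine: "wf_tm machine"
proof -
  have "length rs = R + 2" if "rs \<in> words (R + 2)" for rs
    using that by (simp add: words_def)
  then show ?thesis unfolding wf_tm_def machine_def
    by (auto simp: finite_conts finite_words simp del: One_nat_def dest: moves_range(3))
qed

lemma deterministic_machine: "deterministic machine"
  unfolding deterministic_def machine_def by auto

definition cmd_conf :: "bool list \<Rightarrow> cmd list \<Rightarrow> state \<Rightarrow> config" where
  "cmd_conf w q s = (case s of (r, p, u) \<Rightarrow> (Suc (to_nat q),
     (int p, word_cells w) # map (\<lambda>i. (int (r i), \<lambda>j. if j = 0 then 1 else 0)) [0..<R] @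
     [(int (length u), word_cells u)]))"

definition reads :: "bool list \<Rightarrow> state \<Rightarrow> nat list" where
  "reads w s = (case s of (r, p, u) \<Rightarrow>
     word_cells w (int p) # map (\<lambda>i. if r i = 0 then 1 else 0) [0..<R] @ [0])"

lemma map_read_conf: "map read_tape (snd (cmd_conf w q s)) = reads w s"
  by (cases s) (auto simp: cmd_conf_def reads_def word_cells_def)

lemma reads_words: "reads w s \<in> words (R + 2)"
  by (cases s) (auto simp: reads_def words_def word_cells_def)

lemma sees_iff: "test_reg b < R \<Longrightarrow> sees b (reads w s) = holds w b s"
  by (cases s; cases b) (auto simp: reads_def nth_append)

lemma act_stay: "map2 act (stay (map read_tape ts)) ts = ts"
  by (induction ts) (auto simp: stay_def)

lemma act_stay_conf: "map2 act (stay (reads w s)) (snd (cmd_conf w q s)) = snd (cmd_conf w q' s)"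
  using act_stay[of "snd (cmd_conf w q s)"] unfolding map_read_conf
  by (cases s) (auto simp: cmd_conf_def)

lemma act_upd_conf:
  assumes "i < R + 2" "length ts = R + 2"
  shows "map2 act ((stay (map read_tape ts))[i := m]) ts = ts[i := act m (ts ! i)]"
proof (rule nth_equalityI)
  fix j assume "j < length (map2 act ((stay (map read_tape ts))[i := m]) ts)"
  then have "j < R + 2" using assms by simp
  moreover have "act (read_tape x, 0) x = x" for x by (cases x) auto
  ultimately show "map2 act ((stay (map read_tape ts))[i := m]) ts ! j = ts[i := act m (ts ! i)] ! j"
    using assms by (cases "i = j") (auto simp: stay_def)
qed (use assms in auto)

lemma word_cells_snoc:
  "(word_cells u)(int (length u) := (if b then 2 else 1)) = word_cells (u @ [b])"
  by (rule ext) (auto simp: word_cells_def nth_append nat_less_iff)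

lemma act_moves_conf:
  assumes "instr_reg a < R" "enabled a s"
  shows "map2 act (moves a (reads w s)) (snd (cmd_conf w q s)) = snd (cmd_conf w q' (effect a s))"
proof -
  obtain r p u where s: "s = (r, p, u)" by (cases s)
  let ?ts = "snd (cmd_conf w q s)"
  have len: "length ?ts = R + 2" "length (reads w s) = R + 2"
    by (auto simp: cmd_conf_def s reads_def)
  have upd: "map2 act ((stay (reads w s))[i := m]) ?ts = ?ts[i := act m (?ts ! i)]" if "i < R + 2" for i m
    using act_upd_conf[OF that len(1)] by (simp add: map_read_conf)
  \<comment> \<open>Rewriting the scanned symbol leaves a register tape as it was, wherever its head
    stands.\<close>
  have mark: "(\<lambda>j. if j = 0 then 1 else 0)(x := if x = 0 then 1 else 0) = (\<lambda>j::int. if j =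
    0 then 1 else 0::nat)" for x
    by auto
  have R0: "R > 0" using R by simp
  have reg: "(map f [0..<R] @ [B])[i := y] = map (f(i := y)) [0..<R] @ [B]"
    if "i < R" for f :: "nat \<Rightarrow> tape" and B i y
    using that by (auto intro!: nth_equalityI simp: list_update_append nth_list_update)
  have regs: "(map f [0..<R] @ [B])[R := y] = map f [0..<R] @ [y]" for f :: "nat \<Rightarrow> tape" and B y
    by (auto simp: list_update_append)
  let ?mk = "\<lambda>j::int. if j = 0 then 1 else 0::nat"
  have ts: "?ts = (int p, word_cells w) # map (\<lambda>i. (int (r i), ?mk)) [0..<R] @
    [(int (length u), word_cells u)]"
    for q by (simp add: cmd_conf_def s)
  have rd0: "reads w s ! 0 = word_cells w (int p)" by (simp add: reads_def s)
  have rdi: "reads w s ! Suc i = ?mk (int (r i))" if "i < R" for i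
    using that by (simp add: reads_def s nth_append)
  have tsi: "?ts ! Suc i = (int (r i), ?mk)" if "i < R" for i using that by (simp add: ts nth_append)
  have tsR: "?ts ! Suc R = (int (length u), word_cells u)" by (simp add: ts nth_append)
  show ?thesis
  proof (cases a)
    case (Inc i)
    then have i: "i < R" "Suc i < R + 2" using assms by auto
    have "?ts[Suc i := (int (r i) + 1, ?mk)] = snd (cmd_conf w q' (effect a s))"
      unfolding ts list_update_code reg[OF i(1)] by (auto simp: cmd_conf_def s Inc)
    then show ?thesis unfolding Inc moves.simps upd[OF i(2)] rdi[OF i(1)] tsi[OF i(1)] act.simps mark .
  next
    case (Dec i)
    then have i: "i < R" "Suc i < R + 2" using assms by auto
    have "?ts[Suc i := (int (r i) + -1, ?mk)] = snd (cmd_conf w q' (effect a s))"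
      unfolding ts list_update_code reg[OF i(1)] using assms(2) by (auto simp: cmd_conf_def s Dec of_nat_diff)
    then show ?thesis unfolding Dec moves.simps upd[OF i(2)] rdi[OF i(1)] tsi[OF i(1)] act.simps mark .
  next
    case InR
    have "?ts[0 := act (reads w s ! 0, 1) (?ts ! 0)] = snd (cmd_conf w q' (effect a s))"
      unfolding rd0 by (simp add: cmd_conf_def s InR)
    then show ?thesis unfolding InR moves.simps using upd[of 0] by simp
  next
    case InL
    have "?ts[0 := act (reads w s ! 0, -1) (?ts ! 0)] = snd (cmd_conf w q' (effect a s))"
      unfolding rd0 using assms(2) by (simp add: cmd_conf_def s InL of_nat_diff)
    then show ?thesis unfolding InL moves.simps using upd[of 0] by simp
  next
    case (Out b)
    have "?ts[Suc R := act (if b then 2 else 1, 1) (?ts ! Suc R)] = snd (cmd_conf w q' (effect a s))"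
      unfolding tsR act.simps unfolding ts list_update_code regs word_cells_snoc
      by (simp add: cmd_conf_def s Out)
    then show ?thesis unfolding Out moves.simps using upd[of "Suc R"] len(2) by simp
  qed
qed

lemma step_machine:
  assumes "q \<in> conts c0 []" "next_ctrl q (reads w s) = (q', as)"
    "map2 act as (snd (cmd_conf w q s)) = snd (cmd_conf w q' s')"
  shows "step machine (cmd_conf w q s) (cmd_conf w q' s')"
proof -
  have fst: "fst (cmd_conf w q s) = Suc (to_nat q)" for q s by (auto simp: cmd_conf_def split: prod.splits)
  have "(Suc (to_nat q), reads w s, Suc (to_nat q'), as) \<in> trans machine"
    unfolding machine_def using assms(1,2) reads_words[of w s]
      by (auto intro!: rev_image_eqI[of "(q, reads w s)"])
  then show ?thesis unfolding step_def using assms(3) by (auto simp: fst map_read_conf)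
qed

text \<open>The inclusion of the \<open>conts\<close> sets says that the machine for
  \<open>c0\<close> has rules for all control states that \<open>c\<close> passes through before
  \<open>k\<close>.\<close>

lemma exec_machine:
  "exec w c s t s' \<Longrightarrow> conts c k \<subseteq> conts c0 [] \<Longrightarrow> max_reg c < R \<Longrightarrow>
    (step machine ^^ t) (cmd_conf w (c # k) s) (cmd_conf w k s')"
proof (induction arbitrary: k rule: exec.induct)
  case (Skip s)
  then show ?case by (auto intro!: step_machine simp: act_stay_conf)
next
  case (Do a s)
  then show ?case by (auto intro!: step_machine act_moves_conf)
next
  case (Seq c s t s' d t' s'')
  have 1: "step machine (cmd_conf w (Seq c d # k) s) (cmd_conf w (c # d # k) s)"
    using Seq.prems by (auto intro!: step_machine simp: act_stay_conf)
  have 2: "(step machine ^^ t) (cmd_conf w (c # d # k) s) (cmd_conf w (d # k) s')"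
    "(step machine ^^ t') (cmd_conf w (d # k) s') (cmd_conf w k s'')"
    using Seq.prems by (auto intro!: Seq.IH)
  show ?case using relpowp_Suc_I2[OF 1 relpowp_trans[OF 2]] by simp
next
  case (IfT b s c t s' d)
  have 1: "step machine (cmd_conf w (If b c d # k) s) (cmd_conf w (c # k) s)"
    using IfT by (auto intro!: step_machine simp: act_stay_conf sees_iff)
  have 2: "(step machine ^^ t) (cmd_conf w (c # k) s) (cmd_conf w k s')"
    using IfT.prems by (auto intro!: IfT.IH)
  show ?case using relpowp_Suc_I2[OF 1 2] by simp
next
  case (IfF b s d t s' c)
  have 1: "step machine (cmd_conf w (If b c d # k) s) (cmd_conf w (d # k) s)"
    using IfF by (auto intro!: step_machine simp: act_stay_conf sees_iff)
  have 2: "(step machine ^^ t) (cmd_conf w (d # k) s) (cmd_conf w k s')"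
    using IfF.prems by (auto intro!: IfF.IH)
  show ?case using relpowp_Suc_I2[OF 1 2] by simp
next
  case (WhileT b s c t s' t' s'')
  let ?k = "While b c # k"
  have 1: "step machine (cmd_conf w ?k s) (cmd_conf w (c # ?k) s)"
    using WhileT by (auto intro!: step_machine simp: act_stay_conf sees_iff)
  have 2: "(step machine ^^ t) (cmd_conf w (c # ?k) s) (cmd_conf w ?k s')"
    "(step machine ^^ t') (cmd_conf w ?k s') (cmd_conf w k s'')"
    using WhileT.prems by (auto intro!: WhileT.IH)
  show ?case using relpowp_Suc_I2[OF 1 relpowp_trans[OF 2]] by simp
next
  case (WhileF b s c)
  then show ?case by (auto intro!: step_machine simp: act_stay_conf sees_iff)
qed

lemma step_init: "step machine (init_config machine w) (cmd_conf w [c0] (\<lambda>_. 0, 0, []))"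
proof -
  have "word_cells w 0 \<in> {0, 1, 2}" by (auto simp: word_cells_def)
  then have "(0, word_cells w 0 # replicate (R + 1) 0, Suc (to_nat [c0]),
      (word_cells w 0, 0) # replicate R (1, 0) @ [(0, 0)]) \<in> trans machine"
    unfolding machine_def by auto
  moreover have "map2 act (replicate R (1, 0) @ [(0, 0)]) (replicate (R + 1) (0, \<lambda>_. 0)) =
      map (\<lambda>i. (0, \<lambda>j. if j = 0 then 1 else 0)) [0..<R] @ [(0, word_cells [])]"
    by (rule nth_equalityI) (auto simp: nth_append word_cells_def fun_eq_iff simp del: replicate_Suc)
  ultimately show ?thesis unfolding step_def
    by (intro exI[of _ "(word_cells w 0, 0) # replicate R (1, 0) @ [(0, 0)]"])
      (auto simp: init_config_def cmd_conf_def machine_def simp del: replicate_Suc)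
qed

lemma halted_machine: "halted machine (cmd_conf w [] s)"
  unfolding halted_def step_def machine_def
  by (cases s) (auto simp: cmd_conf_def Nil_notin_conts)

end

section \<open>Determinism and halting time\<close>

lemma step_deterministic:
  assumes "deterministic M" "step M x y" "step M x z"
  shows "y = z"
proof -
  obtain as bs where 1: "(fst x, map read_tape (snd x), fst y, as) \<in> trans M" "snd y = map2 act as (snd x)"
    and 2: "(fst x, map read_tape (snd x), fst z, bs) \<in> trans M" "snd z = map2 act bs (snd x)"
    using assms(2,3) unfolding step_def by auto
  have "fst y = fst z \<and> as = bs"
    using assms(1)[unfolded deterministic_def, rule_format, OF 1(1) 2(1)] .
  with 1(2) 2(2) show ?thesis by (simp add: prod_eq_iff)
qed

lemma relpowp_deterministic:
  assumes "deterministic M"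
  shows "(step M ^^ t) x y \<Longrightarrow> (step M ^^ t) x z \<Longrightarrow> y = z"
proof (induction t arbitrary: y z)
  case (Suc t)
  from Suc.prems obtain y' z' where "(step M ^^ t) x y'" "step M y' y" "(step M ^^ t) x z'" "step M z' z"
    by (elim relpowp_Suc_E)
  with Suc.IH[of y' z'] step_deterministic[OF assms] show ?case by blast
qed simp

text \<open>\<open>poly_time\<close> restricts every computation; for a deterministic machine a
  single halting one limits the length of all others.\<close>

lemma halting_time:
  assumes "deterministic M" "(step M ^^ t) x y" "halted M y" "(step M ^^ t') x z"
  shows "t' \<le> t"
proof (rule ccontr)
  assume "\<not> t' \<le> t"
  then obtain d where "t' = t + Suc d" by (metis less_imp_Suc_add not_le add_Suc_right)
  with assms(4) have "((step M ^^ t) OO (step M ^^ Suc d)) x z" by (simp only: relpowp_add)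
  then obtain y' where y': "(step M ^^ t) x y'" "(step M ^^ Suc d) y' z" by blast
  have "y' = y" using relpowp_deterministic[OF assms(1) y'(1) assms(2)] .
  with y'(2) obtain y'' where "step M y y''" by (blast elim: relpowp_Suc_E2)
  with assms(3) show False unfolding halted_def by blast
qed

lemma poly_time_computable_exec:
  assumes "\<And>w. \<exists>t \<le> poly b (length w). \<exists>r p. exec w c (\<lambda>_. 0, 0, []) t (r, p, f w)"
  shows "poly_time_computable f"
proof -
  let ?R = "Suc (max_reg c)"
  let ?M = "machine c ?R"
  have R: "max_reg c < ?R" by simp
  \<comment> \<open>The summand 1 in the polynomial pays for the preparatory step.\<close>
  have main: "\<exists>t y. t \<le> poly (b + 1) (length w) \<and> (step ?M ^^ t) (init_config ?M w) y \<and> halted ?M y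
    \<and> snd (last (snd y)) = word_cells (f w)" for w
  proof -
    obtain t r p where t: "t \<le> poly b (length w)" and e: "exec w c (\<lambda>_. 0, 0, []) t (r, p, f w)"
      using assms by blast
    have "(step ?M ^^ Suc t) (init_config ?M w) (cmd_conf ?R w [] (r, p, f w))"
      by (rule relpowp_Suc_I2[OF step_init[OF R] exec_machine[OF R e subset_refl R]])
    moreover have "Suc t \<le> poly (b + 1) (length w)" using t by simp
    moreover have "snd (last (snd (cmd_conf ?R w [] (r, p, f w)))) = word_cells (f w)"
      by (simp add: cmd_conf_def[OF R])
    ultimately show ?thesis using halted_machine[OF R, of w "(r, p, f w)"] by blast
  qed
  have "t \<le> poly (b + 1) (length w)" if "(step ?M ^^ t) (init_config ?M w) y" for w t y
  proof -
    obtain t' y' where "t' \<le> poly (b + 1) (length w)" "(step ?M ^^ t') (init_config ?M w) y'"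
      "halted ?M y'" using main[of w] by blast
    with halting_time[OF deterministic_machine[OF R] this(2,3) that] show ?thesis by simp
  qed
  then have "poly_time ?M" unfolding poly_time_def by blast
  moreover have "computes ?M f" unfolding computes_def
  proof
    fix w
    obtain t y where "(step ?M ^^ t) (init_config ?M w) y" "halted ?M y"
      "snd (last (snd y)) = word_cells (f w)" using main[of w] by blast
    then show "\<exists>c. (step ?M)\<^sup>*\<^sup>* (init_config ?M w) c \<and> halted ?M c \<and> snd (last (snd c)) = word_cells (f w)"
      by (intro exI[of _ y]) (auto dest: relpowp_imp_rtranclp)
  qed
  ultimately show ?thesis unfolding poly_time_computable_def
    using wf_machine[OF R] deterministic_machine[OF R] by blast
qed

section \<open>Running-time bounds for program fragments\<close>

definition runs :: "bool list \<Rightarrow> cmd \<Rightarrow> state \<Rightarrow> nat \<Rightarrow> state \<Rightarrow> bool" where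
  "runs w c s T s' \<longleftrightarrow> (\<exists>t \<le> T. exec w c s t s')"

lemma runs_mono: "runs w c s T s' \<Longrightarrow> T \<le> T' \<Longrightarrow> runs w c s T' s'"
  unfolding runs_def by (meson le_trans)

lemma runs_Skip: "runs w Skip s 1 s"
  unfolding runs_def by (blast intro: exec.Skip)

lemma runs_Do: "enabled a s \<Longrightarrow> effect a s = s' \<Longrightarrow> runs w (Do a) s 1 s'"
  unfolding runs_def using exec.Do by blast

lemma runs_Seq:
  assumes "runs w c s T s'" "runs w d s' T' s''"
  shows "runs w (Seq c d) s (Suc (T + T')) s''"
proof -
  obtain t t' where "t \<le> T" "t' \<le> T'" "exec w c s t s'" "exec w d s' t' s''"
    using assms unfolding runs_def by auto
  then show ?thesis unfolding runs_def by (intro exI[of _ "Suc (t + t')"]) (auto intro: exec.Seq)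
qed

lemma runs_If:
  assumes "holds w b s \<Longrightarrow> runs w c s T s'" "\<not> holds w b s \<Longrightarrow> runs w d s T s'"
  shows "runs w (If b c d) s (Suc T) s'"
  using assms unfolding runs_def by (cases "holds w b s") (auto intro: exec.IfT exec.IfF)

text \<open>The loop is described in closed form: \<open>S i\<close> is the state at the loop head
  after \<open>i\<close> rounds.\<close>

lemma runs_While:
  assumes "\<And>i. i < m \<Longrightarrow> holds w b (S i)" "\<And>i. i < m \<Longrightarrow> runs w c (S i) T (S (Suc i))"
    "\<not> holds w b (S m)"
  shows "runs w (While b c) (S 0) (m * Suc T + 1) (S m)"
  using assms
proof (induction m arbitrary: S)
  case 0
  then have "exec w (While b c) (S 0) 1 (S 0)" by (intro exec.WhileF) auto
  then show ?case unfolding runs_def by (intro exI[of _ 1]) simp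
next
  case (Suc m)
  have "runs w (While b c) (S 1) (m * Suc T + 1) (S (Suc m))"
    using Suc.IH[of "\<lambda>i. S (Suc i)"] Suc.prems by auto
  then obtain t where t: "t \<le> m * Suc T + 1" "exec w (While b c) (S 1) t (S (Suc m))"
    unfolding runs_def by blast
  obtain t' where "t' \<le> T" "exec w c (S 0) t' (S 1)"
    using Suc.prems(2)[of 0] unfolding runs_def by auto
  with t Suc.prems(1)[of 0] show ?case
    unfolding runs_def by (intro exI[of _ "Suc (t' + t)"]) (auto intro!: exec.WhileT)
qed

lemma runs_eq: "runs w c s T s' \<Longrightarrow> s = s0 \<Longrightarrow> s' = s1 \<Longrightarrow> runs w c s0 T s1"
  by simp

definition mv :: "nat \<Rightarrow> nat \<Rightarrow> cmd" where
  "mv x y = While (NZ x) (Seq (Do (Dec x)) (Do (Inc y)))"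

lemma runs_mv:
  assumes "x \<noteq> y" "r x \<le> M"
  shows "runs w (mv x y) (r, p, u) (4 * M + 1) (r(x := 0, y := r y + r x), p, u)"
proof -
  let ?S = "\<lambda>i. (r(x := r x - i, y := r y + i), p, u)"
  have "runs w (mv x y) (?S 0) (r x * Suc (Suc (1 + 1)) + 1) (?S (r x))"
    unfolding mv_def
    by (rule runs_While; (rule runs_Seq[OF runs_Do[OF _ refl] runs_Do])?)
      (use assms(1) in \<open>auto simp: fun_eq_iff\<close>)
  then show ?thesis using assms by (auto simp del: fun_upd_apply elim!: runs_mono)
qed

definition clr :: "nat \<Rightarrow> cmd" where
  "clr x = While (NZ x) (Do (Dec x))"

lemma runs_clr:
  assumes "r x \<le> M"
  shows "runs w (clr x) (r, p, u) (2 * M + 1) (r(x := 0), p, u)"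
proof -
  let ?S = "\<lambda>i. (r(x := r x - i), p, u)"
  have "runs w (clr x) (?S 0) (r x * Suc 1 + 1) (?S (r x))"
    unfolding clr_def by (rule runs_While; (rule runs_Do)?) (auto simp: fun_eq_iff)
  then show ?thesis using assms by (auto simp del: fun_upd_apply elim!: runs_mono)
qed

text \<open>Register \<open>b\<close> counts the remaining rounds and \<open>Suc b\<close> saves the
  outer value of \<open>x\<close>, which is restored at the end; a bound variable may therefore
  shadow an outer one, as in \<open>nval\<close>.\<close>

definition for_loop :: "nat \<Rightarrow> nat \<Rightarrow> cmd \<Rightarrow> cmd" where
  "for_loop x b c = Seq (mv x (Suc b))
     (Seq (While (NZ b) (Seq (Do (Dec b)) (Seq c (Do (Inc x)))))
     (Seq (clr x) (mv (Suc b) x)))"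

text \<open>After \<open>i\<close> rounds, \<open>g i\<close> gives the registers apart from the
  three that the loop itself manages, and \<open>u i\<close> the output.\<close>

lemma runs_for_loop:
  assumes "x < b" "y \<le> M" "m \<le> N"
    and body: "\<And>i. i < m \<Longrightarrow>
      runs w c ((g i)(x := i, b := m - Suc i, Suc b := y), p, u i) T
        ((g (Suc i))(x := i, b := m - Suc i, Suc b := y), p, u (Suc i))"
  shows "runs w (for_loop x b c) ((g 0)(x := y, b := m, Suc b := 0), p, u 0)
    (8 * M + N * (T + 7) + 8) ((g m)(x := y, b := 0, Suc b := 0), p, u m)"
proof -
  let ?S = "\<lambda>i. ((g i)(x := i, b := m - i, Suc b := y), p, u i)"
  let ?b = "Seq (Do (Dec b)) (Seq c (Do (Inc x)))"
  have bx: "b \<noteq> x" "x \<noteq> Suc b" "Suc b \<noteq> x" using assms(1) by auto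
  have 1: "runs w (mv x (Suc b)) ((g 0)(x := y, b := m, Suc b := 0), p, u 0) (4 * M + 1) (?S 0)"
    using runs_mv[OF bx(2), of "(g 0)(x := y, b := m, Suc b := 0)" M w p "u 0"] assms(2) bx
    by (simp add: fun_upd_twist)
  have 2: "runs w (While (NZ b) ?b) (?S 0) (m * Suc (Suc (1 + Suc (T + 1))) + 1) (?S m)"
  proof (rule runs_While)
    fix i assume i: "i < m"
    then show "runs w ?b (?S i) (Suc (1 + Suc (T + 1))) (?S (Suc i))"
      by (intro runs_Seq[OF runs_Do runs_Seq[OF body[OF i] runs_Do]]) (use bx in \<open>auto simp: fun_eq_iff\<close>)
  qed auto
  have 3: "runs w (clr x) (?S m) (2 * N + 1) ((g m)(x := 0, b := 0, Suc b := y), p, u m)"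
    using runs_clr[of "(g m)(x := m, b := 0, Suc b := y)" x N w p "u m"] assms(3) bx
    by (simp add: fun_upd_twist)
  have 4: "runs w (mv (Suc b) x) ((g m)(x := 0, b := 0, Suc b := y), p, u m) (4 * M + 1)
      ((g m)(x := y, b := 0, Suc b := 0), p, u m)"
    using runs_mv[OF bx(3), of "(g m)(x := 0, b := 0, Suc b := y)" M w p "u m"] assms(2) bx
    by (simp add: fun_upd_twist)
  have "m * Suc (Suc (1 + Suc (T + 1))) \<le> N * (T + 5)"
    using assms(3) by (intro mult_mono) auto
  then show ?thesis unfolding for_loop_def
    by (intro runs_mono[OF runs_Seq[OF 1 runs_Seq[OF 2 runs_Seq[OF 3 4]]]]) (simp add: algebra_simps)
qed

section \<open>Arithmetic expressions and their programs\<close>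

datatype nexp = Var nat | Const nat | Len | Inp nexp | Add nexp nexp | Sub nexp nexp
  | Sum nat nexp nexp

text \<open>Bounded sums are the only form of iteration, so values stay polynomially bounded;
  products, quotients and substitution are derived from them later.\<close>

fun nval :: "bool list \<Rightarrow> (nat \<Rightarrow> nat) \<Rightarrow> nexp \<Rightarrow> nat" where
  "nval w v (Var x) = v x"
| "nval w v (Const k) = k"
| "nval w v Len = length w"
| "nval w v (Inp e) = word_cells w (int (nval w v e))"
| "nval w v (Add e1 e2) = nval w v e1 + nval w v e2"
| "nval w v (Sub e1 e2) = nval w v e1 - nval w v e2"
| "nval w v (Sum x e1 e2) = (\<Sum>i<nval w v e1. nval w (v(x := i)) e2)"

fun vars :: "nexp \<Rightarrow> nat set" where
  "vars (Var x) = {x}"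
| "vars (Const k) = {}"
| "vars Len = {}"
| "vars (Inp e) = vars e"
| "vars (Add e1 e2) = vars e1 \<union> vars e2"
| "vars (Sub e1 e2) = vars e1 \<union> vars e2"
| "vars (Sum x e1 e2) = insert x (vars e1 \<union> vars e2)"

lemma finite_vars [simp]: "finite (vars e)"
  by (induction e) auto

lemma nval_cong: "(\<And>x. x \<in> vars e \<Longrightarrow> v x = v' x) \<Longrightarrow> nval w v e = nval w v' e"
proof (induction e arbitrary: v v')
  case (Sum x e1 e2)
  have "nval w v e1 = nval w v' e1" by (rule Sum.IH(1)) (use Sum.prems in auto)
  moreover have "nval w (v(x := i)) e2 = nval w (v'(x := i)) e2" for i
    by (rule Sum.IH(2)) (use Sum.prems in auto)
  ultimately show ?case by simp
next
  case (Inp e)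
  then show ?case by (metis nval.simps(4) vars.simps(4))
next
  case (Add e1 e2)
  then show ?case by (metis UnI1 UnI2 nval.simps(5) vars.simps(5))
next
  case (Sub e1 e2)
  then show ?case by (metis UnI1 UnI2 nval.simps(6) vars.simps(6))
qed auto

text \<open>The value of \<open>e\<close> is added to register \<open>d\<close>; registers from \<open>b\<close> on are zero scratch space.\<close>

fun compile :: "nexp \<Rightarrow> nat \<Rightarrow> nat \<Rightarrow> cmd" where
  "compile (Var x) d b = Seq (While (NZ x) (Seq (Do (Dec x)) (Seq (Do (Inc d)) (Do (Inc b))))) (mv b x)"
| "compile (Const k) d b = ((\<lambda>c. Seq (Do (Inc d)) c) ^^ k) Skip"
| "compile Len d b = Seq (While (InGe 1) (Seq (Do InR) (Seq (Do (Inc d)) (Do (Inc b)))))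
     (While (NZ b) (Seq (Do (Dec b)) (Do InL)))"
| "compile (Inp e) d b = Seq (compile e b (b + 2))
     (Seq (While (NZ b) (Seq (Do (Dec b)) (Seq (Do (Inc (Suc b))) (Do InR))))
     (Seq (If (InGe 1) (Do (Inc d)) Skip)
     (Seq (If (InGe 2) (Do (Inc d)) Skip)
       (While (NZ (Suc b)) (Seq (Do (Dec (Suc b))) (Do InL))))))"
| "compile (Add e1 e2) d b = Seq (compile e1 d b) (compile e2 d b)"
| "compile (Sub e1 e2) d b = Seq (compile e1 b (b + 2)) (Seq (compile e2 (Suc b) (b + 2))
     (Seq (While (NZ (Suc b)) (Seq (Do (Dec (Suc b))) (If (NZ b) (Do (Dec b)) Skip)))
       (mv b d)))"
| "compile (Sum x e1 e2) d b = Seq (compile e1 b (b + 2)) (for_loop x b (compile e2 d (b + 2)))"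

text \<open>
  Bounds for the value and the running time when the variables are at most \<open>M\<close> and the input has
  length \<open>l\<close>.
\<close>

fun val_bound :: "nexp \<Rightarrow> nat \<Rightarrow> nat \<Rightarrow> nat" where
  "val_bound (Var x) M l = M"
| "val_bound (Const k) M l = k"
| "val_bound Len M l = l"
| "val_bound (Inp e) M l = 2"
| "val_bound (Add e1 e2) M l = val_bound e1 M l + val_bound e2 M l"
| "val_bound (Sub e1 e2) M l = val_bound e1 M l"
| "val_bound (Sum x e1 e2) M l =
     val_bound e1 M l * val_bound e2 (M + val_bound e1 M l) l"

fun time_bound :: "nexp \<Rightarrow> nat \<Rightarrow> nat \<Rightarrow> nat" where
  "time_bound (Var x) M l = 10 * M + 3"
| "time_bound (Const k) M l = 2 * k + 1"
| "time_bound Len M l = 10 * l + 3"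
| "time_bound (Inp e) M l = time_bound e M l + 10 * val_bound e M l + 15"
| "time_bound (Add e1 e2) M l = time_bound e1 M l + time_bound e2 M l + 1"
| "time_bound (Sub e1 e2) M l = time_bound e1 M l + time_bound e2 M l
     + 5 * val_bound e2 M l + 4 * val_bound e1 M l + 5"
| "time_bound (Sum x e1 e2) M l = time_bound e1 M l + 8 * M +
     val_bound e1 M l * (time_bound e2 (M + val_bound e1 M l) l + 7) + 9"

lemma nval_le: "(\<And>x. x \<in> vars e \<Longrightarrow> v x \<le> M) \<Longrightarrow> nval w v e \<le> val_bound e M (length w)"
proof (induction e arbitrary: v M)
  case (Inp e)
  then show ?case by (auto simp: word_cells_def)
next
  case (Add e1 e2)
  then show ?case by (auto intro!: add_mono)
next
  case (Sub e1 e2)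
  have "nval w v e1 \<le> val_bound e1 M (length w)" by (rule Sub.IH(1)) (use Sub.prems in auto)
  then show ?case by simp
next
  case (Sum x e1 e2)
  let ?B = "val_bound e1 M (length w)"
  have 1: "nval w v e1 \<le> ?B" by (rule Sum.IH(1)) (use Sum.prems in auto)
  have "(\<Sum>i<nval w v e1. nval w (v(x := i)) e2) \<le> (\<Sum>i<nval w v e1. val_bound e2 (M + ?B) (length w))"
  proof (rule sum_mono)
    fix i assume "i \<in> {..<nval w v e1}"
    then show "nval w (v(x := i)) e2 \<le> val_bound e2 (M + ?B) (length w)"
      by (intro Sum.IH(2)) (use 1 Sum.prems in \<open>auto intro: trans_le_add1\<close>)
  qed
  also have "\<dots> \<le> ?B * val_bound e2 (M + ?B) (length w)" using 1 by simp
  finally show ?case by simp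
qed auto

lemma runs_incs: "runs w (((\<lambda>c. Seq (Do (Inc d)) c) ^^ k) Skip) (r, p, u) (2 * k + 1) (r(d := r d + k), p, u)"
proof (induction k arbitrary: r)
  case 0
  then show ?case using runs_Skip by simp
next
  case (Suc k)
  have "runs w (Seq (Do (Inc d)) (((\<lambda>c. Seq (Do (Inc d)) c) ^^ k) Skip)) (r, p, u)
      (Suc (1 + (2 * k + 1))) (r(d := r d + Suc k), p, u)"
    by (rule runs_Seq[OF runs_Do[OF _ refl]], simp, rule runs_eq[OF Suc.IH[of "r(d := Suc (r d))"]]) auto
  then show ?case by (simp del: fun_upd_apply)
qed

lemma word_cells_ge_1: "word_cells w (int i) \<ge> Suc 0 \<longleftrightarrow> i < length w"
  by (auto simp: word_cells_def)

text \<open>Variables are read destructively and restored, and the head returns to cell 0, so that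
  only \<open>d\<close> changes in the end. As \<open>d\<close> may be incremented while variables
  are still to be read, it must not occur in \<open>e\<close>.\<close>

lemma runs_compile:
  "d \<notin> vars e \<Longrightarrow> d < b \<Longrightarrow> vars e \<subseteq> {..<b} \<Longrightarrow> (\<And>i. i \<ge> b \<Longrightarrow> r i = 0) \<Longrightarrow>
   (\<And>x. x \<in> vars e \<Longrightarrow> r x \<le> M) \<Longrightarrow>
   runs w (compile e d b) (r, 0, u) (time_bound e M (length w)) (r(d := r d + nval w r e), 0, u)"
proof (induction e arbitrary: d b r M)
  case (Var x)
  have ne: "d \<noteq> x" "b \<noteq> x" "b \<noteq> d" and b: "r b = 0" and M: "r x \<le> M" using Var.prems by auto
  let ?S = "\<lambda>i. (r(x := r x - i, d := r d + i, b := i), 0, u)"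
  have 1: "runs w (While (NZ x) (Seq (Do (Dec x)) (Seq (Do (Inc d)) (Do (Inc b))))) (?S 0)
      (r x * Suc (Suc (1 + Suc (1 + 1))) + 1) (?S (r x))"
    by (rule runs_While; (rule runs_Seq[OF runs_Do[OF _ refl] runs_Seq[OF runs_Do[OF _ refl] runs_Do]])?)
      (use ne in \<open>auto simp: fun_eq_iff\<close>)
  have S0: "?S 0 = (r, 0, u)" using b by (auto simp: fun_eq_iff)
  have 2: "runs w (mv b x) (?S (r x)) (4 * M + 1) (r(d := r d + r x), 0, u)"
    using runs_mv[OF ne(2), of "r(x := 0, d := r d + r x, b := r x)" M w 0 u] ne M b
    by (auto elim!: back_subst[of "\<lambda>s. runs _ _ _ _ s"] simp: fun_eq_iff)
  show ?case using runs_Seq[OF 1 2] M unfolding S0 by (auto simp del: fun_upd_apply elim!: runs_mono)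
next
  case (Const k)
  then show ?case using runs_incs by (simp del: fun_upd_apply)
next
  case Len
  have ne: "b \<noteq> d" and b: "r b = 0" using Len.prems by auto
  let ?l = "length w"
  let ?S = "\<lambda>i. (r(d := r d + i, b := i), i, u)"
  have 1: "runs w (While (InGe 1) (Seq (Do InR) (Seq (Do (Inc d)) (Do (Inc b))))) (?S 0)
      (?l * Suc (Suc (1 + Suc (1 + 1))) + 1) (?S ?l)"
    by (rule runs_While; (rule runs_Seq[OF runs_Do[OF _ refl] runs_Seq[OF runs_Do[OF _ refl] runs_Do]])?)
      (use ne in \<open>auto simp: fun_eq_iff word_cells_ge_1\<close>)
  have S0: "?S 0 = (r, 0, u)" using b by (auto simp: fun_eq_iff)
  let ?S' = "\<lambda>i. (r(d := r d + ?l, b := ?l - i), ?l - i, u)"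
  have 2: "runs w (While (NZ b) (Seq (Do (Dec b)) (Do InL))) (?S' 0) (?l * Suc (Suc (1 + 1)) + 1) (?S' ?l)"
    by (rule runs_While; (rule runs_Seq[OF runs_Do[OF _ refl] runs_Do])?)
      (use ne in \<open>auto simp: fun_eq_iff\<close>)
  have S: "?S ?l = ?S' 0" "?S' ?l = (r(d := r d + ?l), 0, u)" using b ne by (auto simp: fun_eq_iff)
  show ?case using runs_Seq[OF 1 2[folded S(1)]] unfolding S0 S(2)
    by (auto simp del: fun_upd_apply elim!: runs_mono)
next
  case (Inp e)
  let ?e = "nval w r e" and ?B = "val_bound e M (length w)"
  have ne: "b \<noteq> d" "d \<noteq> Suc b" and b: "r b = 0" "r (Suc b) = 0" using Inp.prems by auto
  have e: "?e \<le> ?B" by (rule nval_le) (use Inp.prems in auto)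
  have 1: "runs w (compile e b (b + 2)) (r, 0, u) (time_bound e M (length w)) (r(b := r b + ?e), 0, u)"
    by (rule Inp.IH) (use Inp.prems in auto)
  let ?S = "\<lambda>i. (r(b := ?e - i, Suc b := i), i, u)"
  have 2: "runs w (While (NZ b) (Seq (Do (Dec b)) (Seq (Do (Inc (Suc b))) (Do InR)))) (?S 0)
      (?e * Suc (Suc (1 + Suc (1 + 1))) + 1) (?S ?e)"
    by (rule runs_While; (rule runs_Seq[OF runs_Do[OF _ refl] runs_Seq[OF runs_Do[OF _ refl] runs_Do]])?)
      (auto simp: fun_eq_iff)
  have S0: "?S 0 = (r(b := r b + ?e), 0, u)" using b by (auto simp: fun_eq_iff)
  let ?c = "word_cells w (int ?e)"
  let ?Q = "\<lambda>k i. (r(d := r d + k, Suc b := ?e - i), ?e - i, u)"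
  \<comment> \<open>The scanned symbol is 0, 1 or 2, hence equal to the number of passed tests among
    \<open>InGe 1\<close> and \<open>InGe 2\<close>.\<close>
  have 3: "runs w (If (InGe 1) (Do (Inc d)) Skip) (?S ?e) (Suc 1) (?Q (of_bool (?c \<ge> 1)) 0)"
    by (rule runs_If; cases "?c \<ge> 1"; (rule runs_Do)?)
      (use ne b runs_Skip[of w "?S ?e"] in \<open>auto simp: fun_eq_iff elim!: back_subst[of
        "\<lambda>s. runs w Skip _ _ s"]\<close>)
  have 4: "runs w (If (InGe 2) (Do (Inc d)) Skip) (?Q (of_bool (?c \<ge> 1)) 0) (Suc 1) (?Q ?c 0)"
  proof -
    consider "?c = 0" | "?c = 1" | "?c = 2" unfolding word_cells_def by (metis (full_types))
    then show ?thesis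
      by cases (rule runs_If; (rule runs_Do)?; use ne b runs_Skip[of w "?Q (of_bool (?c \<ge> 1)) 0"] in
        \<open>auto simp: fun_eq_iff\<close>)+
  qed
  have 5: "runs w (While (NZ (Suc b)) (Seq (Do (Dec (Suc b))) (Do InL))) (?Q ?c 0) (?e * Suc (Suc (1 +
    1)) + 1) (?Q ?c ?e)"
    by (rule runs_While; (rule runs_Seq[OF runs_Do[OF _ refl] runs_Do])?)
      (use ne in \<open>auto simp: fun_eq_iff\<close>)
  have Q: "?Q ?c ?e = (r(d := r d + nval w r (Inp e)), 0, u)" using b ne by (auto simp: fun_eq_iff)
  show ?case
    using runs_Seq[OF 1 runs_Seq[OF 2[unfolded S0] runs_Seq[OF 3 runs_Seq[OF 4 5]]]] e
    unfolding Q by (auto simp del: fun_upd_apply elim!: runs_mono)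
next
  case (Add e1 e2)
  have 1: "runs w (compile e1 d b) (r, 0, u) (time_bound e1 M (length w)) (r(d := r d + nval w r e1), 0, u)"
    by (rule Add.IH) (use Add.prems in auto)
  have "nval w (r(d := r d + nval w r e1)) e2 = nval w r e2"
    by (rule nval_cong) (use Add.prems in auto)
  moreover have "(r(d := r d + nval w r e1)) x \<le> M" if "x \<in> vars e2" for x
    using that Add.prems by auto
  ultimately have 2: "runs w (compile e2 d b) (r(d := r d + nval w r e1), 0, u) (time_bound e2 M (length w))
      (r(d := r d + (nval w r e1 + nval w r e2)), 0, u)"
    by (intro runs_eq[OF Add.IH(2)[of d b "r(d := r d + nval w r e1)" M]])
      (use Add.prems in \<open>auto simp del: fun_upd_apply simp: fun_upd_same fun_upd_other add.assoc\<close>)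
  show ?case using runs_Seq[OF 1 2] by (auto simp del: fun_upd_apply elim!: runs_mono)
next
  case (Sub e1 e2)
  let ?e1 = "nval w r e1" and ?e2 = "nval w r e2"
  let ?B1 = "val_bound e1 M (length w)" and ?B2 = "val_bound e2 M (length w)"
  have ne: "b \<noteq> d" "d \<noteq> Suc b" "b \<notin> vars e2" "b \<notin> vars e1" and b: "r b = 0" "r (Suc b) = 0"
    using Sub.prems by auto
  have B: "?e1 \<le> ?B1" "?e2 \<le> ?B2" by (rule nval_le; use Sub.prems in auto)+
  have 1: "runs w (compile e1 b (b + 2)) (r, 0, u) (time_bound e1 M (length w)) (r(b := ?e1), 0, u)"
    by (intro runs_eq[OF Sub.IH(1)[of b "b + 2" r M]]) (use Sub.prems in auto)
  have "nval w (r(b := ?e1)) e2 = ?e2" by (rule nval_cong) (use ne in auto)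
  moreover have "runs w (compile e2 (Suc b) (b + 2)) (r(b := ?e1), 0, u) (time_bound e2 M (length w))
      ((r(b := ?e1))(Suc b := (r(b := ?e1)) (Suc b) + nval w (r(b := ?e1)) e2), 0, u)"
    by (rule Sub.IH(2)) (use Sub.prems in auto)
  ultimately have 2: "runs w (compile e2 (Suc b) (b + 2)) (r(b := ?e1), 0, u) (time_bound e2 M (length w))
      (r(b := ?e1, Suc b := ?e2), 0, u)"
    using b by simp
  let ?S = "\<lambda>i. (r(b := ?e1 - i, Suc b := ?e2 - i), 0, u)"
  \<comment> \<open>The guarded decrement truncates the difference: \<open>b\<close> stays 0 once it
    is exhausted.\<close>
  have 3: "runs w (While (NZ (Suc b)) (Seq (Do (Dec (Suc b))) (If (NZ b) (Do (Dec b)) Skip)))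
      (?S 0) (?e2 * Suc (Suc (1 + Suc 1)) + 1) (?S ?e2)"
  proof (rule runs_While)
    fix i assume i: "i < ?e2"
    let ?s = "(r(b := ?e1 - i, Suc b := ?e2 - Suc i), 0, u)"
    have "runs w (If (NZ b) (Do (Dec b)) Skip) ?s (Suc 1) (?S (Suc i))"
      by (rule runs_If; (rule runs_Do)?) (use runs_Skip[of w ?s] in \<open>auto simp: fun_eq_iff Suc_diff_Suc\<close>)
    then show "runs w (Seq (Do (Dec (Suc b))) (If (NZ b) (Do (Dec b)) Skip)) (?S i) (Suc (1 + Suc 1))
      (?S (Suc i))"
      using i by (intro runs_Seq[OF runs_Do]) (auto simp: fun_eq_iff)
  qed auto
  have 4: "runs w (mv b d) (?S ?e2) (4 * ?B1 + 1) (r(d := r d + (?e1 - ?e2)), 0, u)"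
    by (rule runs_eq[OF runs_mv[OF ne(1), of "r(b := ?e1 - ?e2, Suc b := 0)" ?B1 w 0 u]])
      (use ne b B in \<open>auto simp: fun_eq_iff\<close>)
  have S0: "?S 0 = (r(b := ?e1, Suc b := ?e2), 0, u)" by simp
  show ?case
    using runs_Seq[OF 1 runs_Seq[OF 2 runs_Seq[OF 3[unfolded S0] 4]]] B
    by (auto simp del: fun_upd_apply elim!: runs_mono)
next
  case (Sum x e1 e2)
  let ?m = "nval w r e1" and ?B = "val_bound e1 M (length w)"
  let ?f = "\<lambda>i. nval w (r(x := i)) e2"
  have ne: "b \<noteq> d" "d \<noteq> Suc b" "b \<notin> vars e2" "Suc b \<notin> vars e2" "x < b" "x \<noteq> d" "r x \<le> M"
    and b: "r b = 0" "r (Suc b) = 0"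
    using Sum.prems by auto
  have B: "?m \<le> ?B" by (rule nval_le) (use Sum.prems in auto)
  have 1: "runs w (compile e1 b (b + 2)) (r, 0, u) (time_bound e1 M (length w)) (r(b := ?m), 0, u)"
    by (intro runs_eq[OF Sum.IH(1)[of b "b + 2" r M]]) (use Sum.prems in auto)
  let ?g = "\<lambda>i. r(d := r d + (\<Sum>j<i. ?f j))"
  have 2: "runs w (for_loop x b (compile e2 d (b + 2))) ((?g 0)(x := r x, b := ?m, Suc b := 0), 0, u)
      (8 * M + ?B * (time_bound e2 (M + ?B) (length w) + 7) + 8)
      ((?g ?m)(x := r x, b := 0, Suc b := 0), 0, u)"
  proof (rule runs_for_loop[where u = "\<lambda>_. u"])
    fix i assume i: "i < ?m"
    let ?r = "(?g i)(x := i, b := ?m - Suc i, Suc b := r x)"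
    have ev: "nval w ?r e2 = ?f i" by (rule nval_cong) (use Sum.prems in auto)
    have "runs w (compile e2 d (b + 2)) (?r, 0, u) (time_bound e2 (M + ?B) (length w))
      (?r(d := ?r d + nval w ?r e2), 0, u)"
      by (rule Sum.IH(2)) (use Sum.prems i B in \<open>auto intro: trans_le_add1\<close>)
    then show "runs w (compile e2 d (b + 2)) (?r, 0, u) (time_bound e2 (M + ?B) (length w))
      ((?g (Suc i))(x := i, b := ?m - Suc i, Suc b := r x), 0, u)"
      by (rule back_subst[of "\<lambda>s. runs w _ _ _ s"]) (use ne in \<open>auto simp: ev fun_eq_iff\<close>)
  qed (use ne B in auto)
  have 3: "(?g 0)(x := r x, b := ?m, Suc b := 0) = r(b := ?m)"
    "(?g ?m)(x := r x, b := 0, Suc b := 0) = r(d := r d + nval w r (Sum x e1 e2))"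
    using ne b by (auto simp: fun_eq_iff)
  show ?case using runs_Seq[OF 1 2[unfolded 3]] by (auto simp del: fun_upd_apply elim!: runs_mono)
qed

section \<open>Expressions that print bit strings\<close>

datatype oexp = OBit bool | OSeq oexp oexp | OIf nexp oexp oexp | OFor nat nexp oexp

fun oval :: "bool list \<Rightarrow> (nat \<Rightarrow> nat) \<Rightarrow> oexp \<Rightarrow> bool list" where
  "oval w v (OBit b) = [b]"
| "oval w v (OSeq o1 o2) = oval w v o1 @ oval w v o2"
| "oval w v (OIf e o1 o2) = (if nval w v e \<noteq> 0 then oval w v o1 else oval w v o2)"
| "oval w v (OFor x e o1) = concat (map (\<lambda>i. oval w (v(x := i)) o1) [0..<nval w v e])"

fun ovars :: "oexp \<Rightarrow> nat set" where
  "ovars (OBit b) = {}"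
| "ovars (OSeq o1 o2) = ovars o1 \<union> ovars o2"
| "ovars (OIf e o1 o2) = vars e \<union> ovars o1 \<union> ovars o2"
| "ovars (OFor x e o1) = insert x (vars e \<union> ovars o1)"

lemma finite_ovars: "finite (ovars e)"
  by (induction e) auto

lemma oval_cong: "(\<And>x. x \<in> ovars e \<Longrightarrow> v x = v' x) \<Longrightarrow> oval w v e = oval w v' e"
proof (induction e arbitrary: v v')
  case (OSeq o1 o2)
  then show ?case by (metis UnI1 UnI2 oval.simps(2) ovars.simps(2))
next
  case (OIf e o1 o2)
  have "nval w v e = nval w v' e" by (rule nval_cong) (use OIf.prems in auto)
  moreover have "oval w v o1 = oval w v' o1" "oval w v o2 = oval w v' o2"
    by (rule OIf.IH; use OIf.prems in auto)+
  ultimately show ?case by simp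
next
  case (OFor x e o1)
  have "nval w v e = nval w v' e" by (rule nval_cong) (use OFor.prems in auto)
  moreover have "oval w (v(x := i)) o1 = oval w (v'(x := i)) o1" for i
    by (rule OFor.IH) (use OFor.prems in auto)
  ultimately show ?case by simp
qed auto

text \<open>Each branch of \<open>OIf\<close> begins by clearing the condition register, so that its
  code finds the scratch space zero again.\<close>

fun ocompile :: "oexp \<Rightarrow> nat \<Rightarrow> cmd" where
  "ocompile (OBit c) b = Do (Out c)"
| "ocompile (OSeq o1 o2) b = Seq (ocompile o1 b) (ocompile o2 b)"
| "ocompile (OIf e o1 o2) b = Seq (compile e b (b + 2))
     (If (NZ b) (Seq (clr b) (ocompile o1 b)) (Seq (clr b) (ocompile o2 b)))"
| "ocompile (OFor x e o1) b = Seq (compile e b (b + 2)) (for_loop x b (ocompile o1 (b + 2)))"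

fun otime :: "oexp \<Rightarrow> nat \<Rightarrow> nat \<Rightarrow> nat" where
  "otime (OBit b) M l = 1"
| "otime (OSeq o1 o2) M l = otime o1 M l + otime o2 M l + 1"
| "otime (OIf e o1 o2) M l = time_bound e M l + 2 * val_bound e M l + otime o1 M l + otime o2 M l + 4"
| "otime (OFor x e o1) M l = time_bound e M l + 8 * M +
     val_bound e M l * (otime o1 (M + val_bound e M l) l + 7) + 9"

lemma runs_ocompile:
  "ovars e \<subseteq> {..<b} \<Longrightarrow> (\<And>i. i \<ge> b \<Longrightarrow> r i = 0) \<Longrightarrow> (\<And>x. x \<in> ovars e \<Longrightarrow> r x \<le> M) \<Longrightarrow>
   runs w (ocompile e b) (r, 0, u) (otime e M (length w)) (r, 0, u @ oval w r e)"
proof (induction e arbitrary: b r M u)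
  case (OBit c)
  show ?case unfolding ocompile.simps otime.simps oval.simps by (rule runs_Do) auto
next
  case (OSeq o1 o2)
  have "runs w (ocompile o1 b) (r, 0, u) (otime o1 M (length w)) (r, 0, u @ oval w r o1)"
    "runs w (ocompile o2 b) (r, 0, u @ oval w r o1) (otime o2 M (length w)) (r, 0, (u @ oval w r o1) @
      oval w r o2)"
    by (rule OSeq.IH; use OSeq.prems in auto)+
  from runs_Seq[OF this] show ?case by (auto simp del: fun_upd_apply elim!: runs_mono)
next
  case (OIf e o1 o2)
  let ?m = "nval w r e" and ?B = "val_bound e M (length w)"
  have B: "?m \<le> ?B" by (rule nval_le) (use OIf.prems in auto)
  have 1: "runs w (compile e b (b + 2)) (r, 0, u) (time_bound e M (length w)) (r(b := ?m), 0, u)"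
    by (intro runs_eq[OF runs_compile[of b e "b + 2" r M]]) (use OIf.prems in auto)
  have "runs w (clr b) (r(b := ?m), 0, u) (2 * ?B + 1) ((r(b := ?m))(b := 0), 0, u)"
    by (rule runs_clr) (use B in auto)
  moreover have "(r(b := ?m))(b := 0) = r" using OIf.prems(2) by (auto simp: fun_eq_iff)
  ultimately have 2: "runs w (clr b) (r(b := ?m), 0, u) (2 * ?B + 1) (r, 0, u)" by metis
  let ?T = "Suc (2 * ?B + 1 + (otime o1 M (length w) + otime o2 M (length w)))"
  have 3: "runs w (ocompile o1 b) (r, 0, u) (otime o1 M (length w)) (r, 0, u @ oval w r o1)"
    "runs w (ocompile o2 b) (r, 0, u) (otime o2 M (length w)) (r, 0, u @ oval w r o2)"
    by (rule OIf.IH; use OIf.prems in auto)+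
  have 4: "runs w (If (NZ b) (Seq (clr b) (ocompile o1 b)) (Seq (clr b) (ocompile o2 b))) (r(b := ?m), 0, u)
     (Suc ?T) (r, 0, u @ oval w r (OIf e o1 o2))"
    by (rule runs_If) (use runs_Seq[OF 2 3(1)] runs_Seq[OF 2 3(2)] in \<open>auto elim!: runs_mono\<close>)
  show ?case using runs_Seq[OF 1 4] by (auto simp del: fun_upd_apply elim!: runs_mono)
next
  case (OFor x e o1)
  let ?m = "nval w r e" and ?B = "val_bound e M (length w)"
  let ?u = "\<lambda>i. u @ concat (map (\<lambda>j. oval w (r(x := j)) o1) [0..<i])"
  have ne: "x < b" "r x \<le> M" and b: "r b = 0" "r (Suc b) = 0"
    using OFor.prems by auto
  have B: "?m \<le> ?B" by (rule nval_le) (use OFor.prems in auto)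
  have 1: "runs w (compile e b (b + 2)) (r, 0, u) (time_bound e M (length w)) (r(b := ?m), 0, u)"
    by (intro runs_eq[OF runs_compile[of b e "b + 2" r M]]) (use OFor.prems in auto)
  have 2: "runs w (for_loop x b (ocompile o1 (b + 2))) (r(x := r x, b := ?m, Suc b := 0), 0, ?u 0)
      (8 * M + ?B * (otime o1 (M + ?B) (length w) + 7) + 8)
      (r(x := r x, b := 0, Suc b := 0), 0, ?u ?m)"
  proof (rule runs_for_loop[where u = ?u and g = "\<lambda>_. r"])
    fix i assume i: "i < ?m"
    let ?r = "r(x := i, b := ?m - Suc i, Suc b := r x)"
    have ev: "oval w ?r o1 = oval w (r(x := i)) o1" by (rule oval_cong) (use OFor.prems in auto)
    have "runs w (ocompile o1 (b + 2)) (?r, 0, ?u i) (otime o1 (M + ?B) (length w))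
      (?r, 0, ?u i @ oval w ?r o1)"
      by (rule OFor.IH) (use OFor.prems i B in \<open>auto intro: trans_le_add1\<close>)
    then show "runs w (ocompile o1 (b + 2)) (?r, 0, ?u i) (otime o1 (M + ?B) (length w)) (?r, 0, ?u (Suc i))"
      by (simp add: ev)
  qed (use ne B in auto)
  have 3: "r(x := r x, b := ?m, Suc b := 0) = r(b := ?m)" "r(x := r x, b := 0, Suc b := 0) = r" "?u 0 = u"
    using ne b by (auto simp: fun_eq_iff)
  show ?case using runs_Seq[OF 1 2[unfolded 3]] by (auto simp del: fun_upd_apply elim!: runs_mono)
qed

section \<open>Polynomial bounds on values and running times\<close>

definition poly_bounded :: "(nat \<Rightarrow> nat) \<Rightarrow> bool" where
  "poly_bounded f \<longleftrightarrow> (\<exists>b :: nat poly. \<forall>n. f n \<le> poly b n)"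

lemma poly_bounded_const: "poly_bounded (\<lambda>n. k)"
  unfolding poly_bounded_def by (intro exI[of _ "[:k:]"]) simp

lemma poly_bounded_id: "poly_bounded (\<lambda>n. n)"
  unfolding poly_bounded_def by (intro exI[of _ "[:0, 1:]"]) simp

lemma poly_bounded_add: "poly_bounded f \<Longrightarrow> poly_bounded g \<Longrightarrow> poly_bounded (\<lambda>n. f n + g n)"
  unfolding poly_bounded_def by (metis poly_add add_mono)

lemma poly_bounded_mult: "poly_bounded f \<Longrightarrow> poly_bounded g \<Longrightarrow> poly_bounded (\<lambda>n. f n * g n)"
  unfolding poly_bounded_def by (metis poly_mult mult_le_mono)

lemmas poly_bounded_intros = poly_bounded_const poly_bounded_id poly_bounded_add poly_bounded_mult

text \<open>The induction needs an arbitrary \<open>M\<close>: a sum evaluates its body with a loop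
  variable that can be as large as the value of the upper limit, so the bound grows.\<close>

lemma poly_bounded_val: "poly_bounded M \<Longrightarrow> poly_bounded (\<lambda>n. val_bound e (M n) n)"
  by (induction e arbitrary: M) (auto intro!: poly_bounded_intros)

lemma poly_bounded_time: "poly_bounded M \<Longrightarrow> poly_bounded (\<lambda>n. time_bound e (M n) n)"
proof (induction e arbitrary: M)
  case (Sum x e1 e2)
  have "poly_bounded (\<lambda>n. time_bound e2 (M n + val_bound e1 (M n) n) n)"
    by (rule Sum.IH(2)) (intro poly_bounded_intros poly_bounded_val Sum.prems)
  with Sum show ?case
    unfolding time_bound.simps by (intro poly_bounded_intros poly_bounded_val)
qed (simp_all only: time_bound.simps, (intro poly_bounded_intros poly_bounded_val | assumption)+)

lemma poly_bounded_otime: "poly_bounded M \<Longrightarrow> poly_bounded (\<lambda>n. otime e (M n) n)"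
proof (induction e arbitrary: M)
  case (OFor x e o1)
  have "poly_bounded (\<lambda>n. otime o1 (M n + val_bound e (M n) n) n)"
    by (rule OFor.IH) (intro poly_bounded_intros poly_bounded_val OFor.prems)
  with OFor show ?case
    unfolding otime.simps by (intro poly_bounded_intros poly_bounded_val poly_bounded_time)
qed (simp_all only: otime.simps, (intro poly_bounded_intros poly_bounded_val poly_bounded_time | assumption)+)

lemma poly_time_computable_oval: "poly_time_computable (\<lambda>w. oval w (\<lambda>_. 0) e)"
proof -
  obtain b where b: "ovars e \<subseteq> {..<b}"
    using finite_ovars[of e] by (meson finite_nat_iff_bounded)
  \<comment> \<open>All registers are 0 at the start, so the bound on the variables is 0.\<close>
  obtain p where p: "otime e 0 n \<le> poly p n" for n
    using poly_bounded_otime[OF poly_bounded_const[of 0], of e] unfolding poly_bounded_def by blast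
  show ?thesis
  proof (rule poly_time_computable_exec)
    fix w
    have "runs w (ocompile e b) (\<lambda>_. 0, 0, []) (otime e 0 (length w)) (\<lambda>_. 0, 0, [] @ oval w (\<lambda>_. 0) e)"
      by (rule runs_ocompile) (use b in auto)
    then obtain t where "t \<le> otime e 0 (length w)"
      "exec w (ocompile e b) (\<lambda>_. 0, 0, []) t (\<lambda>_. 0, 0, oval w (\<lambda>_. 0) e)"
      unfolding runs_def by auto
    then show "\<exists>t \<le> poly p (length w). \<exists>r q. exec w (ocompile e b) (\<lambda>_. 0, 0, []) t (r, q, oval w (\<lambda>_. 0) e)"
      using p[of "length w"] by (meson le_trans)
  qed
qed

section \<open>Expressible functions\<close>

text \<open>Closure properties of this semantic notion replace the writing of programs: every
  quantity of the reduction is shown computable through them.\<close>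

definition expressible :: "(bool list \<Rightarrow> (nat \<Rightarrow> nat) \<Rightarrow> nat) \<Rightarrow> bool" where
  "expressible f \<longleftrightarrow> (\<exists>e. \<forall>w v. nval w v e = f w v)"

abbreviation decidable :: "(bool list \<Rightarrow> (nat \<Rightarrow> nat) \<Rightarrow> bool) \<Rightarrow> bool" where
  "decidable Q \<equiv> expressible (\<lambda>w v. of_bool (Q w v))"

lemma expressible_var: "expressible (\<lambda>w v. v x)"
  unfolding expressible_def by (rule exI[of _ "Var x"]) simp

lemma expressible_const: "expressible (\<lambda>w v. k)"
  unfolding expressible_def by (rule exI[of _ "Const k"]) simp

lemma expressible_length: "expressible (\<lambda>w v. length w)"
  unfolding expressible_def by (rule exI[of _ "Len"]) simp

lemma expressible_input:
  assumes "expressible f"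
  shows "expressible (\<lambda>w v. word_cells w (int (f w v)))"
proof -
  obtain e where "nval w v e = f w v" for w v using assms unfolding expressible_def by blast
  then show ?thesis unfolding expressible_def by (intro exI[of _ "Inp e"]) simp
qed

lemma expressible_add:
  assumes "expressible f" "expressible g"
  shows "expressible (\<lambda>w v. f w v + g w v)"
proof -
  obtain e1 e2 where "nval w v e1 = f w v" "nval w v e2 = g w v" for w v
    using assms unfolding expressible_def by blast
  then show ?thesis unfolding expressible_def by (intro exI[of _ "Add e1 e2"]) simp
qed

lemma expressible_diff:
  assumes "expressible f" "expressible g"
  shows "expressible (\<lambda>w v. f w v - g w v)"
proof -
  obtain e1 e2 where "nval w v e1 = f w v" "nval w v e2 = g w v" for w v
    using assms unfolding expressible_def by blast
  then show ?thesis unfolding expressible_def by (intro exI[of _ "Sub e1 e2"]) simp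
qed

lemma expressible_sum:
  assumes "expressible f" "expressible g"
  shows "expressible (\<lambda>w v. \<Sum>i<f w v. g w (v(x := i)))"
proof -
  obtain e1 e2 where "nval w v e1 = f w v" "nval w v e2 = g w v" for w v
    using assms unfolding expressible_def by blast
  then show ?thesis unfolding expressible_def by (intro exI[of _ "Sum x e1 e2"]) simp
qed

text \<open>An expression mentions finitely many variables, so all large enough ones are irrelevant
  to it and can serve as summation indices.\<close>

lemma expressible_fresh:
  assumes "expressible f"
  obtains X where "\<And>x w v i. x \<ge> X \<Longrightarrow> f w (v(x := i)) = f w v"
proof -
  obtain e where e: "nval w v e = f w v" for w v using assms unfolding expressible_def by blast
  obtain X where X: "vars e \<subseteq> {..<X}" using finite_vars[of e] by (meson finite_nat_iff_bounded)
  have "f w (v(x := i)) = f w v" if "x \<ge> X" for x w v i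
    unfolding e[symmetric] by (rule nval_cong) (use X that in auto)
  then show ?thesis by (rule that)
qed

lemma expressible_fresh2:
  assumes "expressible f" "expressible g"
  obtains x where "\<And>w v i. f w (v(x := i)) = f w v" "\<And>w v i. g w (v(x := i)) = g w v"
proof -
  obtain X where X: "f w (v(x := i)) = f w v" if "x \<ge> X" for x w v i
    by (rule expressible_fresh[OF assms(1)]) (rule that)
  obtain Y where Y: "g w (v(x := i)) = g w v" if "x \<ge> Y" for x w v i
    by (rule expressible_fresh[OF assms(2)]) (rule that)
  show ?thesis by (rule that[of "max X Y"]) (use X Y in auto)
qed

text \<open>A product is a sum with constant summand over a fresh index.\<close>

lemma expressible_mult:
  assumes "expressible f" "expressible g"
  shows "expressible (\<lambda>w v. f w v * g w v)"
proof -
  obtain x where "\<And>w v i. f w (v(x := i)) = f w v" "\<And>w v i. g w (v(x := i)) = g w v"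
    by (rule expressible_fresh2[OF assms]) (rule that)
  then show ?thesis using expressible_sum[OF assms, of x] by simp
qed

lemma decidable_le:
  assumes "expressible f" "expressible g"
  shows "decidable (\<lambda>w v. f w v \<le> g w v)"
proof -
  have *: "of_bool (a \<le> b) = 1 - (a - b)" for a b :: nat by auto
  show ?thesis unfolding * by (intro expressible_diff expressible_const assms)
qed

lemma decidable_not:
  assumes "decidable Q"
  shows "decidable (\<lambda>w v. \<not> Q w v)"
proof -
  have *: "of_bool (\<not> q) = 1 - (of_bool q :: nat)" for q by simp
  show ?thesis unfolding * by (intro expressible_diff expressible_const assms)
qed

lemma decidable_conj:
  assumes "decidable Q" "decidable Q'"
  shows "decidable (\<lambda>w v. Q w v \<and> Q' w v)"
  unfolding of_bool_conj by (intro expressible_mult assms)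

lemma decidable_disj:
  assumes "decidable Q" "decidable Q'"
  shows "decidable (\<lambda>w v. Q w v \<or> Q' w v)"
proof -
  have *: "q \<or> q' \<longleftrightarrow> \<not> (\<not> q \<and> \<not> q')" for q q' by blast
  show ?thesis unfolding * by (intro decidable_not decidable_conj assms)
qed

lemma decidable_imp:
  assumes "decidable Q" "decidable Q'"
  shows "decidable (\<lambda>w v. Q w v \<longrightarrow> Q' w v)"
  unfolding imp_conv_disj by (intro decidable_not decidable_disj assms)

lemma decidable_less:
  assumes "expressible f" "expressible g"
  shows "decidable (\<lambda>w v. f w v < g w v)"
  unfolding not_le[symmetric] by (intro decidable_not decidable_le assms)

lemma decidable_eq:
  assumes "expressible f" "expressible g"
  shows "decidable (\<lambda>w v. f w v = g w v)"
proof -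
  have *: "a = b \<longleftrightarrow> a \<le> b \<and> b \<le> a" for a b :: nat by auto
  show ?thesis unfolding * by (intro decidable_conj decidable_le assms)
qed

lemma expressible_if:
  assumes "decidable Q" "expressible f" "expressible g"
  shows "expressible (\<lambda>w v. if Q w v then f w v else g w v)"
proof -
  have *: "(if Q w v then f w v else g w v) = of_bool (Q w v) * f w v + of_bool (\<not> Q w v) * g w v" for w v
    by simp
  show ?thesis unfolding *
    by (intro expressible_add expressible_mult decidable_not assms)
qed

lemma sum_of_bool_lessThan: "(\<Sum>i<n. of_bool (Q i)) = card {i. i < n \<and> Q i}" for n :: nat
  by (simp add: sum.If_cases of_bool_def Int_def)

text \<open>The quotient counts the positive multiples of the divisor up to the dividend; the
  condition on \<open>b\<close> yields 0 for the divisor 0, as \<open>div\<close> does.\<close>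

lemma expressible_div:
  assumes "expressible f" "expressible g"
  shows "expressible (\<lambda>w v. f w v div g w v)"
proof -
  obtain x where x: "\<And>w v i. f w (v(x := i)) = f w v" "\<And>w v i. g w (v(x := i)) = g w v"
    by (rule expressible_fresh2[OF assms]) (rule that)
  have *: "a div b = (\<Sum>i<a. of_bool ((i + 1) * b \<le> a \<and> \<not> b = 0))" for a b :: nat
  proof (cases "b = 0")
    case False
    then have "(i + 1) * b \<le> a \<longleftrightarrow> i < a div b" for i
      using less_eq_div_iff_mult_less_eq[of b "i + 1" a] by auto
    moreover have "i < a div b \<Longrightarrow> i < a" for i
      using div_le_dividend[of a b] by linarith
    ultimately have "{i. i < a \<and> (i + 1) * b \<le> a} = {..<a div b}"
      by blast
    moreover have "(\<Sum>i<a. of_bool ((i + 1) * b \<le> a \<and> \<not> b = 0)) = card {i. i < a \<and> (i + 1) * b \<le> a}"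
      using False by (simp add: sum_of_bool_lessThan)
    ultimately show ?thesis by simp
  qed simp
  have "expressible (\<lambda>w v. of_bool ((v x + 1) * g w v \<le> f w v \<and> \<not> g w v = 0))"
    by (intro decidable_conj decidable_le decidable_not decidable_eq expressible_mult expressible_add
      expressible_var expressible_const assms)
  from expressible_sum[OF assms(1) this, of x] show ?thesis
    unfolding * by (simp only: x fun_upd_same)
qed

lemma expressible_mod:
  assumes "expressible f" "expressible g"
  shows "expressible (\<lambda>w v. f w v mod g w v)"
  unfolding modulo_nat_def by (intro expressible_diff expressible_mult expressible_div assms)

text \<open>Substitution is the difference of two sums.\<close>

lemma expressible_compose:
  assumes "expressible (\<lambda>w v. h w (v 0))" "expressible f"
  shows "expressible (\<lambda>w v. h w (f w v))"
proof -
  have *: "h w a = (\<Sum>i<a + 1. h w i) - (\<Sum>i<a. h w i)" for w a by simp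
  have "expressible (\<lambda>w v. (\<Sum>i<f w v + 1. h w ((v(0 := i)) 0)) - (\<Sum>i<f w v. h w ((v(0 := i)) 0)))"
    by (intro expressible_diff expressible_sum expressible_add expressible_const assms)
  then show ?thesis unfolding *[of _ "f _ _"] by simp
qed

text \<open>Iterated case distinction on the value of \<open>f\<close>, so \<open>h\<close> may be
  any function. This is how the transition table of a given machine enters.\<close>

lemma expressible_finite:
  assumes "expressible f"
  shows "expressible (\<lambda>w v. if f w v < m then h (f w v) else 0)"
proof (induction m)
  case 0
  then show ?case using expressible_const by simp
next
  case (Suc m)
  have *: "(if f w v < Suc m then h (f w v) else 0) =
    (if f w v = m then h m else if f w v < m then h (f w v) else 0)" for w v
    by auto
  show ?case unfolding *
    by (rule expressible_if[OF decidable_eq[OF assms expressible_const] expressible_const Suc.IH])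
qed

lemma expressible_poly: "expressible (\<lambda>w v. poly b (length w))"
proof (induction b)
  case 0
  then show ?case using expressible_const by simp
next
  case (pCons a b)
  show ?case unfolding poly_pCons
    by (rule expressible_add[OF expressible_const expressible_mult[OF expressible_length pCons(2)]])
qed

text \<open>The sum counts the odd divisors of \<open>p\<close>. The number 1 is always among them,
  and so is the odd part of \<open>p\<close>, which is 1 just for the powers of 2. The test avoids
  computing powers with exponents up to \<open>p\<close>, whose values are not polynomially
  bounded.\<close>

lemma power_2_iff_odd_divisors:
  fixes p :: nat
  assumes "p > 0"
  shows "(\<exists>k. p = 2 ^ k) \<longleftrightarrow> (\<Sum>d<p + 1. of_bool (d mod 2 = 1 \<and> p mod d = 0)) = (1 :: nat)"
proof -
  let ?D = "{d. d < p + 1 \<and> d mod 2 = 1 \<and> p mod d = 0}"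
  have sum: "(\<Sum>d<p + 1. of_bool (d mod 2 = 1 \<and> p mod d = 0)) = card ?D"
    by (rule sum_of_bool_lessThan)
  have fin: "finite ?D" by (rule finite_subset[of _ "{..<p + 1}"]) auto
  have one: "1 \<in> ?D" using assms by auto
  show ?thesis
  proof
    assume "\<exists>k. p = 2 ^ k"
    then obtain k where p: "p = 2 ^ k" by blast
    have "d = 1" if "d \<in> ?D" for d
    proof -
      have "p mod d = 0" "d mod 2 = 1" using that by blast+
      then have "d dvd 2 ^ k" "odd d" unfolding p by (simp_all add: mod_eq_0_iff_dvd odd_iff_mod_2_eq_one)
      then have "coprime d (2 ^ k)" by simp
      from coprime_common_divisor[OF this dvd_refl \<open>d dvd 2 ^ k\<close>] show ?thesis by simp
    qed
    then have D: "?D = {1}" using one by (intro equalityI subsetI) (simp_all only: singleton_iff)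
    show "(\<Sum>d<p + 1. of_bool (d mod 2 = 1 \<and> p mod d = 0)) = (1 :: nat)"
      unfolding sum D by simp
  next
    assume "(\<Sum>d<p + 1. of_bool (d mod 2 = 1 \<and> p mod d = 0)) = (1 :: nat)"
    then obtain x where x: "?D = {x}" unfolding sum by (rule card_1_singletonE)
    obtain m where m: "p = 2 ^ multiplicity 2 p * m" "odd m"
      by (rule multiplicity_decompose'[of p "2::nat"]) (use assms in auto)
    from m(1) obtain k where k: "p = 2 ^ k * m" by (rule that)
    then have "m dvd p" by simp
    then have "m < p + 1" "p mod m = 0" using dvd_imp_le[of m p] assms by simp_all
    moreover have "m mod 2 = 1" using m(2) by (simp add: odd_iff_mod_2_eq_one)
    ultimately have "m \<in> ?D" by blast
    then have "m = x" "1 = x" using one unfolding x by simp_all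
    then have "m = 1" by (rule trans[OF _ sym])
    show "\<exists>k. p = 2 ^ k" by (rule exI[of _ k]) (subst k, simp add: \<open>m = 1\<close>)
  qed
qed

lemma decidable_power_2:
  assumes "expressible f"
  shows "decidable (\<lambda>w v. \<exists>k. f w v = 2 ^ k)"
proof (rule expressible_compose[OF _ assms])
  have *: "(\<exists>k. p = 2 ^ k) \<longleftrightarrow> \<not> p = 0 \<and>
    (\<Sum>d<p + 1. of_bool (d mod 2 = 1 \<and> p mod d = 0)) = (1 :: nat)" for p :: nat
    using power_2_iff_odd_divisors[of p] by (cases "p = 0") auto
  have "expressible (\<lambda>w v. \<Sum>d<v 0 + 1. of_bool ((v(1 := d)) 1 mod 2 = 1 \<and>
    (v(1 := d)) 0 mod (v(1 := d)) 1 = 0))"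
    by (intro expressible_sum[where g = "\<lambda>w v. of_bool (v 1 mod 2 = 1 \<and> v 0 mod v 1 = 0)"]
      decidable_conj decidable_eq expressible_mod expressible_add expressible_const expressible_var)
  then show "decidable (\<lambda>w v. \<exists>k. v 0 = 2 ^ k)"
    unfolding * by (intro decidable_conj decidable_not decidable_eq expressible_var expressible_const) simp
qed

lemmas expressible_intros =
  expressible_var expressible_const expressible_length expressible_input expressible_add
  expressible_diff expressible_mult expressible_div expressible_mod expressible_if
  decidable_le decidable_less decidable_eq decidable_not decidable_conj decidable_disj decidable_imp

section \<open>Printing numbers and rationals\<close>

definition printable :: "(bool list \<Rightarrow> (nat \<Rightarrow> nat) \<Rightarrow> bool list) \<Rightarrow> bool" where
  "printable f \<longleftrightarrow> (\<exists>e. \<forall>w v. oval w v e = f w v)"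

lemma poly_time_computable_printable: "printable f \<Longrightarrow> poly_time_computable (\<lambda>w. f w (\<lambda>_. 0))"
proof -
  assume "printable f"
  then obtain e where "oval w v e = f w v" for w v unfolding printable_def by blast
  then show ?thesis using poly_time_computable_oval[of e] by simp
qed

lemma printable_append:
  assumes "printable f" "printable g"
  shows "printable (\<lambda>w v. f w v @ g w v)"
proof -
  obtain e1 e2 where "oval w v e1 = f w v" "oval w v e2 = g w v" for w v
    using assms unfolding printable_def by blast
  then show ?thesis unfolding printable_def by (intro exI[of _ "OSeq e1 e2"]) simp
qed

lemma printable_if:
  assumes "decidable Q" "printable f" "printable g"
  shows "printable (\<lambda>w v. if Q w v then f w v else g w v)"
proof -
  obtain e e1 e2 where "nval w v e = of_bool (Q w v)" "oval w v e1 = f w v" "oval w v e2 = g w v" for w v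
    using assms unfolding printable_def expressible_def by blast
  then show ?thesis unfolding printable_def by (intro exI[of _ "OIf e e1 e2"]) simp
qed

lemma printable_for:
  assumes "expressible f" "printable g"
  shows "printable (\<lambda>w v. concat (map (\<lambda>i. g w (v(x := i))) [0..<f w v]))"
proof -
  obtain e e1 where "nval w v e = f w v" "oval w v e1 = g w v" for w v
    using assms unfolding printable_def expressible_def by blast
  then show ?thesis unfolding printable_def by (intro exI[of _ "OFor x e e1"]) simp
qed

lemma printable_const: "printable (\<lambda>w v. u)"
proof (induction u)
  case Nil
  show ?case unfolding printable_def by (rule exI[of _ "OFor 0 (Const 0) (OBit True)"]) simp
next
  case (Cons b u)
  have "printable (\<lambda>w v. [b])" unfolding printable_def by (rule exI[of _ "OBit b"]) simp
  from printable_append[OF this Cons] show ?case by simp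
qed

lemma printable_bit:
  assumes "decidable Q"
  shows "printable (\<lambda>w v. [Q w v])"
proof -
  have *: "[q] = (if q then [True] else [False])" for q by simp
  show ?thesis unfolding *[of "Q _ _"] by (intro printable_if printable_const assms)
qed

lemma binary_digits: "2 ^ k \<le> n \<Longrightarrow> n < 2 ^ Suc k \<Longrightarrow> binary n = map (\<lambda>j. odd (n div 2 ^ j)) (rev [0..<Suc k])"
proof (induction k arbitrary: n)
  case 0
  then have "n = 1" by simp
  then show ?case by (simp add: binary.simps)
next
  case (Suc k)
  have "binary (n div 2) = map (\<lambda>j. odd (n div 2 div 2 ^ j)) (rev [0..<Suc k])"
    by (rule Suc.IH) (use Suc.prems in auto)
  also have "\<dots> = map (\<lambda>j. odd (n div 2 ^ j)) (rev (map Suc [0..<Suc k]))"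
    by (simp add: rev_map div_mult2_eq)
  finally have "binary n = map (\<lambda>j. odd (n div 2 ^ j)) (rev (map Suc [0..<Suc k])) @ [odd n]"
    using Suc.prems by (subst binary.simps) (auto simp: not_le)
  also have "\<dots> = map (\<lambda>j. odd (n div 2 ^ j)) (rev (0 # map Suc [0..<Suc k]))" by simp
  also have "0 # map Suc [0..<Suc k] = [0..<Suc (Suc k)]"
    by (metis map_Suc_upt upt_conv_Cons zero_less_Suc)
  finally show ?case .
qed

text \<open>Running from \<open>m\<close> down to 1 and printing a digit at every power of 2 lists
  the digits of \<open>n\<close> from the top, without computing a logarithm. The limit
  \<open>m\<close> is separated from \<open>n\<close> for the sake of the induction.\<close>

lemma print_binary:
  "2 ^ k \<le> m \<Longrightarrow> m < 2 ^ Suc k \<Longrightarrow>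
   concat (map (\<lambda>i. if \<exists>k. m - i = 2 ^ k then [True, odd (n div (m - i))] else []) [0..<m]) =
   concat (map (\<lambda>j. [True, odd (n div 2 ^ j)]) (rev [0..<Suc k]))"
proof (induction m arbitrary: k)
  case (Suc m)
  let ?d = "\<lambda>p. if \<exists>k. p = 2 ^ k then [True, odd (n div p)] else []"
  have "[0..<Suc m] = 0 # map Suc [0..<m]"
    by (metis map_Suc_upt upt_conv_Cons zero_less_Suc)
  then have "concat (map (\<lambda>i. d (Suc m - i)) [0..<Suc m]) = d (Suc m) @ concat (map (\<lambda>i. d (m - i)) [0..<m])"
    for d :: "nat \<Rightarrow> bool list"
    by (simp add: comp_def del: upt_Suc)
  note step = this[of ?d]
  show ?case
  proof (cases "Suc m = 2 ^ k")
    case True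
    then have "\<exists>k. Suc m = 2 ^ k" by blast
    then have d: "?d (Suc m) = [True, odd (n div 2 ^ k)]" using True by simp
    show ?thesis
    proof (cases k)
      case 0
      then show ?thesis using True unfolding step d by simp
    next
      case (Suc k')
      have "concat (map (\<lambda>i. ?d (m - i)) [0..<m]) =
        concat (map (\<lambda>j. [True, odd (n div 2 ^ j)]) (rev [0..<Suc k']))"
        by (rule Suc.IH) (use True Suc in auto)
      then show ?thesis unfolding step d using Suc by simp
    qed
  next
    case False
    have "\<not> (\<exists>j. Suc m = 2 ^ j)"
    proof
      assume "\<exists>j. Suc m = 2 ^ j"
      then obtain j where j: "Suc m = 2 ^ j" by blast
      with Suc.prems False have "2 ^ k < (2::nat) ^ j" "(2::nat) ^ j < 2 ^ Suc k" by auto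
      then have "k < j" "j < Suc k" by
        (metis power_strict_increasing_iff one_less_numeral_iff semiring_norm(76))+
      then show False by simp
    qed
    moreover have "concat (map (\<lambda>i. ?d (m - i)) [0..<m]) =
      concat (map (\<lambda>j. [True, odd (n div 2 ^ j)]) (rev [0..<Suc k]))"
      by (rule Suc.IH) (use False Suc.prems in auto)
    ultimately show ?thesis unfolding step by simp
  qed
qed simp

lemma enc_nat_print:
  "enc_nat n = concat (map (\<lambda>i. if \<exists>k. n - i = 2 ^ k then [True, odd (n div (n - i))] else []) [0..<n]) @
    [False]"
proof (cases "n = 0")
  case True
  then show ?thesis by (simp add: enc_nat_def binary.simps)
next
  case False
  then obtain k where k: "2 ^ k \<le> n" "n < 2 ^ Suc k"
    using ex_power_ivl1[of 2 n] by auto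
  show ?thesis unfolding enc_nat_def binary_digits[OF k] print_binary[OF k] by (simp add: comp_def)
qed

lemma printable_enc_nat:
  assumes "expressible f"
  shows "printable (\<lambda>w v. enc_nat (f w v))"
proof -
  obtain x where x: "\<And>w v i. f w (v(x := i)) = f w v"
    by (rule expressible_fresh2[OF assms assms]) (rule that)
  have "printable (\<lambda>w v. if \<exists>k. f w v - v x = 2 ^ k then [True] @ [f w v div (f w v - v x) mod 2 =
    1] else [])"
    by (intro printable_if printable_append printable_bit printable_const decidable_power_2
      expressible_intros assms)
  from printable_for[OF assms this, of x]
  have "printable (\<lambda>w v. concat (map (\<lambda>i. if \<exists>k. f w v - i =
    2 ^ k then [True, odd (f w v div (f w v - i))] else []) [0..<f w v]))"
    by (simp add: x odd_iff_mod_2_eq_one cong: if_cong)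
  from printable_append[OF this printable_const[of "[False]"]] show ?thesis
    unfolding enc_nat_print .
qed

lemma enc_rat_0: "enc_rat 0 = [False, False, True, True, False]"
  by (simp add: enc_rat_def enc_int_def enc_nat_def binary.simps)

lemma enc_rat_inverse: "q > 0 \<Longrightarrow> enc_rat (1 / of_nat q) = [False, True, True, False] @ enc_nat q"
proof -
  assume "q > 0"
  then have "quotient_of (1 / of_nat q) = (1, int q)"
    by (metis Fract_of_int_quotient of_int_1 of_int_of_nat_eq quotient_of_Fract normalize_stable
      coprime_1_left of_nat_0_less_iff)
  then show ?thesis by (simp add: enc_rat_def enc_int_def enc_nat_def[of "Suc 0"] binary.simps)
qed

text \<open>As \<open>1 / 0 = 0\<close>, the zero entries are covered by \<open>f w v = 0\<close>.\<close>

lemma printable_enc_rat: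
  assumes "expressible f"
  shows "printable (\<lambda>w v. enc_rat (1 / of_nat (f w v)))"
proof -
  have *: "enc_rat (1 / of_nat q) = (if q = 0 then [False, False, True, True, False]
      else [False, True, True, False] @ enc_nat q)" for q
    using enc_rat_0 enc_rat_inverse[of q] by auto
  show ?thesis unfolding *
    by (intro printable_if printable_append printable_const printable_enc_nat expressible_intros assms)
qed

section \<open>Colourings and correlation matrices\<close>

text \<open>This is \<open>m\<close>-colourability of the conflict graph on \<open>V\<close>.
  Classes may overlap, since the atoms of a decomposition cover the vertices but need not partition
  them.\<close>

definition independent_cover :: "nat \<Rightarrow> nat set \<Rightarrow> (nat \<Rightarrow> nat \<Rightarrow> bool) \<Rightarrow> bool" where
  "independent_cover m V conf \<longleftrightarrow> (\<exists>C. finite C \<and> card C \<le> m \<and> V \<subseteq> \<Union>C \<and>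
    (\<forall>X\<in>C. X \<subseteq> V \<and> (\<forall>i\<in>X. \<forall>j\<in>X. i \<noteq> j \<longrightarrow> \<not> conf i j)))"

lemma independent_coverE:
  assumes "independent_cover m V conf"
  obtains C where "finite C" "card C \<le> m" "V \<subseteq> \<Union>C"
    "\<forall>X\<in>C. X \<subseteq> V \<and> (\<forall>i\<in>X. \<forall>j\<in>X. i \<noteq> j \<longrightarrow> \<not> conf i j)"
  using assms unfolding independent_cover_def by (elim exE conjE) (rule that)

lemma independent_cover_imageI:
  assumes "independent_cover m V conf"
    and conf: "\<And>i j. i \<in> V \<Longrightarrow> j \<in> V \<Longrightarrow> conf' (f i) (f j) = conf i j"
  shows "independent_cover m (f ` V) conf'"
proof -
  obtain C where C: "finite C" "card C \<le> m" "V \<subseteq> \<Union>C"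
    and ind: "\<forall>X\<in>C. X \<subseteq> V \<and> (\<forall>i\<in>X. \<forall>j\<in>X. i \<noteq> j \<longrightarrow> \<not> conf i j)"
    by (rule independent_coverE[OF assms(1)])
  show ?thesis unfolding independent_cover_def
  proof (intro exI[of _ "(`) f ` C"] conjI ballI impI)
    show "finite ((`) f ` C)" using C by simp
    show "card ((`) f ` C) \<le> m" using card_image_le[OF C(1), of "(`) f"] C(2) by (rule le_trans)
    show "f ` V \<subseteq> \<Union>((`) f ` C)" using C(3) by blast
    fix X assume "X \<in> (`) f ` C"
    then obtain X' where X: "X' \<in> C" "X = f ` X'" by blast
    have X'V: "X' \<subseteq> V" using ind X(1) by blast
    then show "X \<subseteq> f ` V" unfolding X(2) by blast
    fix i j assume ij: "i \<in> X" "j \<in> X" "i \<noteq> j"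
    then obtain u u' where u: "u \<in> X'" "u' \<in> X'" "i = f u" "j = f u'" unfolding X(2) by blast
    then have "u \<noteq> u'" using ij(3) by blast
    then have "\<not> conf u u'" using ind X(1) u by blast
    then show "\<not> conf' i j" unfolding u(3,4) using conf[of u u'] u(1,2) X'V by blast
  qed
qed

lemma independent_cover_image:
  assumes inj: "inj_on f V" and conf: "\<And>i j. i \<in> V \<Longrightarrow> j \<in> V \<Longrightarrow> conf' (f i) (f j) = conf i j"
  shows "independent_cover m (f ` V) conf' \<longleftrightarrow> independent_cover m V conf"
proof
  assume "independent_cover m (f ` V) conf'"
  then have "independent_cover m (inv_into V f ` f ` V) conf"
    by (rule independent_cover_imageI) (auto simp: inj conf)
  then show "independent_cover m V conf" using inv_into_image_cancel[OF inj order_refl] by simp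
qed (rule independent_cover_imageI, simp_all add: conf)

section \<open>Decompositions of the matrix of a conflict graph\<close>

abbreviation both :: "nat set \<Rightarrow> nat \<Rightarrow> nat \<Rightarrow> real" where
  "both A i j \<equiv> of_bool (i \<in> A \<and> j \<in> A)"

text \<open>Labels for the atoms built from a colouring, with two per gadget index, told apart by
  the flag. Sums over labels make sense whether or not the labelled sets are distinct.\<close>

datatype atom = Class nat | Gadget nat bool | Singleton nat | Empty

text \<open>The bound \<open>2 * n * \<epsilon> \<le> \<delta>\<close> serves twice: it makes the
  diagonal entry \<delta> larger than the rest of its row, and it leaves room for the at most
  \<open>2 * n\<close> class and gadget atoms of weight \<epsilon>. The bound
  \<open>n * \<delta> < 1\<close> keeps the trace below 1.\<close>

locale colour_matrix =
  fixes n :: nat and V Y :: "nat set" and z :: nat and e1 e2 :: "nat \<Rightarrow> nat"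
    and conf :: "nat \<Rightarrow> nat \<Rightarrow> bool" and \<epsilon> \<delta> :: real
  assumes V: "V \<subseteq> {..<n}" and Y: "Y \<subseteq> {..<n}" and z: "z < n" "z \<notin> V" "z \<notin> Y" and VY: "V \<inter> Y = {}"
    and ends: "\<And>y. y \<in> Y \<Longrightarrow> e1 y \<in> V" "\<And>y. y \<in> Y \<Longrightarrow> e2 y \<in> V" "\<And>y. y \<in> Y \<Longrightarrow> e1 y \<noteq> e2 y"
    and pair: "\<And>i j. i \<in> V \<Longrightarrow> j \<in> V \<Longrightarrow> i \<noteq> j \<Longrightarrow> \<exists>!y. y \<in> Y \<and> {e1 y, e2 y} = {i, j}"
    and conf_sym: "\<And>i j. conf i j = conf j i"
    and \<epsilon>: "\<epsilon> > 0" "2 * n * \<epsilon> \<le> \<delta>" and \<delta>: "n * \<delta> < 1"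
begin

definition entry :: "nat \<Rightarrow> nat \<Rightarrow> real" where
  "entry i j =
    (if i = j then (if i \<in> insert z V then \<delta> else if i \<in> Y then 2 * \<epsilon> else 0)
     else if i \<in> V \<and> j \<in> V then (if conf i j then 0 else \<epsilon>)
     else if i \<in> V \<and> j = z \<or> i = z \<and> j \<in> V then \<epsilon>
     else if i \<in> V \<and> j \<in> Y \<and> i \<in> {e1 j, e2 j} \<or> j \<in> V \<and> i \<in> Y \<and> j \<in> {e1 i, e2 i} then \<epsilon>
     else 0)"

lemma entry_sym: "entry i j = entry j i"
  by (cases "i = j") (simp_all add: entry_def conf_sym[of j i] eq_commute[of j i] conj_commute
    disj_commute, argo)

lemma finite_VY: "finite V" "finite Y"
  using finite_subset[OF V] finite_subset[OF Y] by simp_all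

lemma n_pos: "n > 0"
  using z by simp

lemma \<epsilon>_le: "2 * \<epsilon> \<le> \<delta>" "n * \<epsilon> < \<delta>"
proof -
  have "1 * \<epsilon> \<le> n * \<epsilon>" using n_pos \<epsilon> by (intro mult_right_mono) auto
  then show "2 * \<epsilon> \<le> \<delta>" using \<epsilon> by linarith
  have "0 < n * \<epsilon>" using n_pos \<epsilon> by simp
  then show "n * \<epsilon> < \<delta>" using \<epsilon> by linarith
qed

lemma entry_le: "i \<noteq> j \<Longrightarrow> entry i j \<le> \<epsilon>" "entry i i \<le> \<delta>"
  using \<epsilon> \<epsilon>_le by (auto simp: entry_def)

lemma entry_simps:
  "i \<in> V \<Longrightarrow> entry i z = \<epsilon>"
  "y \<in> Y \<Longrightarrow> entry y y = 2 * \<epsilon>"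
  "y \<in> Y \<Longrightarrow> entry z y = 0"
  "y \<in> Y \<Longrightarrow> entry y (e1 y) = \<epsilon>"
  "y \<in> Y \<Longrightarrow> y' \<in> Y \<Longrightarrow> y \<noteq> y' \<Longrightarrow> entry y y' = 0"
  "i \<in> V \<Longrightarrow> j \<in> V \<Longrightarrow> i \<noteq> j \<Longrightarrow> conf i j \<Longrightarrow> entry i j = 0"
  "i \<in> insert z V \<Longrightarrow> entry i i = \<delta>"
proof -
  have "y \<noteq> e1 y" if "y \<in> Y" for y using ends(1)[OF that] VY that by auto
  then show "y \<in> Y \<Longrightarrow> entry y (e1 y) = \<epsilon>"
    using z VY ends(1) unfolding entry_def by auto
qed (use z VY ends(1) in \<open>auto simp: entry_def\<close>)

text \<open>Three disjoint families of atoms are counted: the empty set with the singletons of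
  \<open>insert z V\<close>, the atoms through a gadget index, and those containing \<open>z\<close>
  together with a vertex. The first family has at least \<open>card V + 2\<close> members and the
  second at least \<open>2 * card Y\<close>, so at most \<open>m\<close> are left for the third,
  whose traces on \<open>V\<close> are the colour classes.\<close>

lemma classes_of_decomposition:
  fixes p :: "'k \<Rightarrow> real" and S :: "'k \<Rightarrow> nat set"
  assumes K: "finite K" "\<And>k. k \<in> K \<Longrightarrow> p k \<ge> 0" "(\<Sum>k\<in>K. p k) = 1"
    and S: "\<And>k. k \<in> K \<Longrightarrow> S k \<subseteq> {..<n}"
    and dec: "\<And>i j. i < n \<Longrightarrow> j < n \<Longrightarrow> entry i j = (\<Sum>k\<in>K. p k * both (S k) i j)"
    and card: "card {k \<in> K. p k \<noteq> 0} \<le> m + 2 * card Y + card V + 2"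
  shows "independent_cover m V conf"
proof -
  define A where "A = {k \<in> K. p k \<noteq> 0}"
  have A: "finite A" "A \<subseteq> K" using K(1) by (auto simp: A_def)
  \<comment> \<open>Nothing cancels, as the weights are non-negative; so a zero entry keeps two
    indices apart in all atoms of \<open>A\<close>.\<close>
  have memb: "entry i j > 0" if "k \<in> A" "i \<in> S k" "j \<in> S k" for i j k
  proof -
    have "i < n" "j < n" using that S A by auto
    moreover have "p k * both (S k) i j \<le> (\<Sum>k\<in>K. p k * both (S k) i j)"
      by (rule member_le_sum) (use that K A in auto)
    moreover have "p k > 0" using that(1) K(2)[of k] by (auto simp: A_def)
    ultimately show ?thesis using that(2,3) dec[of i j] by simp
  qed
  have ex: "\<exists>k\<in>A. i \<in> S k \<and> j \<in> S k" if "i < n" "j < n" "entry i j > 0" for i j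
  proof (rule ccontr)
    assume "\<not> ?thesis"
    then have "p k * both (S k) i j = 0" if "k \<in> K" for k
      using that by (auto simp: A_def)
    then have "entry i j = 0" unfolding dec[OF that(1,2)] by (intro sum.neutral) auto
    with that show False by simp
  qed
  \<comment> \<open>Otherwise every atom has an element, and the trace is at least the total weight
    1.\<close>
  have "\<exists>k\<in>A. S k = {}"
  proof (rule ccontr)
    assume *: "\<not> ?thesis"
    have "(\<Sum>k\<in>K. p k) \<le> (\<Sum>k\<in>K. \<Sum>i<n. p k * both (S k) i i)"
    proof (rule sum_mono)
      fix k assume k: "k \<in> K"
      show "p k \<le> (\<Sum>i<n. p k * both (S k) i i)"
      proof (cases "p k = 0")
        case False
        then obtain i where i: "i \<in> S k" using * k by (auto simp: A_def)
        have "p k * both (S k) i i \<le> (\<Sum>i<n. p k * both (S k) i i)"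
          by (rule member_le_sum[where f = "\<lambda>i. p k * both (S k) i i"])
            (use i S k K in auto)
        then show ?thesis using i by simp
      qed simp
    qed
    also have "\<dots> = (\<Sum>i<n. \<Sum>k\<in>K. p k * both (S k) i i)" by (rule sum.swap)
    also have "\<dots> = (\<Sum>i<n. entry i i)" by (intro sum.cong refl dec[symmetric]) auto
    also have "\<dots> \<le> (\<Sum>i<n. \<delta>)" by (intro sum_mono entry_le)
    also have "\<dots> < 1" using \<delta> by simp
    finally show False using K by simp
  qed
  then obtain k0 where k0: "k0 \<in> A" "S k0 = {}" by blast
  \<comment> \<open>Otherwise every atom through \<open>i\<close> contains a further index, and the
    diagonal entry \<delta> is at most the sum of the other entries in row \<open>i\<close>, which
    is below \<delta>.\<close>
  have "\<exists>k\<in>A. S k = {i}" if i: "i \<in> insert z V" for i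
  proof (rule ccontr)
    assume *: "\<not> ?thesis"
    have n: "i < n" using i z V by auto
    have "entry i i \<le> (\<Sum>k\<in>K. \<Sum>j\<in>{..<n} - {i}. p k * both (S k) i j)"
      unfolding dec[OF n n]
    proof (rule sum_mono)
      fix k assume k: "k \<in> K"
      show "p k * both (S k) i i \<le> (\<Sum>j\<in>{..<n} - {i}. p k * both (S k) i j)"
      proof (cases "p k \<noteq> 0 \<and> i \<in> S k")
        case True
        then obtain j where j: "j \<in> S k" "j \<noteq> i" using * k by (auto simp: A_def)
        have "p k * both (S k) i j \<le> (\<Sum>j\<in>{..<n} - {i}. p k * both (S k) i j)"
          by (rule member_le_sum[where f = "\<lambda>j. p k * both (S k) i j"])
            (use j S k K in auto)
        then show ?thesis using j True by simp
      qed (use K k in \<open>auto intro!: sum_nonneg\<close>)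
    qed
    also have "\<dots> = (\<Sum>j\<in>{..<n} - {i}. \<Sum>k\<in>K. p k * both (S k) i j)" by (rule sum.swap)
    also have "\<dots> = (\<Sum>j\<in>{..<n} - {i}. entry i j)" by (intro sum.cong refl dec[symmetric] n) auto
    also have "\<dots> \<le> (\<Sum>j\<in>{..<n} - {i}. \<epsilon>)" by (intro sum_mono entry_le) auto
    also have "\<dots> \<le> n * \<epsilon>" using \<epsilon> n by (simp add: algebra_simps)
    also have "\<dots> < entry i i" using \<epsilon>_le entry_simps(7)[OF i] by simp
    finally show False by simp
  qed
  then obtain f where f: "\<And>i. i \<in> insert z V \<Longrightarrow> f i \<in> A" "\<And>i. i \<in> insert z V \<Longrightarrow> S (f i) = {i}" by metis
  define AY where "AY y = {k \<in> A. y \<in> S k}" for y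
  \<comment> \<open>Some atom contains both \<open>y\<close> and \<open>e1 y\<close>, as their entry
    is \<epsilon>; the diagonal entry of \<open>y\<close> is twice as large, so another atom
    contains \<open>y\<close> without \<open>e1 y\<close>.\<close>
  have two: "card (AY y) \<ge> 2" if y: "y \<in> Y" for y
  proof -
    have n: "y < n" "e1 y < n" using y Y V ends(1)[OF y] by auto
    obtain k1 where k1: "k1 \<in> A" "y \<in> S k1" "e1 y \<in> S k1"
      using ex[OF n] entry_simps(4)[OF y] \<epsilon> by auto
    have "\<exists>k2\<in>A. y \<in> S k2 \<and> e1 y \<notin> S k2"
    proof (rule ccontr)
      assume *: "\<not> ?thesis"
      have "entry y y = entry y (e1 y)" unfolding dec[OF n] dec[OF n(1) n(1)]
      proof (rule sum.cong[OF refl])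
        fix k assume "k \<in> K"
        with * show "p k * both (S k) y y = p k * of_bool (y \<in> S k \<and> e1 y \<in> S k)"
          by (cases "p k = 0") (auto simp: A_def)
      qed
      then show False using entry_simps(2,4)[OF y] \<epsilon> by simp
    qed
    then obtain k2 where k2: "k2 \<in> A" "y \<in> S k2" "e1 y \<notin> S k2" by blast
    have "k1 \<noteq> k2" using k1 k2 by blast
    then have "2 = card {k1, k2}" by simp
    also have "\<dots> \<le> card (AY y)"
      by (rule card_mono) (use A k1 k2 in \<open>auto simp: AY_def\<close>)
    finally show ?thesis .
  qed
  have finAY: "finite (AY y)" for y using A by (simp add: AY_def)
  have "2 * card Y \<le> (\<Sum>y\<in>Y. card (AY y))" using sum_mono[of Y "\<lambda>_. 2" "\<lambda>y. card (AY y)"] two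
    by (simp add: mult.commute)
  also have "\<dots> = card (\<Union>y\<in>Y. AY y)"
  proof (rule card_UN_disjoint[symmetric])
    show "\<forall>y\<in>Y. \<forall>y'\<in>Y. y \<noteq> y' \<longrightarrow> AY y \<inter> AY y' = {}"
    proof (intro ballI impI)
      fix y y' assume "y \<in> Y" "y' \<in> Y" "y \<noteq> y'"
      then have "\<not> (k \<in> A \<and> y \<in> S k \<and> y' \<in> S k)" for k
        using memb[of k y y'] entry_simps(5)[of y y'] by auto
      then show "AY y \<inter> AY y' = {}" by (auto simp: AY_def)
    qed
  qed (use finite_VY finAY in auto)
  finally have cY: "2 * card Y \<le> card (\<Union>y\<in>Y. AY y)" .
  define AZ where "AZ = {k \<in> A. z \<in> S k \<and> S k \<inter> V \<noteq> {}}"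
  have finAZ: "finite AZ" using A by (simp add: AZ_def)
  have cV: "card (f ` insert z V) = card V + 1"
  proof -
    have "inj_on f (insert z V)" using f(2) by (metis inj_onI singleton_inject)
    then show ?thesis using finite_VY z by (simp add: card_image del: image_insert)
  qed
  define F where "F = insert k0 (f ` insert z V)"
  define W where "W = (\<Union>y\<in>Y. AY y)"
  have fin: "finite F" "finite W" using finite_VY finAY by (auto simp: F_def W_def)
  have SF: "S k \<inter> Y = {} \<and> (z \<notin> S k \<or> S k \<inter> V = {})" if "k \<in> F" for k
    using that k0(2) f(2) z VY unfolding F_def by auto
  have d1: "F \<inter> W = {}" using SF unfolding AY_def W_def by blast
  have d2: "F \<inter> AZ = {}" using SF unfolding AZ_def by blast
  have d3: "W \<inter> AZ = {}"
  proof (rule ccontr)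
    assume "W \<inter> AZ \<noteq> {}"
    then obtain k y where "k \<in> A" "y \<in> Y" "y \<in> S k" "z \<in> S k" by (auto simp: W_def AY_def AZ_def)
    then show False using memb[of k z y] entry_simps(3)[of y] by simp
  qed
  have "k0 \<notin> f ` insert z V"
  proof
    assume "k0 \<in> f ` insert z V"
    then obtain i where "i \<in> insert z V" "f i = k0" by blast
    then show False using f(2)[of i] k0(2) by simp
  qed
  then have c1: "card F = card V + 2"
    using cV finite_VY unfolding F_def by (simp del: image_insert)
  have "card (F \<union> W \<union> AZ) = card F + card W + card AZ"
    using card_Un_disjoint[OF fin d1] card_Un_disjoint[of "F \<union> W" AZ] d2 d3 fin finAZ
    by (simp add: Int_Un_distrib2)
  moreover have "card (F \<union> W \<union> AZ) \<le> card A"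
    by (rule card_mono[OF A(1)]) (use k0 f in \<open>auto simp: F_def W_def AY_def AZ_def\<close>)
  ultimately have "card AZ \<le> m" using cY c1 card unfolding A_def[symmetric] W_def[symmetric] by linarith
  then have "card ((\<lambda>k. S k \<inter> V) ` AZ) \<le> m" using card_image_le[OF finAZ] le_trans by blast
  moreover have "V \<subseteq> \<Union>((\<lambda>k. S k \<inter> V) ` AZ)"
  proof
    fix i assume i: "i \<in> V"
    then have "i < n" using V by auto
    moreover have "entry i z > 0" using entry_simps(1)[OF i] \<epsilon>(1) by simp
    ultimately obtain k where "k \<in> A" "i \<in> S k" "z \<in> S k" using ex[OF _ z(1)] by blast
    then show "i \<in> \<Union>((\<lambda>k. S k \<inter> V) ` AZ)" using i by (auto simp: AZ_def)
  qed
  moreover have "\<not> conf i j" if "k \<in> AZ" "i \<in> S k \<inter> V" "j \<in> S k \<inter> V" "i \<noteq> j" for i j k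
    using memb[of k i j] that entry_simps(6)[of i j] by (auto simp: AZ_def)
  ultimately show ?thesis using finAZ unfolding independent_cover_def
    by (intro exI[of _ "(\<lambda>k. S k \<inter> V) ` AZ"]) auto
qed

text \<open>Class and gadget atoms of weight \<epsilon> produce all entries off the diagonal;
  \<open>s\<close> is their joint contribution. Singletons then fill up the diagonal, and the empty
  atom brings the total weight to 1.\<close>

lemma decomposition_of_colouring:
  assumes c: "\<And>i j. i \<in> V \<Longrightarrow> j \<in> V \<Longrightarrow> i \<noteq> j \<Longrightarrow> conf i j \<Longrightarrow> c i \<noteq> (c j :: nat)"
  obtains I :: "atom set" and p S where "finite I" "card I \<le> card (c ` V) + 2 * card Y + card V + 2"
    "\<And>a. a \<in> I \<Longrightarrow> p a \<ge> (0::real)" "(\<Sum>a\<in>I. p a) = 1" "\<And>a. a \<in> I \<Longrightarrow> S a \<subseteq> {..<n}"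
    "\<And>i j. i < n \<Longrightarrow> j < n \<Longrightarrow> entry i j = (\<Sum>a\<in>I. p a * both (S a) i j)"
proof -
  \<comment> \<open>The atom that joins both ends of \<open>y\<close> is chosen just when their
    entry should be \<epsilon> and no common colour class supplies it.\<close>
  define joint where "joint y \<longleftrightarrow> c (e1 y) \<noteq> c (e2 y) \<and> \<not> conf (e1 y) (e2 y)" for y
  define S where "S a = (case a of
      Class x \<Rightarrow> insert z {i \<in> V. c i = x}
    | Gadget y b \<Rightarrow> insert y (if joint y then (if b then {e1 y, e2 y} else {}) else
      (if b then {e1 y} else {e2 y}))
    | Singleton i \<Rightarrow> {i} | Empty \<Rightarrow> {})" for a
  define B where "B = Class ` c ` V \<union> (\<lambda>(y, b). Gadget y b) ` (Y \<times> UNIV)"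
  define s where "s i j = (\<Sum>a\<in>B. \<epsilon> * both (S a) i j)" for i j
  have finB: "finite B" using finite_VY by (simp add: B_def)
  have inj: "inj_on (\<lambda>(y, b). Gadget y b) (Y \<times> UNIV)" by (auto simp: inj_on_def)
  have inj_Class: "inj_on Class X" and inj_Singleton: "inj_on Singleton X" for X
    by (simp_all add: inj_on_def)
  have cardB: "card B = card (c ` V) + 2 * card Y"
    unfolding B_def using finite_VY inj
    by (subst card_Un_disjoint) (auto simp: card_image inj_Class card_cartesian_product)
  have "card (c ` V) + card Y \<le> n"
  proof -
    have "card (c ` V) + card Y \<le> card V + card Y" using card_image_le[OF finite_VY(1)] by simp
    also have "\<dots> = card (V \<union> Y)" using card_Un_disjoint[OF finite_VY VY] by simp
    also have "\<dots> \<le> card {..<n}" by (rule card_mono) (use V Y in auto)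
    finally show ?thesis by simp
  qed
  then have "card B * \<epsilon> \<le> real (2 * n) * \<epsilon>" unfolding cardB using \<epsilon>(1) by (intro mult_right_mono) auto
  from order.trans[OF this \<epsilon>(2)] have cardB_\<epsilon>: "card B * \<epsilon> \<le> \<delta>" .
  have ends_less: "y < n" "e1 y < n" "e2 y < n" if "y \<in> Y" for y
    using that ends(1,2)[OF that] V Y by auto
  have SB: "S a \<subseteq> {..<n}" if "a \<in> B" for a
    using that z(1) V ends_less by (auto simp: B_def S_def split: if_splits)
  have s: "s i j = \<epsilon> * ((\<Sum>x\<in>c ` V. both (S (Class x)) i j) +
      (\<Sum>y\<in>Y. \<Sum>b\<in>UNIV. both (S (Gadget y b)) i j))" for i j
  proof -
    have "s i j = \<epsilon> * (\<Sum>a\<in>B. both (S a) i j)" by (simp add: s_def sum_distrib_left)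
    also have "(\<Sum>a\<in>B. both (S a) i j) = (\<Sum>a\<in>Class ` c ` V. both (S a) i j) +
      (\<Sum>a\<in>(\<lambda>(y, b). Gadget y b) ` (Y \<times> UNIV). both (S a) i j :: real)"
      unfolding B_def by (rule sum.union_disjoint) (use finite_VY in auto)
    also have "(\<Sum>a\<in>Class ` c ` V. both (S a) i j :: real) =
      (\<Sum>x\<in>c ` V. both (S (Class x)) i j)"
      by (subst sum.reindex[OF inj_Class]) (simp only: comp_def)
    also have "(\<Sum>a\<in>(\<lambda>(y, b). Gadget y b) ` (Y \<times> UNIV). both (S a) i j :: real) =
      (\<Sum>y\<in>Y. \<Sum>b\<in>UNIV. both (S (Gadget y b)) i j)"
      by (subst sum.reindex[OF inj]) (simp only: sum.cartesian_product comp_def case_prod_unfold)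
    finally show ?thesis .
  qed
  have cls: "(\<Sum>x\<in>c ` V. both (S (Class x)) i j) =
     (if i = z \<and> j = z then real (card (c ` V)) else
      of_bool (i \<in> V \<and> j \<in> V \<and> c i = c j \<or> i \<in> V \<and> j = z \<or> i = z \<and> j \<in> V))" (is "_ = ?r i j") for i j
  proof -
    consider "i \<in> V" "j \<in> V" | "i \<in> V" "j = z" | "i = z" "j \<in> V" | "i = z" "j = z"
      | "i \<notin> insert z V \<or> j \<notin> insert z V" by blast
    then show ?thesis
    proof cases
      case 1
      then have "(\<Sum>x\<in>c ` V. both (S (Class x)) i j) = (\<Sum>x\<in>c ` V. if x = c i then of_bool (c i =
        c j) else (0 :: real))"
        using z by (intro sum.cong) (auto simp: S_def)
      then show ?thesis using 1 z finite_VY by (auto simp: sum.delta)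
    next
      case 2
      then have "(\<Sum>x\<in>c ` V. both (S (Class x)) i j) = (\<Sum>x\<in>c ` V. if x = c i then 1 else (0 :: real))"
        using z by (intro sum.cong) (auto simp: S_def)
      then show ?thesis using 2 z finite_VY by (auto simp: sum.delta)
    next
      case 3
      then have "(\<Sum>x\<in>c ` V. both (S (Class x)) i j) = (\<Sum>x\<in>c ` V. if x = c j then 1 else (0 :: real))"
        using z by (intro sum.cong) (auto simp: S_def)
      then show ?thesis using 3 z finite_VY by (auto simp: sum.delta)
    next
      case 4
      then show ?thesis by (simp add: S_def)
    next
      case 5
      then have "(\<Sum>x\<in>c ` V. both (S (Class x)) i j) = (\<Sum>x\<in>c ` V. 0 :: real)"
        by (intro sum.cong) (auto simp: S_def)
      then show ?thesis using 5 by auto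
    qed
  qed
  let ?g = "\<lambda>i j y. \<Sum>b\<in>UNIV. both (S (Gadget y b)) i j :: real"
  have g_local: "?g i j y = 0" if "y \<in> Y" "i \<in> V" "j \<in> V" "i \<noteq> j" "{e1 y, e2 y} \<noteq> {i, j}" for i j y
    using that VY ends by (auto simp: S_def UNIV_bool)
  \<comment> \<open>Among the gadgets only that of this very pair contributes. It adds \<epsilon> if
    \<open>joint\<close> holds, and the classes add \<epsilon> if the colours agree; together this
    is \<epsilon> exactly for non-conflicting pairs.\<close>
  have sV: "s i j = entry i j" if ij: "i \<in> V" "j \<in> V" "i \<noteq> j" for i j
  proof -
    obtain y where y: "y \<in> Y" "{e1 y, e2 y} = {i, j}" and u: "\<And>y'. y' \<in> Y \<Longrightarrow> {e1 y', e2 y'} = {i, j} \<Longrightarrow> y' = y"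
      using pair[OF ij] by (elim ex1E) blast
    have "(\<Sum>y\<in>Y. ?g i j y) = (\<Sum>y'\<in>Y. if y' = y then ?g i j y else 0)"
    proof (rule sum.cong[OF refl])
      fix y' assume y': "y' \<in> Y"
      show "?g i j y' = (if y' = y then ?g i j y else 0)"
      proof (cases "y' = y")
        case False
        then have "{e1 y', e2 y'} \<noteq> {i, j}" using u[OF y'] by blast
        from g_local[OF y' ij this] False show ?thesis by simp
      qed simp
    qed
    also have "\<dots> = ?g i j y" using y finite_VY by simp
    also have "\<dots> = of_bool (c i \<noteq> c j \<and> \<not> conf i j)"
    proof -
      have "y \<notin> V" using y VY by auto
      then have "i \<noteq> y" "j \<noteq> y" using that by auto
      moreover have ij_ends: "i = e1 y \<and> j = e2 y \<or> i = e2 y \<and> j = e1 y" using y(2)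
        by (auto simp: doubleton_eq_iff)
      moreover have "joint y \<longleftrightarrow> c i \<noteq> c j \<and> \<not> conf i j"
        using ij_ends conf_sym[of "e1 y" "e2 y"] unfolding joint_def by metis
      ultimately show ?thesis using ij(3) by (elim disjE) (simp_all add: S_def UNIV_bool)
    qed
    finally show ?thesis unfolding s cls using ij z c[OF ij] by (auto simp: entry_def)
  qed
  have sY: "s i j = entry i j" if "j \<in> Y" for i j
  proof -
    have "j \<notin> V" using that VY by auto
    then have "j \<noteq> z" "j \<noteq> e1 y" "j \<noteq> e2 y" if "y \<in> Y" for y using ends[OF that] z \<open>j \<in> Y\<close> by auto
    note ne = this
    have "(\<Sum>y\<in>Y. ?g i j y) = (\<Sum>y\<in>Y. if y = j then ?g i j j else 0)"
      using ne by (intro sum.cong) (auto simp: S_def)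
    also have "\<dots> = ?g i j j" using that finite_VY by simp
    also have "\<dots> = (if i = j then 2 else of_bool (i \<in> {e1 j, e2 j}))"
      using ends(3)[OF that] by (auto simp: S_def UNIV_bool)
    finally show ?thesis unfolding s cls using that \<open>j \<notin> V\<close> ne[OF that] ends[OF that] z VY
      by (auto simp: entry_def)
  qed
  have s_sym: "s i j = s j i" for i j by (simp add: s_def conj_commute)
  have sz: "s i z = entry i z" if "i \<in> V" for i
  proof -
    have "(\<Sum>y\<in>Y. ?g i z y) = 0"
      using z ends by (intro sum.neutral) (auto simp: S_def)
    then show ?thesis unfolding s cls using that z by (auto simp: entry_def)
  qed
  have s0: "s i j = 0 \<and> entry i j = 0" if "j \<notin> insert z (V \<union> Y)" for i j
  proof -
    have "j \<notin> S a" if "a \<in> B" for a using that \<open>j \<notin> _\<close> ends by (auto simp: B_def S_def split: if_splits)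
    then have "s i j = 0" unfolding s_def by (intro sum.neutral) auto
    then show ?thesis using that by (auto simp: entry_def)
  qed
  have off: "s i j = entry i j" if "i \<noteq> j" for i j
  proof (cases "i \<in> Y \<or> j \<in> Y \<or> i \<notin> insert z (V \<union> Y) \<or> j \<notin> insert z (V \<union> Y)")
    case True
    then show ?thesis
      using sY[of j i] sY[of i j] s0[of j i] s0[of i j] s_sym[of i j] entry_sym[of i j] by auto
  next
    case False
    then show ?thesis using that sV[of i j] sz[of i] sz[of j] s_sym[of i j] entry_sym[of i j] by auto
  qed
  have diag: "s i i = entry i i" if "i \<notin> insert z V" for i
    using that sY[of i i] s0[of i i] by (cases "i \<in> Y") simp_all
  have s_le: "s i i \<le> \<delta>" for i
  proof -
    have "s i i \<le> (\<Sum>a\<in>B. \<epsilon>)" unfolding s_def by (intro sum_mono) (use \<epsilon> in auto)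
    then show ?thesis using cardB_\<epsilon> by simp
  qed
  define J where "J = B \<union> Singleton ` insert z V"
  \<comment> \<open>A singleton carries what its diagonal entry still lacks, which is non-negative
    by \<open>s_le\<close>.\<close>
  define q where "q a = (case a of Singleton i \<Rightarrow> \<delta> - s i i | _ \<Rightarrow> \<epsilon>)" for a
  define p where "p a = (if a = Empty then 1 - (\<Sum>a\<in>J. q a) else q a)" for a
  have finJ: "finite J" and E: "Empty \<notin> J" using finB finite_VY by (auto simp: J_def B_def)
  have BS: "B \<inter> Singleton ` insert z V = {}" by (auto simp: B_def)
  have dec: "entry i j = (\<Sum>a\<in>J. q a * both (S a) i j)" for i j
  proof -
    have "(\<Sum>a\<in>J. q a * both (S a) i j) = (\<Sum>a\<in>B. q a * both (S a) i j) +
      (\<Sum>a\<in>Singleton ` insert z V. q a * both (S a) i j)"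
      unfolding J_def using finB finite_VY BS by (intro sum.union_disjoint) auto
    also have "(\<Sum>a\<in>B. q a * both (S a) i j) = s i j"
      unfolding s_def by (intro sum.cong) (auto simp: q_def B_def)
    also have "(\<Sum>a\<in>Singleton ` insert z V. q a * both (S a) i j) =
      (\<Sum>x\<in>insert z V. if x = i then of_bool (i = j) * (\<delta> - s i i) else 0)"
      unfolding sum.reindex[OF inj_Singleton] by (intro sum.cong) (auto simp: S_def q_def)
    also have "\<dots> = of_bool (i \<in> insert z V \<and> i = j) * (\<delta> - s i i)"
      using finite_VY by (subst sum.delta) auto
    finally show ?thesis
      using off[of i j] diag[of i] entry_simps(7)[of i] by (cases "i = j"; cases "i \<in> insert z V") simp_all
  qed
  have q_nonneg: "q a \<ge> 0" for a using s_le \<epsilon> by (cases a) (auto simp: q_def)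
  have SJ: "S a \<subseteq> {..<n}" "S a \<noteq> {}" if "a \<in> J" for a
    using that SB z V by (auto simp: J_def S_def B_def)
  \<comment> \<open>No atom labelled by \<open>J\<close> is empty, so their total weight is at most
    the trace and leaves a non-negative weight for \<open>Empty\<close>.\<close>
  have "(\<Sum>a\<in>J. q a) \<le> (\<Sum>a\<in>J. \<Sum>i<n. q a * both (S a) i i)"
  proof (rule sum_mono)
    fix a assume a: "a \<in> J"
    then obtain i where i: "i \<in> S a" using SJ by blast
    have "q a * both (S a) i i \<le> (\<Sum>i<n. q a * both (S a) i i)"
      by (rule member_le_sum[where f = "\<lambda>i. q a * both (S a) i i"])
        (use i SJ a q_nonneg in auto)
    then show "q a \<le> (\<Sum>i<n. q a * both (S a) i i)" using i by simp
  qed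
  also have "\<dots> = (\<Sum>i<n. \<Sum>a\<in>J. q a * both (S a) i i)" by (rule sum.swap)
  also have "\<dots> = (\<Sum>i<n. entry i i)" by (simp only: dec)
  also have "\<dots> \<le> (\<Sum>i<n. \<delta>)" by (intro sum_mono entry_le)
  also have "\<dots> < 1" using \<delta> by simp
  finally have le1: "(\<Sum>a\<in>J. q a) \<le> 1" by simp
  have pq: "p a = q a" if "a \<in> J" for a
  proof -
    have "a \<noteq> Empty" using that E by blast
    then show ?thesis unfolding p_def by simp
  qed
  show ?thesis
  proof (rule that[of "insert Empty J" p S])
    show "finite (insert Empty J)" using finJ by simp
    have "card (Singleton ` insert z V) = card V + 1"
      using finite_VY z by (simp add: card_image[OF inj_Singleton] del: image_insert)
    then have "card J \<le> card (c ` V) + 2 * card Y + card V + 1"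
      unfolding J_def using card_Un_le[of B "Singleton ` insert z V"] cardB by simp
    then show "card (insert Empty J) \<le> card (c ` V) + 2 * card Y + card V + 2"
      using finJ E by simp
    show "p a \<ge> 0" for a using q_nonneg le1 by (simp add: p_def)
    show "(\<Sum>a\<in>insert Empty J. p a) = 1"
      using finJ E pq by (simp add: p_def)
    show "S a \<subseteq> {..<n}" if "a \<in> insert Empty J" for a using that SJ by (auto simp: S_def)
    show "entry i j = (\<Sum>a\<in>insert Empty J. p a * both (S a) i j)" for i j
      using finJ E by (simp add: dec pq S_def)
  qed
qed

end

section \<open>From weighted sets to decompositions in the correlation polytope\<close>

lemma bit_set_encode:
  assumes "S \<subseteq> {..<n}"
  shows "set_encode S \<le> P n" "i < n \<Longrightarrow> bit (set_encode S) i \<longleftrightarrow> i \<in> S"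
proof -
  have fin: "finite S" using assms finite_subset by blast
  have "set_encode S \<le> set_encode {..<n}"
    unfolding set_encode_def by (rule sum_mono2) (use assms in auto)
  also have "set_encode {..<n} = P n" unfolding set_encode_def P_def
    by (simp add: sum_power2 lessThan_atLeast0)
  finally show "set_encode S \<le> P n" .
  show "bit (set_encode S) i \<longleftrightarrow> i \<in> S"
  proof -
    have "i \<in> set_decode (set_encode S) \<longleftrightarrow> i \<in> S" by (simp only: set_encode_inverse[OF fin])
    then show ?thesis unfolding set_decode_def bit_iff_odd by simp
  qed
qed

lemma outer_xvec: "i < n \<Longrightarrow> j < n \<Longrightarrow> outer (xvec n k) $$ (i, j) = of_bool (bit k i \<and> bit k j)"
  by (simp add: outer_def xvec_def)

lemma le_P_iff: "k \<le> P n \<longleftrightarrow> k < 2 ^ n"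
proof -
  have "(2::nat) ^ n > 0" by simp
  then show ?thesis unfolding P_def by linarith
qed

text \<open>\<open>set_encode S\<close> is the number \<open>k\<close> for which
  \<open>xvec n k\<close> is the indicator vector of \<open>S\<close>. Labels with the same set have
  their weights added, which can only reduce the number of non-zero components.\<close>

lemma decomposition_of_atoms:
  assumes I: "finite I" "\<And>a. a \<in> I \<Longrightarrow> p a \<ge> (0::real)" "(\<Sum>a\<in>I. p a) = 1" "\<And>a. a \<in> I \<Longrightarrow> S a \<subseteq> {..<n}"
  shows "\<exists>q. is_decomposition n (mat n n (\<lambda>(i, j). \<Sum>a\<in>I. p a * both (S a) i j)) q \<and>
    norm0 q \<le> card I"
proof -
  let ?code = "\<lambda>a. set_encode (S a)"
  define q where "q k = (\<Sum>a\<in>{a \<in> I. ?code a = k}. p a)" for k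
  have sum_q: "(\<Sum>k\<le>P n. q k * h k) = (\<Sum>a\<in>I. p a * h (?code a))" for h
  proof -
    have "(\<Sum>k\<le>P n. q k * h k) = (\<Sum>k\<le>P n. \<Sum>a\<in>{a \<in> I. ?code a = k}. p a * h (?code a))"
      unfolding q_def sum_distrib_right by (intro sum.cong refl) simp
    also have "\<dots> = (\<Sum>a\<in>I. p a * h (?code a))"
      by (rule sum.group) (use I bit_set_encode(1) in auto)
    finally show ?thesis .
  qed
  let ?M = "mat n n (\<lambda>(i, j). \<Sum>a\<in>I. p a * both (S a) i j)"
  have "?M = mat n n (\<lambda>(i, j). \<Sum>k \<le> P n. vec (2 ^ n) q $ k * outer (xvec n k) $$ (i, j))"
  proof (rule cong_mat[OF refl refl])
    fix i j assume ij: "i < n" "j < n"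
    have "(\<Sum>k \<le> P n. vec (2 ^ n) q $ k * outer (xvec n k) $$ (i, j)) = (\<Sum>k\<le>P n. q k * of_bool (bit k i \<and>
      bit k j))"
      by (rule sum.cong) (auto simp: le_P_iff outer_xvec[OF ij])
    also have "\<dots> = (\<Sum>a\<in>I. p a * both (S a) i j)"
      unfolding sum_q by (rule sum.cong[OF refl]) (simp only: bit_set_encode(2)[OF I(4)] ij)
    finally show "(case (i, j) of (i, j) \<Rightarrow> \<Sum>a\<in>I. p a * both (S a) i j) =
      (case (i, j) of (i, j) \<Rightarrow> \<Sum>k \<le> P n. vec (2 ^ n) q $ k * outer (xvec n k) $$ (i, j))" by simp
  qed
  moreover have "(\<Sum>k\<le>P n. vec (2 ^ n) q $ k) = 1"
  proof -
    have "(\<Sum>k\<le>P n. vec (2 ^ n) q $ k) = (\<Sum>k\<le>P n. q k * 1)"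
      by (rule sum.cong) (auto simp: le_P_iff)
    then show ?thesis unfolding sum_q using I(3) by simp
  qed
  moreover have "\<forall>k\<le>P n. 0 \<le> vec (2 ^ n) q $ k"
    using I(2) by (auto simp: le_P_iff q_def intro!: sum_nonneg)
  ultimately have dec: "is_decomposition n ?M (vec (2 ^ n) q)"
    unfolding is_decomposition_def by simp
  have "{k. k < 2 ^ n \<and> vec (2 ^ n) q $ k \<noteq> 0} \<subseteq> ?code ` I"
  proof
    fix k assume "k \<in> {k. k < 2 ^ n \<and> vec (2 ^ n) q $ k \<noteq> 0}"
    then have "q k \<noteq> 0" by (metis (mono_tags, lifting) index_vec mem_Collect_eq)
    then have "{a \<in> I. ?code a = k} \<noteq> {}" unfolding q_def by (metis sum.empty)
    then show "k \<in> ?code ` I" by auto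
  qed
  then have "norm0 (vec (2 ^ n) q) \<le> card (?code ` I)"
    unfolding norm0_def by (simp add: card_mono I(1))
  also have "\<dots> \<le> card I" by (rule card_image_le[OF I(1)])
  finally show ?thesis using dec by blast
qed

text \<open>\<open>convex_mat\<close> speaks of two matrices at a time, so the weights other than
  \<open>p x\<close> are rescaled by \<open>1 - p x\<close>; if that is 0, they all vanish.\<close>

lemma convex_mat_sum:
  assumes t: "convex_mat n t"
  shows "finite K \<Longrightarrow> (\<And>k. k \<in> K \<Longrightarrow> A k \<in> t) \<Longrightarrow> (\<And>k. k \<in> K \<Longrightarrow> p k \<ge> 0) \<Longrightarrow> (\<Sum>k\<in>K. p k) = 1 \<Longrightarrow>
    mat n n (\<lambda>(i, j). \<Sum>k\<in>K. p k * A k $$ (i, j)) \<in> t"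
proof (induction K arbitrary: p rule: finite_induct)
  case empty
  then show ?case by simp
next
  case (insert x K)
  have carr: "A k \<in> carrier_mat n n" if "k \<in> insert x K" for k
    using insert.prems(1)[OF that] t unfolding convex_mat_def by blast
  have px: "p x \<ge> 0" and sK: "(\<Sum>k\<in>K. p k) = 1 - p x"
    using insert.prems(2,3) insert.hyps by auto
  have pK: "p k \<ge> 0" if "k \<in> K" for k using insert.prems(2) that by simp
  show ?case
  proof (cases "p x = 1")
    case True
    then have "p k = 0" if "k \<in> K" for k
      using sK sum_nonneg_eq_0_iff[OF insert.hyps(1), of p] pK that by simp
    then have "(\<Sum>k\<in>insert x K. p k * A k $$ (i, j)) = A x $$ (i, j)" for i j
      using insert.hyps True by simp
    then have "mat n n (\<lambda>(i, j). \<Sum>k\<in>insert x K. p k * A k $$ (i, j)) = A x"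
      using carr[of x] by (intro eq_matI) auto
    then show ?thesis using insert.prems(1)[OF insertI1] by (simp only:)
  next
    case False
    let ?s = "1 - p x"
    have "(\<Sum>k\<in>K. p k) \<ge> 0" using pK by (simp add: sum_nonneg)
    then have s: "?s > 0" using False sK by simp
    let ?B = "mat n n (\<lambda>(i, j). \<Sum>k\<in>K. (p k / ?s) * A k $$ (i, j))"
    have "?B \<in> t"
    proof (rule insert.IH)
      show "(\<Sum>k\<in>K. p k / ?s) = 1" using sK s by (simp add: sum_divide_distrib[symmetric])
    qed (use insert.prems pK s in auto)
    moreover have "A x \<in> t" using insert.prems(1) by simp
    ultimately have "p x \<cdot>\<^sub>m A x + ?s \<cdot>\<^sub>m ?B \<in> t"
      using t px s unfolding convex_mat_def by auto
    also have "p x \<cdot>\<^sub>m A x + ?s \<cdot>\<^sub>m ?B = mat n n (\<lambda>(i, j). \<Sum>k\<in>insert x K. p k * A k $$ (i, j))"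
      using carr[of x] insert.hyps s by (intro eq_matI) (auto simp: sum_distrib_left)
    finally show ?thesis .
  qed
qed

lemma COR_of_decomposition:
  assumes "is_decomposition n M q"
  shows "M \<in> COR n"
  unfolding COR_def hull_def
proof (rule InterI)
  fix t assume "t \<in> {t. convex_mat n t \<and> {outer (xvec n k) |k. k \<le> P n} \<subseteq> t}"
  then have "convex_mat n t" "\<And>k. k \<in> {..P n} \<Longrightarrow> outer (xvec n k) \<in> t" by auto
  from convex_mat_sum[OF this(1), of "{..P n}" "\<lambda>k. outer (xvec n k)" "\<lambda>k. q $ k"] this(2) assms
  show "M \<in> t" unfolding is_decomposition_def by simp
qed

context colour_matrix
begin

lemma is_decomposition_of_colouring:
  assumes c: "\<And>i j. i \<in> V \<Longrightarrow> j \<in> V \<Longrightarrow> i \<noteq> j \<Longrightarrow> conf i j \<Longrightarrow> c i \<noteq> (c j :: nat)"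
  shows "\<exists>q. is_decomposition n (mat n n (\<lambda>(i, j). entry i j)) q \<and>
    norm0 q \<le> card (c ` V) + 2 * card Y + card V + 2"
proof (rule decomposition_of_colouring[OF c])
  fix I :: "atom set" and p S
  assume I: "finite I" "\<And>a. a \<in> I \<Longrightarrow> p a \<ge> (0::real)" "(\<Sum>a\<in>I. p a) = 1" "\<And>a. a \<in> I \<Longrightarrow> S a \<subseteq> {..<n}"
    and card: "card I \<le> card (c ` V) + 2 * card Y + card V + 2"
    and e: "\<And>i j. i < n \<Longrightarrow> j < n \<Longrightarrow> entry i j = (\<Sum>a\<in>I. p a * both (S a) i j)"
  have eq: "mat n n (\<lambda>(i, j). entry i j) = mat n n (\<lambda>(i, j). \<Sum>a\<in>I. p a * both (S a) i j)"
    by (rule cong_mat) (simp_all add: e)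
  have "\<exists>q. is_decomposition n (mat n n (\<lambda>(i, j). entry i j)) q \<and> norm0 q \<le> card I"
    unfolding eq by (rule decomposition_of_atoms; fact I)
  with card show ?thesis by (meson le_trans)
qed

lemma entry_in_COR: "mat n n (\<lambda>(i, j). entry i j) \<in> COR n"
proof -
  have "\<exists>q. is_decomposition n (mat n n (\<lambda>(i, j). entry i j)) q \<and>
    norm0 q \<le> card ((\<lambda>i. i) ` V) + 2 * card Y + card V + 2"
    by (rule is_decomposition_of_colouring)
  then show ?thesis by (elim exE conjE) (rule COR_of_decomposition)
qed

lemma rank_iff_classes:
  "(\<exists>q. is_decomposition n (mat n n (\<lambda>(i, j). entry i j)) q \<and> norm0 q \<le> m + 2 * card Y + card V + 2) \<longleftrightarrow>
   independent_cover m V conf" (is "?L = ?R")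
proof
  assume ?L
  then obtain q where q: "is_decomposition n (mat n n (\<lambda>(i, j). entry i j)) q"
    "norm0 q \<le> m + 2 * card Y + card V + 2" by blast
  let ?S = "\<lambda>k. {i. i < n \<and> bit k i}"
  show ?R
  proof (rule classes_of_decomposition)
    show "finite {..P n}" by simp
    show "0 \<le> q $ k" if "k \<in> {..P n}" for k using q(1) that by (simp add: is_decomposition_def)
    show "(\<Sum>k\<in>{..P n}. q $ k) = 1" using q(1) by (simp add: is_decomposition_def)
    show "?S k \<subseteq> {..<n}" for k by auto
    show "entry i j = (\<Sum>k\<in>{..P n}. q $ k * both (?S k) i j)" if ij: "i < n" "j < n" for i j
    proof -
      have "mat n n (\<lambda>(i, j). entry i j) $$ (i, j) =
        mat n n (\<lambda>(i, j). \<Sum>k \<le> P n. q $ k * outer (xvec n k) $$ (i, j)) $$ (i, j)"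
        using q(1) unfolding is_decomposition_def by simp
      then show ?thesis using ij by (simp add: outer_xvec[OF ij])
    qed
    have "{k. k < dim_vec q \<and> q $ k \<noteq> 0} = {k \<in> {..P n}. q $ k \<noteq> 0}"
      using q(1) unfolding is_decomposition_def carrier_vec_def by (simp add: le_P_iff)
    then show "card {k \<in> {..P n}. q $ k \<noteq> 0} \<le> m + 2 * card Y + card V + 2"
      using q(2) unfolding norm0_def by simp
  qed
next
  assume ?R
  then obtain C where C: "finite C" "card C \<le> m" "V \<subseteq> \<Union>C"
    and ind: "\<forall>X\<in>C. X \<subseteq> V \<and> (\<forall>i\<in>X. \<forall>j\<in>X. i \<noteq> j \<longrightarrow> \<not> conf i j)"
    by (rule independent_coverE)
  \<comment> \<open>The classes of the cover may overlap: each vertex picks one of its classes as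
    \<open>g i\<close>, and \<open>h\<close> turns classes into numbers.\<close>
  have "\<forall>i\<in>V. \<exists>X. X \<in> C \<and> i \<in> X" using C(3) by blast
  from bchoice[OF this] obtain g where g: "\<And>i. i \<in> V \<Longrightarrow> g i \<in> C \<and> i \<in> g i" by auto
  obtain h :: "nat set \<Rightarrow> nat" where h: "inj_on h C" using finite_imp_inj_to_nat_seg[OF C(1)] by auto
  let ?c = "\<lambda>i. h (g i)"
  have c: "?c i \<noteq> ?c j" if "i \<in> V" "j \<in> V" "i \<noteq> j" "conf i j" for i j
  proof
    assume "?c i = ?c j"
    then have "g i = g j" using inj_onD[OF h] g[OF that(1)] g[OF that(2)] by simp
    then show False using ind g[OF that(1)] g[OF that(2)] that(3,4) by metis
  qed
  have "\<exists>q. is_decomposition n (mat n n (\<lambda>(i, j). entry i j)) q \<and>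
    norm0 q \<le> card (?c ` V) + 2 * card Y + card V + 2"
    by (rule is_decomposition_of_colouring) (rule c)
  then obtain q where q: "is_decomposition n (mat n n (\<lambda>(i, j). entry i j)) q"
    "norm0 q \<le> card (?c ` V) + 2 * card Y + card V + 2"
    by (elim exE conjE) (rule that)
  have "card (?c ` V) \<le> card (h ` C)" by (rule card_mono) (use C(1) g in auto)
  also have "\<dots> \<le> m" using card_image_le[OF C(1), of h] C(2) by simp
  finally have "norm0 q \<le> m + 2 * card Y + card V + 2" using q(2) by simp
  with q(1) show ?L by (intro exI[of _ q] conjI)
qed

end

section \<open>Vertices, pairs and the special index as matrix indices\<close>

definition side :: "nat \<Rightarrow> nat" where
  "side U = U + 1"

lemma less_side: "q < side U \<longleftrightarrow> q \<le> U"
  by (simp add: side_def less_Suc_eq_le)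

lemma side_pos [simp]: "side U > 0"
  by (simp add: side_def)

text \<open>The pair (u, u) stands for the vertex u, a pair (p, q) with p < q for the gadget of p
  and q, and (U, U), available because \<open>side U\<close> exceeds \<open>U\<close>, for the
  special index. All other indices have zero rows, so the dimension is independent of which numbers
  below \<open>U\<close> are vertices.\<close>

definition pair_code :: "nat \<Rightarrow> nat \<Rightarrow> nat \<Rightarrow> nat" where
  "pair_code U p q = p * side U + q"

lemma pair_code_div [simp]: "q \<le> U \<Longrightarrow> pair_code U p q div side U = p"
  and pair_code_mod [simp]: "q \<le> U \<Longrightarrow> pair_code U p q mod side U = q"
  unfolding less_side[symmetric] pair_code_def by simp_all

lemma pair_code_div_mod: "pair_code U (i div side U) (i mod side U) = i"
  unfolding pair_code_def by (rule div_mult_mod_eq)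

lemma pair_code_less: "p \<le> U \<Longrightarrow> q \<le> U \<Longrightarrow> pair_code U p q < side U * side U"
proof -
  assume "p \<le> U" "q \<le> U"
  then have "p * side U + q < Suc p * side U" "Suc p * side U \<le> side U * side U"
    using less_side by (simp, intro mult_right_mono) (auto simp: side_def)
  then show ?thesis unfolding pair_code_def by simp
qed

lemma pair_code_eq: "q \<le> U \<Longrightarrow> q' \<le> U \<Longrightarrow> pair_code U p q = pair_code U p' q' \<longleftrightarrow> p = p' \<and> q = q'"
  by (metis pair_code_div pair_code_mod)

definition is_vertex :: "nat \<Rightarrow> (nat \<Rightarrow> bool) \<Rightarrow> nat \<Rightarrow> bool" where
  "is_vertex U val i \<longleftrightarrow> i div side U = i mod side U \<and> i div side U < U \<and> val (i div side U)"

definition is_gadget :: "nat \<Rightarrow> (nat \<Rightarrow> bool) \<Rightarrow> nat \<Rightarrow> bool" where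
  "is_gadget U val i \<longleftrightarrow> i div side U < i mod side U \<and> i mod side U < U \<and>
     val (i div side U) \<and> val (i mod side U)"

text \<open>The reciprocals of the matrix entries, with 0 for the entry 0.\<close>

definition denom :: "nat \<Rightarrow> (nat \<Rightarrow> bool) \<Rightarrow> (nat \<Rightarrow> nat \<Rightarrow> bool) \<Rightarrow> nat \<Rightarrow> nat \<Rightarrow> nat" where
  "denom U val conf i j =
    (if i = j then
       (if is_vertex U val i \<or> i = pair_code U U U then 2 * (side U * side U)
        else if is_gadget U val i then 2 * (side U * side U) * (side U * side U) else 0)
     else if is_vertex U val i \<and> is_vertex U val j \<and> \<not> conf (i div side U) (j div side U) \<or>
       is_vertex U val i \<and> j = pair_code U U U \<or> i = pair_code U U U \<and> is_vertex U val j \<or>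
       is_vertex U val i \<and> is_gadget U val j \<and>
         (i div side U = j div side U \<or> i div side U = j mod side U) \<or>
       is_vertex U val j \<and> is_gadget U val i \<and>
         (j div side U = i div side U \<or> j div side U = i mod side U)
     then 4 * (side U * side U) * (side U * side U) else 0)"

definition colour_mat :: "nat \<Rightarrow> (nat \<Rightarrow> bool) \<Rightarrow> (nat \<Rightarrow> nat \<Rightarrow> bool) \<Rightarrow> rat mat" where
  "colour_mat U val conf =
     mat (side U * side U) (side U * side U) (\<lambda>(i, j). 1 / of_nat (denom U val conf i j))"

text \<open>The square of the vertex set splits into the diagonal and two mirror images. This
  evaluates the constant in the rank bound.\<close>

lemma card_ordered_pairs:
  assumes "finite verts"
  shows "2 * card {(p, q). p \<in> verts \<and> q \<in> verts \<and> p < (q :: nat)} + card verts = card verts * card verts"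
proof -
  let ?L = "{(p, q). p \<in> verts \<and> q \<in> verts \<and> p < q}" and ?D = "(\<lambda>p. (p, p)) ` verts"
  have fin: "finite ?L" by (rule finite_subset[of _ "verts \<times> verts"]) (use assms in auto)
  have R: "card (prod.swap ` ?L) = card ?L" by (rule card_image) (auto simp: inj_on_def)
  have D: "card ?D = card verts" by (rule card_image) (auto simp: inj_on_def)
  have "verts \<times> verts = (?L \<union> prod.swap ` ?L) \<union> ?D" by (auto simp: image_iff)
  moreover have "card ((?L \<union> prod.swap ` ?L) \<union> ?D) = card (?L \<union> prod.swap ` ?L) + card ?D"
    by (rule card_Un_disjoint) (use fin assms in auto)
  moreover have "card (?L \<union> prod.swap ` ?L) = card ?L + card (prod.swap ` ?L)"
    by (rule card_Un_disjoint) (use fin in auto)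
  ultimately show ?thesis using R D card_cartesian_product[of verts verts] by simp
qed

context
  fixes U :: nat and val :: "nat \<Rightarrow> bool" and conf :: "nat \<Rightarrow> nat \<Rightarrow> bool"
  assumes conf_sym: "\<And>u u'. conf u u' = conf u' u"
begin

abbreviation "mat_dim \<equiv> side U * side U"
abbreviation "verts \<equiv> {u. u < U \<and> val u}"
abbreviation "vpos u \<equiv> pair_code U u u"

lemma vertices_eq: "{i. i < mat_dim \<and> is_vertex U val i} = vpos ` verts"
proof (intro equalityI subsetI)
  fix i assume "i \<in> {i. i < mat_dim \<and> is_vertex U val i}"
  then have "i div side U \<in> verts" "i = vpos (i div side U)"
    using pair_code_div_mod[of U i] unfolding is_vertex_def by auto
  then show "i \<in> vpos ` verts" by blast
next
  fix i assume "i \<in> vpos ` verts"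
  then obtain u where u: "u < U" "val u" "i = vpos u" by blast
  then have "i div side U = u" "i mod side U = u" "i < mat_dim"
    using pair_code_less[of u U u] pair_code_div[of u U u] pair_code_mod[of u U u] by simp_all
  then show "i \<in> {i. i < mat_dim \<and> is_vertex U val i}" using u unfolding is_vertex_def by simp
qed

lemma gadgets_eq:
  "{i. i < mat_dim \<and> is_gadget U val i} = (\<lambda>(p, q). pair_code U p q) ` {(p, q). p \<in> verts \<and> q \<in> verts \<and>
    p < q}"
proof (intro equalityI subsetI)
  fix i assume i: "i \<in> {i. i < mat_dim \<and> is_gadget U val i}"
  then have "(i div side U, i mod side U) \<in> {(p, q). p \<in> verts \<and> q \<in> verts \<and> p < q}"
    unfolding is_gadget_def by auto
  then show "i \<in> (\<lambda>(p, q). pair_code U p q) ` {(p, q). p \<in> verts \<and> q \<in> verts \<and> p < q}"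
    by (rule rev_image_eqI) (use pair_code_div_mod[of U i] in simp)
next
  fix i assume "i \<in> (\<lambda>(p, q). pair_code U p q) ` {(p, q). p \<in> verts \<and> q \<in> verts \<and> p < q}"
  then obtain p q where pq: "p < q" "q < U" "val p" "val q" "i = pair_code U p q" by auto
  then have "i div side U = p" "i mod side U = q" "i < mat_dim"
    using pair_code_less[of p U q] pair_code_div[of q U p] pair_code_mod[of q U p] by simp_all
  then show "i \<in> {i. i < mat_dim \<and> is_gadget U val i}" using pq unfolding is_gadget_def by simp
qed

text \<open>For dimension N the weights are \<delta> = 1 / (2 N), which makes N \<delta> = 1/2, and
  \<epsilon> = 1 / (4 N^2), which gives 2 N \<epsilon> = \<delta>. All entries, including 2
  \<epsilon>, are thus reciprocals of integers or 0.\<close>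

interpretation cm: colour_matrix mat_dim "vpos ` verts" "(\<lambda>(p, q). pair_code U p q) ` {(p, q). p \<in> verts \<and>
  q \<in> verts \<and> p < q}"
  "vpos U" "\<lambda>y. vpos (y div side U)" "\<lambda>y. vpos (y mod side U)" "\<lambda>i j. conf (i div side U) (j div side U)"
  "1 / real (4 * mat_dim * mat_dim)" "1 / real (2 * mat_dim)"
proof
  let ?Y = "(\<lambda>(p, q). pair_code U p q) ` {(p, q). p \<in> verts \<and> q \<in> verts \<and> p < q}"
  show "vpos ` verts \<subseteq> {..<mat_dim}" unfolding vertices_eq[symmetric] by blast
  show "?Y \<subseteq> {..<mat_dim}" unfolding gadgets_eq[symmetric] by blast
  show "vpos U < mat_dim" by (rule pair_code_less) auto
  show "vpos U \<notin> vpos ` verts" by (auto simp: pair_code_eq)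
  show "vpos U \<notin> ?Y" by (auto simp: pair_code_eq)
  show "vpos ` verts \<inter> ?Y = {}" by (auto simp: pair_code_eq)
  have y: "y div side U \<in> verts \<and> y mod side U \<in> verts \<and> y div side U < y mod side U" if "y \<in> ?Y" for y
    using that unfolding gadgets_eq[symmetric] is_gadget_def by auto
  show "vpos (y div side U) \<in> vpos ` verts" "vpos (y mod side U) \<in> vpos ` verts" if "y \<in> ?Y" for y
    using y[OF that] by blast+
  show "vpos (y div side U) \<noteq> vpos (y mod side U)" if "y \<in> ?Y" for y
    using y[OF that] pair_code_eq[of "y div side U" U "y mod side U"] by auto
  show "\<exists>!y. y \<in> ?Y \<and> {vpos (y div side U), vpos (y mod side U)} = {i, j}"
    if ij: "i \<in> vpos ` verts" "j \<in> vpos ` verts" "i \<noteq> j" for i j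
  proof -
    obtain u u' where u: "u \<in> verts" "u' \<in> verts" "i = vpos u" "j = vpos u'" using ij by blast
    have ends: "{vpos p, vpos q} = {i, j} \<longleftrightarrow> p = min u u' \<and> q = max u u'" if "p < q" "q < U" for p q
      using that u ij(3) by (auto simp: doubleton_eq_iff pair_code_eq min_def max_def)
    have ne: "u \<noteq> u'" using u ij(3) by blast
    let ?y = "pair_code U (min u u') (max u u')"
    have 1: "(min u u', max u u') \<in> {(p, q). p \<in> verts \<and> q \<in> verts \<and> p < q}" using u ne
      by (auto simp: min_def max_def)
    have 2: "?y div side U = min u u'" "?y mod side U = max u u'" using u by auto
    show ?thesis
    proof (rule ex1I[of _ ?y])
      show "?y \<in> ?Y \<and> {vpos (?y div side U), vpos (?y mod side U)} = {i, j}"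
        unfolding 2 using ends[of "min u u'" "max u u'"] 1 u by (auto intro!: rev_image_eqI[OF 1])
      fix y assume "y \<in> ?Y \<and> {vpos (y div side U), vpos (y mod side U)} = {i, j}"
      then have "y div side U = min u u' \<and> y mod side U = max u u'"
        using ends[of "y div side U" "y mod side U"] y[of y] by simp
      then show "y = ?y" using pair_code_div_mod[of U y] by simp
    qed
  qed
  show "conf (i div side U) (j div side U) = conf (j div side U) (i div side U)" for i j
    by (rule conf_sym)
  have mat_dim: "real mat_dim > 0" by simp
  show "0 < 1 / real (4 * mat_dim * mat_dim)" by simp
  show "real (2 * mat_dim) * (1 / real (4 * mat_dim * mat_dim)) \<le> 1 / real (2 * mat_dim)" using mat_dim
    by (simp add: field_simps)
  show "real mat_dim * (1 / real (2 * mat_dim)) < 1" using mat_dim by (simp add: field_simps)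
qed

lemma entry_eq:
  assumes "i < mat_dim" "j < mat_dim"
  shows "cm.entry i j = 1 / real (denom U val conf i j)"
proof -
  have V: "k \<in> vpos ` verts \<longleftrightarrow> is_vertex U val k" if "k < mat_dim" for k
    unfolding vertices_eq[symmetric] using that by blast
  have Y: "k \<in> (\<lambda>(p, q). pair_code U p q) ` {(p, q). p \<in> verts \<and> q \<in> verts \<and> p < q} \<longleftrightarrow> is_gadget U val k"
    if "k < mat_dim" for k
    unfolding gadgets_eq[symmetric] using that by blast
  have vv: "k = vpos u \<longleftrightarrow> k div side U = u" if "is_vertex U val k" "u \<le> U" for k u
    using that pair_code_div_mod[of U k] pair_code_div[of u U u] unfolding is_vertex_def by auto
  have g: "k div side U \<le> U" "k mod side U \<le> U" if "is_gadget U val k" for k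
    using that unfolding is_gadget_def by auto
  have z: "\<not> is_vertex U val (vpos U)" "\<not> is_gadget U val (vpos U)"
    unfolding is_vertex_def is_gadget_def by simp_all
  have vg: "\<not> (is_vertex U val k \<and> is_gadget U val k)" for k unfolding is_vertex_def is_gadget_def by auto
  show ?thesis
  proof (cases "i = j")
    case True
    show ?thesis unfolding cm.entry_def denom_def insert_iff V[OF assms(1)] Y[OF assms(1)] using True by simp
  next
    case False
    have vg1: "is_vertex U val i \<and> is_gadget U val j \<and> i \<in> {vpos (j div side U), vpos (j mod side U)} \<longleftrightarrow>
      is_vertex U val i \<and> is_gadget U val j \<and> (i div side U = j div side U \<or> i div side U = j mod side U)"
      using vv g by blast
    have vg2: "is_vertex U val j \<and> is_gadget U val i \<and> j \<in> {vpos (i div side U), vpos (i mod side U)} \<longleftrightarrow>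
      is_vertex U val j \<and> is_gadget U val i \<and> (j div side U = i div side U \<or> j div side U = i mod side U)"
      using vv g by blast
    show ?thesis unfolding cm.entry_def denom_def V[OF assms(1)] Y[OF assms(1)] V[OF assms(2)] Y[OF assms(2)]
        vg1 vg2
      using False vg z by auto
  qed
qed

lemma of_rat_colour_mat: "map_mat of_rat (colour_mat U val conf) =
  mat mat_dim mat_dim (\<lambda>(i, j). cm.entry i j)"
  unfolding colour_mat_def
proof (rule eq_matI)
  fix i j assume "i < dim_row (mat mat_dim mat_dim (\<lambda>(i, j). cm.entry i j))"
    "j < dim_col (mat mat_dim mat_dim (\<lambda>(i, j). cm.entry i j))"
  then have ij: "i < mat_dim" "j < mat_dim" by simp_all
  have "map_mat of_rat (mat mat_dim mat_dim (\<lambda>(i, j). 1 / of_nat (denom U val conf i j))) $$ (i, j) =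
    1 / real (denom U val conf i j)"
    using ij by (simp add: of_rat_divide)
  also have "\<dots> = cm.entry i j" by (rule entry_eq[OF ij, symmetric])
  also have "\<dots> = mat mat_dim mat_dim (\<lambda>(i, j). cm.entry i j) $$ (i, j)"
    by (simp only: index_mat(1)[OF ij] prod.case)
  finally show "map_mat of_rat (mat mat_dim mat_dim (\<lambda>(i, j). 1 / of_nat (denom U val conf i j))) $$ (i, j) =
    mat mat_dim mat_dim (\<lambda>(i, j). cm.entry i j) $$ (i, j)" .
qed simp_all

lemma colour_mat_promise:
  assumes "\<rho> \<ge> 1"
  shows "(mat_dim, \<rho>, colour_mat U val conf) \<in> COR_promise"
proof -
  let ?G = "colour_mat U val conf"
  have carr: "?G \<in> carrier_mat mat_dim mat_dim" unfolding colour_mat_def by simp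
  have cor: "map_mat of_rat ?G \<in> COR mat_dim" unfolding of_rat_colour_mat by (rule cm.entry_in_COR)
  have "transpose_mat ?G = ?G"
  proof (rule eq_matI)
    fix i j assume "i < dim_row ?G" "j < dim_col ?G"
    then have ij: "i < mat_dim" "j < mat_dim" using carr by auto
    have "1 / real (denom U val conf i j) = 1 / real (denom U val conf j i)"
      using entry_eq[OF ij] entry_eq[OF ij(2,1)] cm.entry_sym[of i j] by simp
    \<comment> \<open>A reciprocal determines its denominator even for the denominator 0, as
      \<open>1 / 0 = 0\<close>.\<close>
    then have "denom U val conf j i = denom U val conf i j" by (simp add: divide_inverse)
    then show "transpose_mat ?G $$ (i, j) = ?G $$ (i, j)"
      using ij by (simp add: colour_mat_def)
  qed (use carr in auto)
  then show ?thesis using assms carr cor unfolding COR_promise_def by (simp add: Suc_le_eq)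
qed

lemma colour_mat_yes:
  "(mat_dim, m + card verts * card verts + 2, colour_mat U val conf) \<in> COR_rank_yes \<longleftrightarrow>
   independent_cover m verts conf" (is "?L \<longleftrightarrow> _")
proof -
  let ?Y = "(\<lambda>(p, q). pair_code U p q) ` {(p, q). p \<in> verts \<and> q \<in> verts \<and> p < q}"
  have finW: "finite verts" by simp
  have inj: "inj_on vpos verts" by (auto simp: inj_on_def pair_code_eq)
  have cV: "card (vpos ` verts) = card verts" by (rule card_image[OF inj])
  have "card ?Y = card {(p, q). p \<in> verts \<and> q \<in> verts \<and> p < q}"
    by (rule card_image) (auto simp: inj_on_def pair_code_eq)
  then have cY: "2 * card ?Y + card (vpos ` verts) = card verts * card verts"
    using card_ordered_pairs[OF finW] cV by simp
  have div: "vpos u div side U = u" if "u \<in> verts" for u using that by simp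
  have "?L \<longleftrightarrow> (\<exists>q. is_decomposition mat_dim (mat mat_dim mat_dim (\<lambda>(i, j). cm.entry i j)) q \<and> norm0 q \<le>
    m + card verts * card verts + 2)"
    using colour_mat_promise[of "m + card verts * card verts + 2"]
    unfolding COR_rank_yes_def of_rat_colour_mat[symmetric] by simp
  also have "\<dots> \<longleftrightarrow> (\<exists>q. is_decomposition mat_dim (mat mat_dim mat_dim (\<lambda>(i, j). cm.entry i j)) q \<and>
      norm0 q \<le> m + 2 * card ?Y + card (vpos ` verts) + 2)"
    unfolding cY[symmetric] by (simp only: add.assoc)
  also have "\<dots> \<longleftrightarrow>
      independent_cover m (vpos ` verts) (\<lambda>i j. conf (i div side U) (j div side U))"
    by (rule cm.rank_iff_classes)
  also have "\<dots> \<longleftrightarrow> independent_cover m verts conf"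
    by (rule independent_cover_image[OF inj]) (simp only: div)
  finally show ?thesis .
qed

end

section \<open>Binary constraint problems as colouring problems\<close>

text \<open>
  A constraint problem with variables \<open>x < X\<close>, values \<open>a < D\<close> and binary constraints \<open>R\<close> is solved by
  a colouring: vertex \<open>x * (2 * D) + a\<close> stands for the value \<open>a\<close> of \<open>x\<close>, and the vertices
  \<open>x * (2 * D) + D + a\<close> with \<open>0 < a\<close> are helpers that use up one colour each.  They absorb all but one value
  of every variable, so that the one remaining colour class is a solution.
\<close>

definition csp_vertex :: "nat \<Rightarrow> nat \<Rightarrow> bool" where
  "csp_vertex D u \<longleftrightarrow> u mod (2 * D) \<noteq> D"

text \<open>Helpers conflict with each other and with the values of other variables, but not with
  the values of their own variable. Two values conflict if they belong to the same variable or
  violate \<open>R\<close> in either order, which makes the relation symmetric.\<close>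

definition csp_conf :: "nat \<Rightarrow> (nat \<Rightarrow> nat \<Rightarrow> nat \<Rightarrow> nat \<Rightarrow> bool) \<Rightarrow> nat \<Rightarrow> nat \<Rightarrow> bool" where
  "csp_conf D R u u' \<longleftrightarrow>
    (if u mod (2 * D) < D \<and> u' mod (2 * D) < D then
       u div (2 * D) = u' div (2 * D) \<or>
       \<not> (R (u div (2 * D)) (u mod (2 * D)) (u' div (2 * D)) (u' mod (2 * D)) \<and>
          R (u' div (2 * D)) (u' mod (2 * D)) (u div (2 * D)) (u mod (2 * D)))
     else u mod (2 * D) < D \<or> u' mod (2 * D) < D \<longrightarrow> u div (2 * D) \<noteq> u' div (2 * D))"

lemma csp_conf_sym: "csp_conf D R u u' = csp_conf D R u' u"
  unfolding csp_conf_def by (cases "u mod (2 * D) < D"; cases "u' mod (2 * D) < D") auto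

definition csp_solvable :: "nat \<Rightarrow> nat \<Rightarrow> (nat \<Rightarrow> nat \<Rightarrow> nat \<Rightarrow> nat \<Rightarrow> bool) \<Rightarrow> bool" where
  "csp_solvable X D R \<longleftrightarrow>
    (\<exists>t. \<forall>x<X. t x < D \<and> (\<forall>y<X. x \<noteq> y \<longrightarrow> R x (t x) y (t y)))"

section \<open>Solutions of constraint problems and colourings\<close>

context
  fixes X D :: nat and R :: "nat \<Rightarrow> nat \<Rightarrow> nat \<Rightarrow> nat \<Rightarrow> bool"
  assumes D: "D > 0"
begin

abbreviation "csp_vertices \<equiv> {u. u < X * (2 * D) \<and> csp_vertex D u}"
abbreviation "node x k \<equiv> x * (2 * D) + k"

lemma node_div_mod [simp]: "k < 2 * D \<Longrightarrow> node x k div (2 * D) = x" "k < 2 * D \<Longrightarrow> node x k mod (2 * D) = k"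
  by simp_all

lemma vertices_eq_image: "csp_vertices = (\<lambda>(x, k). node x k) ` ({..<X} \<times> ({..<2 * D} - {D}))"
proof (intro equalityI subsetI)
  fix u assume u: "u \<in> csp_vertices"
  then have "u div (2 * D) < X" "u mod (2 * D) \<noteq> D"
    using less_mult_imp_div_less unfolding csp_vertex_def by blast+
  then have "(u div (2 * D), u mod (2 * D)) \<in> {..<X} \<times> ({..<2 * D} - {D})" using D by simp
  moreover have "u = (\<lambda>(x, k). node x k) (u div (2 * D), u mod (2 * D))"
    unfolding prod.case by (rule div_mult_mod_eq[symmetric])
  ultimately show "u \<in> (\<lambda>(x, k). node x k) ` ({..<X} \<times> ({..<2 * D} - {D}))"
    by (rule rev_image_eqI)
next
  fix u assume "u \<in> (\<lambda>(x, k). node x k) ` ({..<X} \<times> ({..<2 * D} - {D}))"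
  then obtain x k where k: "x < X" "k < 2 * D" "k \<noteq> D" "u = node x k" by auto
  have "node x k < Suc x * (2 * D)" using k by simp
  also have "\<dots> \<le> X * (2 * D)" using k by (intro mult_right_mono) auto
  finally have "u < X * (2 * D)" unfolding k(4) .
  moreover have "csp_vertex D u" using k unfolding csp_vertex_def by simp
  ultimately show "u \<in> csp_vertices" by blast
qed

lemma node_in_vertices: "x < X \<Longrightarrow> k < 2 * D \<Longrightarrow> k \<noteq> D \<Longrightarrow> node x k \<in> csp_vertices"
  unfolding vertices_eq_image by (rule image_eqI[of _ _ "(x, k)"]) auto

lemma node_eq: "k < 2 * D \<Longrightarrow> k' < 2 * D \<Longrightarrow> node x k = node x' k' \<longleftrightarrow> x = x' \<and> k = k'"
  by (metis node_div_mod)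

lemma card_vertices: "card csp_vertices = X * (2 * D - 1)"
proof -
  have "inj_on (\<lambda>(x, k). node x k) ({..<X} \<times> ({..<2 * D} - {D}))"
    by (rule inj_onI) (auto simp: node_eq)
  then show ?thesis unfolding vertices_eq_image using D by (simp add: card_image card_cartesian_product)
qed

lemma conf_node:
  assumes "k < 2 * D" "k' < 2 * D"
  shows "csp_conf D R (node x k) (node x' k') \<longleftrightarrow>
    (if k < D \<and> k' < D then x = x' \<or> \<not> (R x k x' k' \<and> R x' k' x k)
     else k < D \<or> k' < D \<longrightarrow> x \<noteq> x')"
  unfolding csp_conf_def by (simp only: node_div_mod assms)

text \<open>The helpers conflict pairwise and lie in X * (D - 1) distinct classes, so at most one
  class remains. A class with a helper of \<open>x\<close> holds no value of another variable and at
  most one value of \<open>x\<close>; hence the D - 1 helpers of \<open>x\<close> cannot absorb all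
  D values. So every variable has a value in the remaining class, and values in one class are
  compatible.\<close>

lemma solution_of_classes:
  assumes "independent_cover (X * (D - 1) + 1) csp_vertices (csp_conf D R)"
  shows "csp_solvable X D R"
proof -
  obtain C where C: "finite C" "card C \<le> X * (D - 1) + 1" "csp_vertices \<subseteq> \<Union>C"
    and "\<forall>K\<in>C. K \<subseteq> csp_vertices \<and> (\<forall>u\<in>K. \<forall>u'\<in>K. u \<noteq> u' \<longrightarrow> \<not> csp_conf D R u u')"
    by (rule independent_coverE[OF assms])
  then have ind: "\<not> csp_conf D R u u'" if "K \<in> C" "u \<in> K" "u' \<in> K" "u \<noteq> u'" for K u u'
    using that by simp
  have "\<forall>u\<in>csp_vertices. \<exists>K. K \<in> C \<and> u \<in> K" using C(3) by blast
  from bchoice[OF this] obtain cl where cl: "\<forall>u\<in>csp_vertices. cl u \<in> C \<and> u \<in> cl u" ..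
  have clash: "cl u \<noteq> cl u'" if "u \<in> csp_vertices" "u' \<in> csp_vertices" "u \<noteq> u'" "csp_conf D R u u'" for u u'
  proof
    assume eq: "cl u = cl u'"
    have "u' \<in> cl u'" using bspec[OF cl that(2)] by simp
    then have "cl u \<in> C" "u \<in> cl u" "u' \<in> cl u" using bspec[OF cl that(1)] by (simp_all only: eq)
    from ind[OF this that(3)] that(4) show False by blast
  qed
  define H where "H = {..<X} \<times> {D<..<2 * D}"
  define h where "h = (\<lambda>(x, k). cl (node x k))"
  have inj: "inj_on h H"
  proof (rule inj_onI)
    fix a a' assume a: "a \<in> H" "a' \<in> H" and eq: "h a = h a'"
    obtain x k x' k' where xk: "a = (x, k)" "a' = (x', k')" by (cases a; cases a')
    have k: "x < X" "k < 2 * D" "D < k" "x' < X" "k' < 2 * D" "D < k'" using a unfolding xk H_def by auto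
    have "node x k = node x' k'"
    proof (rule ccontr)
      assume ne: "node x k \<noteq> node x' k'"
      have "csp_conf D R (node x k) (node x' k')" using k by (simp only: conf_node) simp
      from clash[OF _ _ ne this] have "h a \<noteq> h a'"
        unfolding xk h_def using node_in_vertices k by simp
      with eq show False by contradiction
    qed
    then show "a = a'" unfolding xk using node_eq k by simp
  qed
  have hC: "h ` H \<subseteq> C"
    using cl node_in_vertices unfolding h_def H_def by auto
  have "card (h ` H) = X * (D - 1)"
    unfolding card_image[OF inj] unfolding H_def by (simp add: card_cartesian_product)
  then have rest: "card (C - h ` H) \<le> 1"
    using C(1,2) hC card_Diff_subset[of "h ` H" C] finite_subset[OF hC C(1)] by simp
  have ex: "\<exists>a<D. cl (node x a) \<in> C - h ` H" if x: "x < X" for x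
  proof (rule ccontr)
    assume *: "\<not> ?thesis"
    have sub: "(\<lambda>a. cl (node x a)) ` {..<D} \<subseteq> (\<lambda>k. h (x, k)) ` {D<..<2 * D}"
    proof (rule image_subsetI)
      fix a assume "a \<in> {..<D}"
      then have a: "a < D" by simp
      then have v: "node x a \<in> csp_vertices" using node_in_vertices[OF x, of a] by simp
      then have "cl (node x a) \<in> h ` H" using * a cl by blast
      then obtain y k where yk: "(y, k) \<in> H" "cl (node x a) = h (y, k)" by (metis imageE surj_pair)
      then have k: "y < X" "k < 2 * D" "D < k" unfolding H_def by auto
      have "y = x"
      proof (rule ccontr)
        assume "y \<noteq> x"
        then have conf: "csp_conf D R (node x a) (node y k)" using a k by (simp only: conf_node) simp
        have ne: "node x a \<noteq> node y k" using node_eq[of a k x y] a k by simp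
        have "node y k \<in> csp_vertices" using node_in_vertices k by simp
        from clash[OF v this ne conf] yk(2) show False unfolding h_def by simp
      qed
      then show "cl (node x a) \<in> (\<lambda>k. h (x, k)) ` {D<..<2 * D}" using yk(2) k by auto
    qed
    have "inj_on (\<lambda>a. cl (node x a)) {..<D}"
    proof (rule inj_onI, rule ccontr)
      fix a a' assume a: "a \<in> {..<D}" "a' \<in> {..<D}" and eq: "cl (node x a) = cl (node x a')" and ne: "a \<noteq> a'"
      have "csp_conf D R (node x a) (node x a')" using a by (simp add: conf_node)
      moreover have "node x a \<noteq> node x a'" using ne by simp
      moreover have "node x a \<in> csp_vertices" "node x a' \<in> csp_vertices" using node_in_vertices[OF x] a
        by simp_all
      ultimately show False using clash eq by blast
    qed
    then have "D = card ((\<lambda>a. cl (node x a)) ` {..<D})" by (simp add: card_image)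
    also have "\<dots> \<le> card ((\<lambda>k. h (x, k)) ` {D<..<2 * D})" by (rule card_mono[OF _ sub]) simp
    also have "\<dots> \<le> card {D<..<2 * D}" by (rule card_image_le) simp
    finally show False using D by simp
  qed
  then obtain t where t: "\<And>x. x < X \<Longrightarrow> t x < D \<and> cl (node x (t x)) \<in> C - h ` H" by metis
  have "R x (t x) y (t y)" if xy: "x < X" "y < X" "x \<noteq> y" for x y
  proof -
    have v: "node x (t x) \<in> csp_vertices" "node y (t y) \<in> csp_vertices"
      using node_in_vertices t[OF xy(1)] t[OF xy(2)] xy by simp_all
    have "finite (C - h ` H)" using C(1) by simp
    then have "cl (node x (t x)) = cl (node y (t y))"
      using rest t[OF xy(1)] t[OF xy(2)] card_le_Suc0_iff_eq[of "C - h ` H"] by simp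
    moreover have "node x (t x) \<noteq> node y (t y)"
      using node_eq[of "t x" "t y" x y] t[OF xy(1)] t[OF xy(2)] xy(3) by simp
    ultimately have "\<not> csp_conf D R (node x (t x)) (node y (t y))" using clash[OF v] by blast
    then show ?thesis using conf_node[of "t x" "t y" x y] t[OF xy(1)] t[OF xy(2)] by simp
  qed
  then show ?thesis using t unfolding csp_solvable_def by blast
qed

lemma classes_of_solution:
  assumes "csp_solvable X D R"
  shows "independent_cover (X * (D - 1) + 1) csp_vertices (csp_conf D R)"
proof -
  from assms obtain t where "\<forall>x<X. t x < D \<and> (\<forall>y<X. x \<noteq> y \<longrightarrow> R x (t x) y (t y))"
    unfolding csp_solvable_def ..
  then have t: "x < X \<Longrightarrow> t x < D" "x < X \<Longrightarrow> y < X \<Longrightarrow> x \<noteq> y \<Longrightarrow> R x (t x) y (t y)" for x y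
    by simp_all
  define S where "S = (\<lambda>x. node x (t x)) ` {..<X}"
  \<comment> \<open>The helper \<open>D + a\<close> takes the value \<open>a\<close> along. Where
    \<open>a\<close> is the value chosen by the solution, it takes 0 instead, so that exactly the
    other values of \<open>x\<close> are absorbed.\<close>
  define Q where "Q = (\<lambda>(x, a). {node x (D + a), node x (if a = t x then 0 else a)})"
  let ?H = "{..<X} \<times> {0<..<D}"
  have "card (insert S (Q ` ?H)) \<le> Suc (card (Q ` ?H))" by (rule card_insert_le_m1) auto
  also have "card (Q ` ?H) \<le> card ?H" by (rule card_image_le) simp
  finally have card: "card (insert S (Q ` ?H)) \<le> X * (D - 1) + 1" by (simp add: card_cartesian_product)
  have cover: "csp_vertices \<subseteq> \<Union>(insert S (Q ` ?H))"
  proof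
    fix u assume "u \<in> csp_vertices"
    then obtain x k where k: "x < X" "k < 2 * D" "k \<noteq> D" "u = node x k" unfolding vertices_eq_image by auto
    have Qu: "u \<in> \<Union>(insert S (Q ` ?H))" if "u \<in> Q (x, a)" "0 < a" "a < D" for a
      using that k(1) by (intro UnionI[OF insertI2[OF imageI]] SigmaI) simp_all
    show "u \<in> \<Union>(insert S (Q ` ?H))"
    proof (cases "k = t x")
      case True
      then have "u \<in> S" using k unfolding S_def by blast
      then show ?thesis by blast
    next
      case ne: False
      show ?thesis
      proof (cases "k > D")
        case True
        have "u \<in> Q (x, k - D)" using True by (simp add: Q_def k(4))
        then show ?thesis by (rule Qu) (use True k in simp_all)
      next
        case False
        then have kD: "k < D" using k(3) by simp
        show ?thesis
        proof (cases "k = 0")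
          case True
          have "u \<in> Q (x, t x)" using True by (simp add: Q_def k(4))
          then show ?thesis by (rule Qu) (use True ne t(1)[OF k(1)] in simp_all)
        next
          case False
          have "u \<in> Q (x, k)" using ne by (simp add: Q_def k(4))
          then show ?thesis by (rule Qu) (use False kD in simp_all)
        qed
      qed
    qed
  qed
  have S: "S \<subseteq> csp_vertices \<and> (\<forall>u\<in>S. \<forall>u'\<in>S. u \<noteq> u' \<longrightarrow> \<not> csp_conf D R u u')"
  proof (intro conjI ballI impI)
    show "S \<subseteq> csp_vertices" unfolding S_def
    proof (rule image_subsetI)
      fix x assume "x \<in> {..<X}"
      then have "x < X" by simp
      with t(1)[OF this] show "node x (t x) \<in> csp_vertices" by (intro node_in_vertices) simp_all
    qed
    fix u u' assume u: "u \<in> S" "u' \<in> S" "u \<noteq> u'"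
    then obtain x x' where x: "x < X" "x' < X" "u = node x (t x)" "u' = node x' (t x')" unfolding S_def
      by blast
    then have "x \<noteq> x'" using u(3) by blast
    then show "\<not> csp_conf D R u u'"
      using conf_node[of "t x" "t x'" x x'] t(1)[OF x(1)] t(1)[OF x(2)] t(2)[of x x'] t(2)[of x' x] x by simp
  qed
  have Q: "Q (x, a) \<subseteq> csp_vertices \<and> (\<forall>u\<in>Q (x, a). \<forall>u'\<in>Q (x, a). u \<noteq> u' \<longrightarrow> \<not> csp_conf D R u u')"
    if xa: "x < X" "0 < a" "a < D" for x a
  proof -
    let ?b = "if a = t x then 0 else a"
    have b: "?b < D" using xa by simp
    have conf: "\<not> csp_conf D R (node x (D + a)) (node x ?b)"
      using conf_node[of "D + a" ?b x x] b xa by simp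
    then have "\<not> csp_conf D R (node x ?b) (node x (D + a))" using csp_conf_sym by metis
    moreover have "node x (D + a) \<in> csp_vertices" "node x ?b \<in> csp_vertices"
      using node_in_vertices[OF xa(1)] xa b by simp_all
    ultimately show ?thesis unfolding Q_def prod.case using conf by blast
  qed
  have "\<forall>K\<in>insert S (Q ` ?H). K \<subseteq> csp_vertices \<and> (\<forall>u\<in>K. \<forall>u'\<in>K. u \<noteq> u' \<longrightarrow> \<not> csp_conf D R u u')"
  proof
    fix K assume "K \<in> insert S (Q ` ?H)"
    then have "K = S \<or> K \<in> Q ` ?H" by (rule insertE) blast+
    then show "K \<subseteq> csp_vertices \<and> (\<forall>u\<in>K. \<forall>u'\<in>K. u \<noteq> u' \<longrightarrow> \<not> csp_conf D R u u')"
    proof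
      assume "K = S"
      show ?thesis unfolding \<open>K = S\<close> by (rule S)
    next
      assume "K \<in> Q ` ?H"
      then obtain y where y: "y \<in> ?H" "K = Q y" by (rule imageE)
      obtain x a where "y = (x, a)" by (rule prod.exhaust)
      with y Q[of x a] show ?thesis by simp
    qed
  qed
  moreover have "finite (insert S (Q ` ?H))" by simp
  ultimately show ?thesis using card cover unfolding independent_cover_def
    by (intro exI[of _ "insert S (Q ` ?H)"] conjI)
qed

lemma independent_cover_iff_solvable:
  "independent_cover (X * (D - 1) + 1) csp_vertices (csp_conf D R) \<longleftrightarrow> csp_solvable X D R"
  using solution_of_classes classes_of_solution ..

end

section \<open>Computations as constraint problems\<close>

type_synonym rule = "nat \<times> nat list \<times> nat \<times> (nat \<times> int) list"

text \<open>These symbols and the states in \<open>ctrl_states\<close> are all that a computation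
  can meet; the restriction to them keeps \<open>idle M\<close> finite.\<close>

definition tape_syms :: "tm \<Rightarrow> nat set" where
  "tape_syms M = {0, 1, 2} \<union> (\<Union>(q, rs, q', as)\<in>trans M. fst ` set as)"

definition ctrl_states :: "tm \<Rightarrow> nat set" where
  "ctrl_states M = insert (start M) ((\<lambda>(q, rs, q', as). q') ` trans M)"

text \<open>Idle transitions in accepting halting situations make all accepting computations equally long.\<close>

definition idle :: "tm \<Rightarrow> rule set" where
  "idle M = (\<lambda>(q, rs). (q, rs, q, stay rs)) `
    {(q, rs). q \<in> ctrl_states M \<inter> accepting M \<and> set rs \<subseteq> tape_syms M \<and> length rs = tapes M \<and>
      (\<nexists>q' as. (q, rs, q', as) \<in> trans M)}"

lemma finite_tape_syms: "wf_tm M \<Longrightarrow> finite (tape_syms M)"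
  unfolding tape_syms_def wf_tm_def by auto

lemma finite_ext:
  assumes "wf_tm M"
  shows "finite (trans M \<union> idle M)"
proof -
  have fin: "finite (trans M)" using assms by (simp add: wf_tm_def)
  then have "finite (ctrl_states M)" by (simp add: ctrl_states_def)
  then have "finite (ctrl_states M \<times> {rs. set rs \<subseteq> tape_syms M \<and> length rs = tapes M})"
    using finite_lists_length_eq[OF finite_tape_syms[OF assms]] by simp
  then have "finite {(q, rs). q \<in> ctrl_states M \<inter> accepting M \<and> set rs \<subseteq> tape_syms M \<and> length rs = tapes M \<and>
      (\<nexists>q' as. (q, rs, q', as) \<in> trans M)}"
    by (rule rev_finite_subset) blast
  then show ?thesis unfolding idle_def using fin by simp
qed

definition step_via :: "rule \<Rightarrow> config \<Rightarrow> config \<Rightarrow> bool" where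
  "step_via d c c' \<longleftrightarrow> (\<exists>as. d = (fst c, map read_tape (snd c), fst c', as) \<and> snd c' = map2 act as (snd c))"

lemma step_iff_via: "step M c c' \<longleftrightarrow> (\<exists>d\<in>trans M. step_via d c c')"
  unfolding step_def step_via_def by blast

text \<open>This invariant guarantees that every accepting halted configuration that is reached has
  a matching rule in \<open>idle M\<close>.\<close>

definition tidy :: "tm \<Rightarrow> config \<Rightarrow> bool" where
  "tidy M c \<longleftrightarrow> fst c \<in> ctrl_states M \<and> length (snd c) = tapes M \<and>
    (\<forall>t\<in>set (snd c). range (snd t) \<subseteq> tape_syms M)"

lemma tidy_init:
  assumes "wf_tm M"
  shows "tidy M (init_config M w)"
proof -
  have "range (word_cells w) \<subseteq> tape_syms M" "range (\<lambda>_::int. 0) \<subseteq> tape_syms M"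
    unfolding tape_syms_def by (auto simp: word_cells_def)
  then show ?thesis using assms unfolding tidy_def init_config_def wf_tm_def ctrl_states_def by auto
qed

lemma tidy_step:
  assumes M: "wf_tm M" and c: "tidy M c" and st: "step M c c'"
  shows "tidy M c'"
proof -
  obtain as where t: "(fst c, map read_tape (snd c), fst c', as) \<in> trans M" and c': "snd c' =
    map2 act as (snd c)"
    using st unfolding step_def by blast
  have len: "length as = tapes M" using M t unfolding wf_tm_def by blast
  have "fst c' \<in> ctrl_states M" unfolding ctrl_states_def using t by force
  moreover have "range (snd y) \<subseteq> tape_syms M" if y: "y \<in> set (snd c')" for y
  proof -
    obtain a x where ax: "(a, x) \<in> set (zip as (snd c))" "y = act a x" using y unfolding c' by auto
    then have a: "a \<in> set as" "x \<in> set (snd c)" by (auto dest: set_zip_leftD set_zip_rightD)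
    obtain s d h f where sd: "a = (s, d)" "x = (h, f)" by (cases a; cases x)
    have "s \<in> tape_syms M" unfolding tape_syms_def using t a(1) sd by force
    moreover have "range f \<subseteq> tape_syms M" using c a(2) sd unfolding tidy_def by force
    ultimately show ?thesis unfolding ax(2) sd by auto
  qed
  ultimately show ?thesis using c len unfolding tidy_def c' by simp
qed

lemma tidy_steps: "wf_tm M \<Longrightarrow> (step M)\<^sup>*\<^sup>* (init_config M w) c \<Longrightarrow> tidy M c"
  by (erule rtranclp_induct) (auto intro: tidy_init tidy_step)

lemma step_via_stay:
  assumes "rs = map read_tape (snd c)"
  shows "step_via (fst c, rs, fst c, stay rs) c c"
proof -
  have "map2 act (stay (map read_tape ts)) ts = ts" for ts
    by (induction ts) (auto simp: stay_def)
  then show ?thesis unfolding step_via_def assms by simp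
qed

definition accepting_run :: "tm \<Rightarrow> bool list \<Rightarrow> nat \<Rightarrow> (nat \<Rightarrow> config) \<Rightarrow> (nat \<Rightarrow> rule) \<Rightarrow> bool" where
  "accepting_run M w T c \<delta> \<longleftrightarrow> c 0 = init_config M w \<and>
    (\<forall>s<T. \<delta> s \<in> trans M \<union> idle M \<and> step_via (\<delta> s) (c s) (c (Suc s))) \<and> \<delta> (T - 1) \<in> idle M"

text \<open>An accepting computation is prolonged by idling, and the strict bound
  \<open>t < T\<close> leaves time for at least one idle step. Conversely, before the first idle
  step only genuine transitions are used, and an idle rule applies only where the machine has halted
  in an accepting state.\<close>

lemma accepts_iff_run:
  assumes M: "wf_tm M" and bound: "\<And>t c. (step M ^^ t) (init_config M w) c \<Longrightarrow> t < T"
  shows "accepts M w \<longleftrightarrow> (\<exists>c \<delta>. accepting_run M w T c \<delta>)"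
proof
  assume "accepts M w"
  then obtain e where e: "(step M)\<^sup>*\<^sup>* (init_config M w) e" "halted M e" "fst e \<in> accepting M"
    unfolding accepts_def by blast
  from rtranclp_imp_relpowp[OF e(1)] obtain t where t: "(step M ^^ t) (init_config M w) e" ..
  have tT: "t < T" by (rule bound[OF t])
  obtain f where f: "f 0 = init_config M w" "f t = e" "\<forall>i<t. step M (f i) (f (Suc i))"
    using t unfolding relpowp_fun_conv by (elim exE conjE) (rule that)
  have "\<exists>d. d \<in> trans M \<and> step_via d (f i) (f (Suc i))" if "i < t" for i
    using f(3) that unfolding step_iff_via by blast
  then have "\<forall>i\<in>{..<t}. \<exists>d. d \<in> trans M \<and> step_via d (f i) (f (Suc i))" by simp
  from bchoice[OF this] obtain g where "\<forall>i\<in>{..<t}. g i \<in> trans M \<and> step_via (g i) (f i) (f (Suc i))" ..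
  then have g: "g i \<in> trans M" "step_via (g i) (f i) (f (Suc i))" if "i < t" for i
    using that by simp_all
  let ?rs = "map read_tape (snd e)"
  let ?d = "(fst e, ?rs, fst e, stay ?rs)"
  have tidy: "tidy M e" by (rule tidy_steps[OF M e(1)])
  have "read_tape x \<in> tape_syms M" if "x \<in> set (snd e)" for x
    using tidy that unfolding tidy_def by (cases x) force
  then have "set ?rs \<subseteq> tape_syms M" by auto
  moreover have "(fst e, ?rs, q', as) \<notin> trans M" for q' as
  proof
    assume "(fst e, ?rs, q', as) \<in> trans M"
    then have "step M e (q', map2 act as (snd e))" unfolding step_def by auto
    with e(2) show False unfolding halted_def by blast
  qed
  ultimately have d: "?d \<in> idle M" unfolding idle_def using tidy e(3) unfolding tidy_def
    by (intro image_eqI[of _ _ "(fst e, ?rs)"]) auto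
  let ?c = "\<lambda>s. f (min s t)" and ?\<delta> = "\<lambda>s. if s < t then g s else ?d"
  show "\<exists>c \<delta>. accepting_run M w T c \<delta>"
    unfolding accepting_run_def
  proof (intro exI[of _ ?c] exI[of _ ?\<delta>] conjI allI impI)
    show "?c 0 = init_config M w" using f(1) by simp
    show "?\<delta> s \<in> trans M \<union> idle M" for s using g(1)[of s] d by simp
    show "step_via (?\<delta> s) (?c s) (?c (Suc s))" for s
    proof (cases "s < t")
      case True
      then show ?thesis using g(2)[OF True] by (simp add: min_def Suc_le_eq)
    next
      case False
      then have "?c s = e" "?c (Suc s) = e" using f(2) by (simp_all add: min_def)
      then show ?thesis using False step_via_stay[of ?rs e] by simp
    qed
    have "\<not> T - 1 < t" using tT by simp
    then show "?\<delta> (T - 1) \<in> idle M" using d by (simp only: if_False)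
  qed
next
  assume "\<exists>c \<delta>. accepting_run M w T c \<delta>"
  then obtain c \<delta> where c: "c 0 = init_config M w"
    and \<delta>: "\<forall>s<T. \<delta> s \<in> trans M \<union> idle M \<and> step_via (\<delta> s) (c s) (c (Suc s))"
    and last: "\<delta> (T - 1) \<in> idle M"
    unfolding accepting_run_def by (elim exE conjE) (rule that)
  define s where "s = (LEAST s. \<delta> s \<in> idle M)"
  have s: "\<delta> s \<in> idle M" unfolding s_def using last by (rule LeastI)
  have s_le: "s \<le> T - 1" unfolding s_def using last by (rule Least_le)
  have less: "\<delta> r \<notin> idle M" if "r < s" for r using that unfolding s_def by (rule not_less_Least)
  have "T > 0" using bound[of 0 "init_config M w"] by simp
  then have sT: "s < T" using s_le by simp
  have steps: "(step M ^^ r) (init_config M w) (c r)" if "r \<le> s" for r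
    using that
  proof (induction r)
    case 0
    then show ?case using c by simp
  next
    case (Suc r)
    have "r < T" "\<delta> r \<notin> idle M" using Suc.prems sT less[of r] by simp_all
    with \<delta>[rule_format, of r] have "\<delta> r \<in> trans M" "step_via (\<delta> r) (c r) (c (Suc r))" by simp_all
    then have 1: "step M (c r) (c (Suc r))" unfolding step_iff_via by (rule bexI[rotated])
    have 2: "(step M ^^ r) (init_config M w) (c r)" by (rule Suc.IH) (use Suc.prems in simp)
    show ?case by (rule relpowp_Suc_I[OF 2 1])
  qed
  have reach: "(step M)\<^sup>*\<^sup>* (init_config M w) (c s)"
    by (rule relpowp_imp_rtranclp[OF steps[OF order_refl]])
  obtain q rs where qr: "\<delta> s = (q, rs, q, stay rs)" "q \<in> accepting M" "\<nexists>q' as. (q, rs, q', as) \<in> trans M"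
    using s unfolding idle_def by auto
  have "step_via (\<delta> s) (c s) (c (Suc s))" using \<delta> sT by blast
  then have q: "fst (c s) = q" "map read_tape (snd (c s)) = rs" unfolding step_via_def qr(1) by auto
  have "\<not> step M (c s) c'" for c' unfolding step_def q using qr(3) by blast
  then have "halted M (c s)" unfolding halted_def by blast
  moreover have "fst (c s) \<in> accepting M" unfolding q by (rule qr(2))
  ultimately show "accepts M w" unfolding accepts_def using reach by blast
qed

text \<open>The contents of a tape are replaced by a reference to one earlier moment, so that
  reading the right symbol becomes a condition on two variables.\<close>

lemma last_write:
  assumes F: "\<And>s. s < T \<Longrightarrow> F (Suc s) = (F s)(H s := wr s)"
  shows "s \<le> T \<Longrightarrow> (\<And>r. r < s \<Longrightarrow> H r \<noteq> p) \<Longrightarrow> F s p = F 0 p"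
    and "s \<le> T \<Longrightarrow> l < s \<Longrightarrow> H l = p \<Longrightarrow> (\<And>r. l < r \<Longrightarrow> r < s \<Longrightarrow> H r \<noteq> p) \<Longrightarrow> F s p = wr l"
proof -
  show "s \<le> T \<Longrightarrow> (\<And>r. r < s \<Longrightarrow> H r \<noteq> p) \<Longrightarrow> F s p = F 0 p"
  proof (induction s)
    case (Suc s)
    have "H s \<noteq> p" using Suc.prems(2) by simp
    moreover have "F s p = F 0 p" using Suc by simp
    ultimately show ?case using F[of s] Suc.prems(1) by simp
  qed simp
  show "s \<le> T \<Longrightarrow> l < s \<Longrightarrow> H l = p \<Longrightarrow> (\<And>r. l < r \<Longrightarrow> r < s \<Longrightarrow> H r \<noteq> p) \<Longrightarrow> F s p = wr l"
  proof (induction s)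
    case (Suc s)
    show ?case
    proof (cases "l = s")
      case True
      then show ?thesis using F[of s] Suc.prems by simp
    next
      case False
      then have "l < s" using Suc.prems(2) by simp
      moreover from this have "H s \<noteq> p" using Suc.prems(4)[of s] by simp
      moreover have "F s p = wr l" by (rule Suc.IH) (use Suc.prems \<open>l < s\<close> in simp_all)
      ultimately show ?thesis using F[of s] Suc.prems(1) by simp
    qed
  qed simp
qed

section \<open>Tabulated rules and the constraints of a computation\<close>

definition rl_src :: "rule list \<Rightarrow> nat \<Rightarrow> nat" where
  "rl_src ds i = (if i < length ds then fst (ds ! i) else 0)"
definition rl_dst :: "rule list \<Rightarrow> nat \<Rightarrow> nat" where
  "rl_dst ds i = (if i < length ds then fst (snd (snd (ds ! i))) else 0)"
text \<open>The value 0 outside the lists makes this a function of finite support on numbers,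
  computable by \<open>expressible_table2\<close>.\<close>

definition rl_read :: "rule list \<Rightarrow> nat \<Rightarrow> nat \<Rightarrow> nat" where
  "rl_read ds i k = (if i < length ds \<and> k < length (fst (snd (ds ! i))) then fst (snd (ds ! i)) ! k else 0)"
definition rl_write :: "rule list \<Rightarrow> nat \<Rightarrow> nat \<Rightarrow> nat" where
  "rl_write ds i k = (if i < length ds \<and> k < length (snd (snd (snd (ds ! i))))
     then fst (snd (snd (snd (ds ! i))) ! k) else 0)"
text \<open>The displacements -1, 0, 1 are stored as 0, 1, 2.\<close>

definition rl_move :: "rule list \<Rightarrow> nat \<Rightarrow> nat \<Rightarrow> nat" where
  "rl_move ds i k = (if i < length ds \<and> k < length (snd (snd (snd (ds ! i))))
     then nat (snd (snd (snd (snd (ds ! i))) ! k) + 1) else 0)"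
definition rl_idle :: "tm \<Rightarrow> rule list \<Rightarrow> nat \<Rightarrow> bool" where
  "rl_idle M ds i \<longleftrightarrow> i < length ds \<and> ds ! i \<in> idle M"

text \<open>
  A computation of length \<open>T\<close> as a constraint problem: variable \<open>s * K + k\<close> describes time \<open>s\<close> and
  tape \<open>k\<close>.  Its value consists of the index of the applied rule, the head position shifted by \<open>T\<close> and
  the time of the last earlier visit to the scanned cell, with \<open>s\<close> itself for an unvisited cell.
  Thus the symbol read is determined by a single other variable.
\<close>

definition v_code :: "nat \<Rightarrow> nat \<Rightarrow> nat \<Rightarrow> nat \<Rightarrow> nat" where
  "v_code T i h l = (i * (2 * T + 1) + h) * T + l"
definition v_rule :: "nat \<Rightarrow> nat \<Rightarrow> nat" where "v_rule T a = a div T div (2 * T + 1)"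
definition v_head :: "nat \<Rightarrow> nat \<Rightarrow> nat" where "v_head T a = a div T mod (2 * T + 1)"
definition v_last :: "nat \<Rightarrow> nat \<Rightarrow> nat" where "v_last T a = a mod T"

text \<open>\<open>h\<close> is a head position shifted by \<open>T\<close>, hence the subtraction;
  cells to the left of the input are blank.\<close>

definition init_sym :: "bool list \<Rightarrow> nat \<Rightarrow> nat \<Rightarrow> nat \<Rightarrow> nat" where
  "init_sym w T k h = (if k = 0 \<and> T \<le> h then word_cells w (int (h - T)) else 0)"

text \<open>The conditions on a single variable. A last visit equal to the present time signals an
  unvisited cell, where the initial symbol must be read.\<close>

definition step_ok :: "tm \<Rightarrow> rule list \<Rightarrow> bool list \<Rightarrow> nat \<Rightarrow> nat \<Rightarrow> nat \<Rightarrow> bool" where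
  "step_ok M ds w T x a \<longleftrightarrow>
    v_rule T a < length ds \<and> v_last T a \<le> x div tapes M \<and>
    (v_last T a = x div tapes M \<longrightarrow>
      rl_read ds (v_rule T a) (x mod tapes M) = init_sym w T (x mod tapes M) (v_head T a)) \<and>
    (x div tapes M = 0 \<longrightarrow> v_head T a = T \<and> rl_src ds (v_rule T a) = start M) \<and>
    (x div tapes M + 1 = T \<longrightarrow> rl_idle M ds (v_rule T a))"

text \<open>The last two implications certify the stored last visit: no visit to the scanned cell is
  later than the stored time, and at that time, if it is earlier than the present, the head was at
  this cell and wrote the symbol now read.\<close>

definition steps_fit :: "tm \<Rightarrow> rule list \<Rightarrow> nat \<Rightarrow> nat \<Rightarrow> nat \<Rightarrow> nat \<Rightarrow> nat \<Rightarrow> bool" where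
  "steps_fit M ds T x a y b \<longleftrightarrow>
    (y div tapes M = x div tapes M \<longrightarrow> v_rule T b = v_rule T a) \<and>
    (y div tapes M = x div tapes M + 1 \<longrightarrow>
      rl_dst ds (v_rule T a) = rl_src ds (v_rule T b) \<and>
      (y mod tapes M = x mod tapes M \<longrightarrow>
        v_head T b + 1 = v_head T a + rl_move ds (v_rule T a) (x mod tapes M))) \<and>
    (y mod tapes M = x mod tapes M \<and> y div tapes M < x div tapes M \<longrightarrow>
      (v_head T a = v_head T b \<longrightarrow> y div tapes M \<le> v_last T a \<and> \<not> v_last T a = x div tapes M) \<and>
      (v_last T a = y div tapes M \<longrightarrow> v_head T a = v_head T b \<and>
        rl_write ds (v_rule T b) (x mod tapes M) = rl_read ds (v_rule T a) (x mod tapes M)))"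

text \<open>The conditions on one variable are attached to the binary constraints. They take effect
  because \<open>T \<ge> 2\<close> gives every variable a partner.\<close>

definition tableau_rel :: "tm \<Rightarrow> rule list \<Rightarrow> bool list \<Rightarrow> nat \<Rightarrow> nat \<Rightarrow> nat \<Rightarrow> nat \<Rightarrow> nat \<Rightarrow> bool" where
  "tableau_rel M ds w T x a y b \<longleftrightarrow> step_ok M ds w T x a \<and> steps_fit M ds T x a y b"

lemma v_code_decode:
  assumes "h < 2 * T + 1" "l < T"
  shows "v_rule T (v_code T i h l) = i" "v_head T (v_code T i h l) = h" "v_last T (v_code T i h l) = l"
proof -
  have 1: "v_code T i h l div T = i * (2 * T + 1) + h" "v_code T i h l mod T = l"
    unfolding v_code_def using assms(2) by simp_all
  have *: "(i * b + h) div b = i \<and> (i * b + h) mod b = h" if "h < b" for b using that by simp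
  have 2: "(i * (2 * T + 1) + h) div (2 * T + 1) = i" "(i * (2 * T + 1) + h) mod (2 * T + 1) = h"
    using *[OF assms(1)] by blast+
  show "v_rule T (v_code T i h l) = i" unfolding v_rule_def 1 2 ..
  show "v_head T (v_code T i h l) = h" unfolding v_head_def 1 2 ..
  show "v_last T (v_code T i h l) = l" unfolding v_last_def 1 ..
qed

lemma v_code_less:
  assumes "i < m" "h < 2 * T + 1" "l < T"
  shows "v_code T i h l < m * ((2 * T + 1) * T)"
proof -
  have "v_code T i h l < (i * (2 * T + 1) + h) * T + T" unfolding v_code_def using assms(3) by simp
  also have "\<dots> = (i * (2 * T + 1) + h + 1) * T" by simp
  also have "\<dots> \<le> (Suc i * (2 * T + 1)) * T" using assms(2) by (intro mult_right_mono) simp_all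
  also have "\<dots> \<le> (m * (2 * T + 1)) * T" using assms(1) by (intro mult_right_mono) simp_all
  finally show ?thesis by (simp only: mult.assoc)
qed

section \<open>Equivalence of accepting runs and solutions\<close>

context
  fixes M :: tm and ds :: "rule list" and w :: "bool list" and T :: nat
  assumes M: "wf_tm M" and ds: "set ds = trans M \<union> idle M" and T: "T \<ge> 2"
begin

abbreviation "tps \<equiv> tapes M"

definition init_tape :: "nat \<Rightarrow> int \<Rightarrow> nat" where
  "init_tape k = (if k = 0 then word_cells w else (\<lambda>_. 0))"

text \<open>An accepting run taken apart into rule indices, head positions and contents of the
  single tapes; the summand 1 beside the new head position undoes the shift in
  \<open>rl_move\<close>.\<close>

definition trace :: "(nat \<Rightarrow> nat) \<Rightarrow> (nat \<Rightarrow> nat \<Rightarrow> int) \<Rightarrow> (nat \<Rightarrow> nat \<Rightarrow> int \<Rightarrow> nat) \<Rightarrow> bool" where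
  "trace i H F \<longleftrightarrow>
    (\<forall>s<T. i s < length ds) \<and> rl_src ds (i 0) = start M \<and> ds ! i (T - 1) \<in> idle M \<and>
    (\<forall>s. Suc s < T \<longrightarrow> rl_dst ds (i s) = rl_src ds (i (Suc s))) \<and>
    (\<forall>k<tps. H 0 k = 0 \<and> F 0 k = init_tape k) \<and>
    (\<forall>s<T. \<forall>k<tps. F s k (H s k) = rl_read ds (i s) k \<and> H (Suc s) k + 1 = H s k + int (rl_move ds (i s) k) \<and>
      F (Suc s) k = (F s k)(H s k := rl_write ds (i s) k))"

lemma K_pos: "tps > 0"
  using M by (simp add: wf_tm_def)

lemma rule_shape:
  assumes "j < length ds"
  shows "length (fst (snd (ds ! j))) = tps" "length (snd (snd (snd (ds ! j)))) = tps"
    "k < tps \<Longrightarrow> snd (snd (snd (snd (ds ! j))) ! k) \<in> {-1, 0, 1}"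
proof -
  obtain q rs q' as where e: "ds ! j = (q, rs, q', as)" by (cases "ds ! j")
  then have "(q, rs, q', as) \<in> trans M \<union> idle M" using assms ds nth_mem by metis
  then have *: "length rs = tps \<and> length as = tps \<and> (\<forall>(s, d)\<in>set as. d \<in> {-1, 0, 1})"
  proof
    assume "(q, rs, q', as) \<in> trans M"
    then show ?thesis using M unfolding wf_tm_def by fast
  next
    assume "(q, rs, q', as) \<in> idle M"
    then have "length rs = tps" "as = stay rs" unfolding idle_def by auto
    then show ?thesis by (auto simp: stay_def)
  qed
  show "length (fst (snd (ds ! j))) = tps" "length (snd (snd (snd (ds ! j)))) = tps" using *
    by (simp_all add: e)
  show "snd (snd (snd (snd (ds ! j))) ! k) \<in> {-1, 0, 1}" if "k < tps"
  proof -
    have "as ! k \<in> set as" using * that by simp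
    then have "snd (as ! k) \<in> {-1, 0, 1}" using * by (metis (no_types, lifting) case_prodE snd_conv)
    then show ?thesis by (simp add: e)
  qed
qed

lemma rl_move_int:
  assumes "j < length ds" "k < tps"
  shows "int (rl_move ds j k) = snd (snd (snd (snd (ds ! j))) ! k) + 1" "rl_move ds j k \<le> 2"
  using rule_shape(2)[OF assms(1)] rule_shape(3)[OF assms] assms unfolding rl_move_def by auto

lemma init_tapes: "k < tps \<Longrightarrow> snd (init_config M w) ! k =
  (0, init_tape k)" "length (snd (init_config M w)) = tps"
  using K_pos unfolding init_config_def init_tape_def by (auto simp: nth_Cons')

lemma run_iff_trace:
  "(\<exists>c \<delta>. accepting_run M w T c \<delta>) \<longleftrightarrow> (\<exists>i H F. trace i H F)"
proof
  assume "\<exists>c \<delta>. accepting_run M w T c \<delta>"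
  then obtain c \<delta> where c: "c 0 = init_config M w"
    and \<delta>: "\<forall>s<T. \<delta> s \<in> trans M \<union> idle M \<and> step_via (\<delta> s) (c s) (c (Suc s))"
    and last: "\<delta> (T - 1) \<in> idle M"
    unfolding accepting_run_def by (elim exE conjE) (rule that)
  have "\<forall>s\<in>{..<T}. \<exists>j. j < length ds \<and> ds ! j = \<delta> s"
    using \<delta> ds by (metis in_set_conv_nth lessThan_iff)
  from bchoice[OF this] obtain i where "\<forall>s\<in>{..<T}. i s < length ds \<and> ds ! i s = \<delta> s" ..
  then have i: "i s < length ds" "ds ! i s = \<delta> s" if "s < T" for s using that by simp_all
  define H where "H s k = fst (snd (c s) ! k)" for s k
  define F where "F s k = snd (snd (c s) ! k)" for s k
  have via: "ds ! i s = (fst (c s), map read_tape (snd (c s)), fst (c (Suc s)), snd (snd (snd (ds ! i s))))"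
    "snd (c (Suc s)) = map2 act (snd (snd (snd (ds ! i s)))) (snd (c s))" if "s < T" for s
  proof -
    have "step_via (ds ! i s) (c s) (c (Suc s))" using \<delta> i that by simp
    then obtain as where as: "ds ! i s = (fst (c s), map read_tape (snd (c s)), fst (c (Suc s)), as)"
      "snd (c (Suc s)) = map2 act as (snd (c s))" unfolding step_via_def by blast
    show "ds ! i s = (fst (c s), map read_tape (snd (c s)), fst (c (Suc s)), snd (snd (snd (ds ! i s))))"
      unfolding as(1) by simp
    show "snd (c (Suc s)) = map2 act (snd (snd (snd (ds ! i s)))) (snd (c s))" unfolding as by simp
  qed
  have src: "rl_src ds (i s) = fst (c s)" "rl_dst ds (i s) = fst (c (Suc s))"
    and rd: "fst (snd (ds ! i s)) = map read_tape (snd (c s))" if "s < T" for s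
    using i(1)[OF that] unfolding rl_src_def rl_dst_def by (subst via(1)[OF that], simp)+
  have len: "length (snd (c s)) = tps" if "s < T" for s
    using rule_shape(1)[OF i(1)[OF that]] unfolding rd[OF that] by simp
  have "trace i H F" unfolding trace_def
  proof (intro conjI allI impI)
    show "i s < length ds" if "s < T" for s by (rule i(1)[OF that])
    show "rl_src ds (i 0) = start M" using src(1)[of 0] T c by (simp add: init_config_def)
    show "ds ! i (T - 1) \<in> idle M" using i(2)[of "T - 1"] last T by simp
    show "rl_dst ds (i s) = rl_src ds (i (Suc s))" if "Suc s < T" for s
      using src(2)[of s] src(1)[of "Suc s"] that by simp
    show "H 0 k = 0" "F 0 k = init_tape k" if "k < tps" for k
      using init_tapes(1)[OF that] c by (simp_all add: H_def F_def)
    fix s k assume s: "s < T" and k: "k < tps"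
    let ?as = "snd (snd (snd (ds ! i s)))"
    have "rl_read ds (i s) k = read_tape (snd (c s) ! k)"
      unfolding rl_read_def rd[OF s] using len[OF s] k i(1)[OF s] by simp
    then show "F s k (H s k) = rl_read ds (i s) k" by (cases "snd (c s) ! k") (simp add: H_def F_def)
    have "snd (c (Suc s)) ! k = act (?as ! k) (snd (c s) ! k)"
      unfolding via(2)[OF s] using len[OF s] k rule_shape(2)[OF i(1)[OF s]] by simp
    then have "H (Suc s) k = H s k + snd (?as ! k) \<and> F (Suc s) k = (F s k)(H s k := fst (?as ! k))"
      unfolding H_def F_def by (cases "?as ! k"; cases "snd (c s) ! k") simp
    then show "H (Suc s) k + 1 = H s k + int (rl_move ds (i s) k)"
      "F (Suc s) k = (F s k)(H s k := rl_write ds (i s) k)"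
      unfolding rl_move_int(1)[OF i(1)[OF s] k] rl_write_def
      using rule_shape(2)[OF i(1)[OF s]] k i(1)[OF s] by simp_all
  qed
  then show "\<exists>i H F. trace i H F" by blast
next
  assume "\<exists>i H F. trace i H F"
  then obtain i H F where "trace i H F" by blast
  note tr = this[unfolded trace_def]
  \<comment> \<open>At time \<open>T\<close> no rule is applied whose source would give the state,
    so the destination of the last rule is taken.\<close>
  define q where "q s = (if s < T then rl_src ds (i s) else rl_dst ds (i (T - 1)))" for s
  define c where "c s = (q s, map (\<lambda>k. (H s k, F s k)) [0..<tps])" for s
  have q: "q (Suc s) = rl_dst ds (i s)" if "s < T" for s
  proof (cases "Suc s < T")
    case True
    then show ?thesis using tr by (simp add: q_def)
  next
    case False
    then have "T - 1 = s" using that by simp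
    then show ?thesis using False by (simp add: q_def)
  qed
  show "\<exists>c \<delta>. accepting_run M w T c \<delta>"
    unfolding accepting_run_def
  proof (intro exI[of _ c] exI[of _ "\<lambda>s. ds ! i s"] conjI allI impI)
    have "map (\<lambda>k. (H 0 k, F 0 k)) [0..<tps] = snd (init_config M w)"
      by (rule nth_equalityI) (use tr init_tapes in simp_all)
    moreover have "q 0 = start M" using tr T by (simp add: q_def)
    ultimately show "c 0 = init_config M w" by (simp add: c_def init_config_def)
    show "ds ! i (T - 1) \<in> idle M" using tr by simp
    fix s assume s: "s < T"
    then have il: "i s < length ds" using tr by simp
    show "ds ! i s \<in> trans M \<union> idle M" unfolding ds[symmetric] by (rule nth_mem[OF il])
    obtain a rs a' as where e: "ds ! i s = (a, rs, a', as)" by (cases "ds ! i s")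
    have len: "length rs = tps" "length as = tps" using rule_shape(1,2)[OF il] by (simp_all add: e)
    have tr_s: "F s k (H s k) = rl_read ds (i s) k" "H (Suc s) k + 1 = H s k + int (rl_move ds (i s) k)"
      "F (Suc s) k = (F s k)(H s k := rl_write ds (i s) k)" if "k < tps" for k
      using tr s that by simp_all
    have "rs = map read_tape (snd (c s))"
      by (rule nth_equalityI) (simp_all add: c_def len tr_s(1) rl_read_def e il)
    moreover have "snd (c (Suc s)) = map2 act as (snd (c s))"
    proof (rule nth_equalityI)
      fix k assume "k < length (snd (c (Suc s)))"
      then have k: "k < tps" by (simp add: c_def)
      have "H (Suc s) k = H s k + snd (as ! k)"
        using tr_s(2)[OF k] rl_move_int(1)[OF il k] by (simp add: e)
      moreover have "F (Suc s) k = (F s k)(H s k := fst (as ! k))"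
        using tr_s(3)[OF k] k by (simp add: rl_write_def e il len)
      ultimately show "snd (c (Suc s)) ! k = map2 act as (snd (c s)) ! k"
        using k len by (cases "as ! k") (simp add: c_def)
    qed (simp add: c_def len)
    moreover have "a = fst (c s)" using s by (simp add: c_def q_def rl_src_def e il)
    moreover have "a' = fst (c (Suc s))" using q[OF s] by (simp add: c_def rl_dst_def e il)
    ultimately show "step_via (ds ! i s) (c s) (c (Suc s))" unfolding step_via_def e by blast
  qed
qed

abbreviation "var_rel \<equiv> tableau_rel M ds w T"
text \<open>The summand 1 keeps the number of values positive even for an empty list of
  rules.\<close>

abbreviation "num_vals \<equiv> (length ds + 1) * ((2 * T + 1) * T)"

lemma init_sym_eq:
  assumes "- int T \<le> p"
  shows "init_sym w T k (nat (p + int T)) = init_tape k p"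
proof (cases "p \<ge> 0")
  case True
  then have "T \<le> nat (p + int T)" "int (nat (p + int T) - T) = p" by linarith+
  then show ?thesis unfolding init_sym_def init_tape_def by simp
next
  case False
  then have "\<not> T \<le> nat (p + int T)" using assms by linarith
  moreover have "word_cells w p = 0" using False by (simp add: word_cells_def)
  ultimately show ?thesis unfolding init_sym_def init_tape_def by simp
qed

lemma solution_of_trace:
  assumes "trace i H F"
  shows "csp_solvable (T * tps) num_vals var_rel"
proof -
  note tr = assms[unfolded trace_def]
  have il: "i s < length ds" if "s < T" for s using tr that by simp
  have H0: "H 0 k = 0" "F 0 k = init_tape k" if "k < tps" for k using tr that by simp_all
  have trs: "F s k (H s k) = rl_read ds (i s) k" "H (Suc s) k + 1 = H s k + int (rl_move ds (i s) k)"
    "F (Suc s) k = (F s k)(H s k := rl_write ds (i s) k)" if "s < T" "k < tps" for s k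
    using tr that by simp_all
  \<comment> \<open>A head moves by at most one cell per step, so its position shifted by
    \<open>T\<close> is a natural number below \<open>2 * T + 1\<close>.\<close>
  have Hb: "- int s \<le> H s k \<and> H s k \<le> int s" if "s \<le> T" "k < tps" for s k
    using that(1)
  proof (induction s)
    case 0
    then show ?case using H0(1)[OF that(2)] by simp
  next
    case (Suc s)
    then have s: "s < T" by simp
    have "- int s \<le> H s k \<and> H s k \<le> int s" by (rule Suc.IH) (use s in simp)
    moreover have "0 \<le> int (rl_move ds (i s) k)" "int (rl_move ds (i s) k) \<le> 2"
      using rl_move_int(2)[OF il[OF s] that(2)] by simp_all
    ultimately show ?case using trs(2)[OF s that(2)] unfolding of_nat_Suc by linarith
  qed
  \<comment> \<open>\<open>l\<close> is the time of the last earlier visit to the cell scanned at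
    time \<open>s\<close>, or \<open>s\<close> itself if there was none.\<close>
  define Q where "Q s k l \<longleftrightarrow> l \<le> s \<and> ((l = s \<and> (\<forall>r<s. H r k \<noteq> H s k)) \<or>
    (l < s \<and> H l k = H s k \<and> (\<forall>r. l < r \<and> r < s \<longrightarrow> H r k \<noteq> H s k)))" for s k l
  have ex: "\<exists>l. Q s k l" for s k
  proof (cases "\<exists>r<s. H r k = H s k")
    case True
    define A where "A = {r. r < s \<and> H r k = H s k}"
    have A: "finite A" "A \<noteq> {}" using True unfolding A_def by auto
    define l where "l = Max A"
    have "l \<in> A" unfolding l_def by (rule Max_in[OF A])
    then have l: "l < s" "H l k = H s k" unfolding A_def by blast+
    have "H r k \<noteq> H s k" if r: "l < r" "r < s" for r
    proof
      assume "H r k = H s k"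
      with r(2) have "r \<in> A" unfolding A_def by blast
      then have "r \<le> l" unfolding l_def by (rule Max_ge[OF A(1)])
      with r(1) show False by simp
    qed
    with l have "Q s k l" unfolding Q_def by (intro conjI disjI2 allI impI) simp_all
    then show ?thesis by (rule exI)
  next
    case False
    then have "\<forall>r<s. H r k \<noteq> H s k" by blast
    then have "Q s k s" unfolding Q_def by (intro conjI disjI1) simp_all
    then show ?thesis by (rule exI)
  qed
  define l where "l s k = (SOME l. Q s k l)" for s k
  have l: "l s k \<le> s \<and> ((l s k = s \<and> (\<forall>r<s. H r k \<noteq> H s k)) \<or>
    (l s k < s \<and> H (l s k) k = H s k \<and> (\<forall>r. l s k < r \<and> r < s \<longrightarrow> H r k \<noteq> H s k)))" for s k
  proof -
    have "Q s k (l s k)" unfolding l_def by (rule someI_ex[OF ex])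
    then show ?thesis unfolding Q_def .
  qed
  define h where "h s k = nat (H s k + int T)" for s k
  define t where "t x = v_code T (i (x div tps)) (h (x div tps) (x mod tps)) (l (x div tps) (x mod
    tps))" for x
  have hb: "h s k < 2 * T + 1" "int (h s k) = H s k + int T" if "s < T" "k < tps" for s k
    using Hb[of s k] that unfolding h_def by linarith+
  have lb: "l s k < T" if "s < T" for s k using l[of s k] that by simp
  have xb: "x div tps < T" "x mod tps < tps" if "x < T * tps" for x
    using that K_pos less_mult_imp_div_less by simp_all
  have dec: "v_rule T (t x) = i (x div tps)" "v_head T (t x) = h (x div tps) (x mod tps)"
    "v_last T (t x) = l (x div tps) (x mod tps)" if "x < T * tps" for x
    unfolding t_def using v_code_decode[OF hb(1) lb] xb[OF that] by simp_all
  have h_eq: "h s k = h s' k \<longleftrightarrow> H s k = H s' k" if "s < T" "s' < T" "k < tps" for s s' k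
    using hb(2)[OF that(1,3)] hb(2)[OF that(2,3)] by linarith
  have ok: "step_ok M ds w T x (t x)" if x: "x < T * tps" for x
  proof -
    let ?s = "x div tps" and ?k = "x mod tps"
    note s = xb[OF x]
    have "rl_read ds (i ?s) ?k = init_sym w T ?k (h ?s ?k)" if "l ?s ?k = ?s"
    proof -
      have nv: "\<And>r. r < ?s \<Longrightarrow> H r ?k \<noteq> H ?s ?k" using l[of ?s ?k] that by simp
      have "F ?s ?k (H ?s ?k) = F 0 ?k (H ?s ?k)"
        by (rule last_write(1)[where F = "\<lambda>s. F s ?k" and H = "\<lambda>s. H s ?k" and T = T])
          (use trs(3) s nv in simp_all)
      moreover have "init_sym w T ?k (h ?s ?k) = init_tape ?k (H ?s ?k)"
        unfolding h_def by (rule init_sym_eq) (use Hb[of ?s ?k] s in simp)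
      ultimately show ?thesis using trs(1)[OF s] H0(2)[OF s(2)] by simp
    qed
    moreover have "h 0 ?k = T" using H0(1)[OF s(2)] by (simp add: h_def)
    moreover have "rl_idle M ds (i ?s)" if "?s + 1 = T"
    proof -
      have "T - 1 = ?s" using that by simp
      then have "ds ! i ?s \<in> idle M" using tr by metis
      with il[OF s(1)] show ?thesis unfolding rl_idle_def ..
    qed
    moreover have "rl_src ds (i 0) = start M" using tr by simp
    ultimately show ?thesis unfolding step_ok_def dec[OF x] using il[OF s(1)] l[of ?s ?k] by simp
  qed
  have fit: "steps_fit M ds T x (t x) y (t y)" if x: "x < T * tps" and y: "y < T * tps" for x y
  proof -
    let ?s = "x div tps" and ?k = "x mod tps" and ?r = "y div tps"
    note s = xb[OF x] and r = xb[OF y]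
    have 1: "rl_dst ds (i ?s) = rl_src ds (i ?r)" if "?r = ?s + 1"
      using tr r(1) that by simp
    have 2: "h ?r ?k + 1 = h ?s ?k + rl_move ds (i ?s) ?k" if "?r = ?s + 1"
    proof -
      have "H ?r ?k + 1 = H ?s ?k + int (rl_move ds (i ?s) ?k)" using trs(2)[OF s] that by simp
      then show ?thesis using hb(2)[OF r(1) s(2)] hb(2)[OF s] by linarith
    qed
    have 3: "?r \<le> l ?s ?k \<and> \<not> l ?s ?k = ?s" if rs: "?r < ?s" and eq: "h ?s ?k = h ?r ?k"
    proof -
      have H: "H ?r ?k = H ?s ?k" using h_eq[OF s(1) r(1) s(2)] eq by simp
      from conjunct2[OF l[of ?s ?k]] show ?thesis
      proof (elim disjE conjE)
        assume "\<forall>r<?s. H r ?k \<noteq> H ?s ?k"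
        with rs H show ?thesis by blast
      next
        assume 2: "l ?s ?k < ?s" "\<forall>r. l ?s ?k < r \<and> r < ?s \<longrightarrow> H r ?k \<noteq> H ?s ?k"
        have "\<not> l ?s ?k < ?r"
        proof
          assume "l ?s ?k < ?r"
          with 2(2) rs have "H ?r ?k \<noteq> H ?s ?k" by blast
          with H show False by (rule notE[rotated])
        qed
        with 2(1) show ?thesis by simp
      qed
    qed
    have 4: "h ?s ?k = h ?r ?k \<and> rl_write ds (i ?r) ?k = rl_read ds (i ?s) ?k"
      if rs: "?r < ?s" and eq: "l ?s ?k = ?r"
    proof -
      have H: "H ?r ?k = H ?s ?k" and nv: "\<forall>q. ?r < q \<and> q < ?s \<longrightarrow> H q ?k \<noteq> H ?s ?k"
        using l[of ?s ?k] rs eq by simp_all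
      have "F ?s ?k (H ?s ?k) = rl_write ds (i ?r) ?k"
        by (rule last_write(2)[where F = "\<lambda>s. F s ?k" and H = "\<lambda>s. H s ?k" and T = T
              and wr = "\<lambda>s. rl_write ds (i s) ?k"])
          (use trs(3) s rs H nv in simp_all)
      then show ?thesis using trs(1)[OF s] h_eq[OF s(1) r(1) s(2)] H by simp
    qed
    show ?thesis unfolding steps_fit_def dec[OF x] dec[OF y] using 1 2 3 4 by simp
  qed
  have "t x < num_vals" if "x < T * tps" for x
    unfolding t_def by (rule v_code_less) (use xb[OF that] il hb lb in \<open>simp_all add: less_SucI\<close>)
  then show ?thesis using ok fit unfolding csp_solvable_def tableau_rel_def by (intro exI[of _ t]) simp
qed

text \<open>Heads and tape contents are recomputed from the rule indices alone; the constraints then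
  force the head positions and last visits stored in the values to agree with them.\<close>

lemma trace_of_solution:
  assumes t: "\<And>x y. x < T * tps \<Longrightarrow> y < T * tps \<Longrightarrow> x \<noteq> y \<Longrightarrow> var_rel x (t x) y (t y)"
  shows "\<exists>i H F. trace i H F"
proof -
  have xl: "s * tps + k < T * tps" if "s < T" "k < tps" for s k
  proof -
    have "s * tps + k < Suc s * tps" using that by simp
    also have "\<dots> \<le> T * tps" using that by (intro mult_right_mono) simp_all
    finally show ?thesis .
  qed
  have dm: "(s * tps + k) div tps = s" "(s * tps + k) mod tps = k" if "k < tps" for s k using that by simp_all
  define v where "v s k = t (s * tps + k)" for s k
  define i where "i s = v_rule T (v s 0)" for s
  have fit: "steps_fit M ds T (s * tps + k) (v s k) (r * tps + j) (v r j)"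
    if "s < T" "k < tps" "r < T" "j < tps" "(s, k) \<noteq> (r, j)" for s k r j
  proof -
    have "s * tps + k \<noteq> r * tps + j"
    proof
      assume eq: "s * tps + k = r * tps + j"
      have "s = r" using arg_cong[OF eq, of "\<lambda>x. x div tps"] unfolding dm(1)[OF that(2)] dm(1)[OF that(4)] .
      moreover have "k = j" using arg_cong[OF eq, of "\<lambda>x. x mod tps"]
        unfolding dm(2)[OF that(2)] dm(2)[OF that(4)] .
      ultimately show False using that(5) by simp
    qed
    then show ?thesis using t[OF xl[OF that(1,2)] xl[OF that(3,4)]] unfolding tableau_rel_def v_def by simp
  qed
  have ok: "step_ok M ds w T (s * tps + k) (v s k)" if "s < T" "k < tps" for s k
  proof -
    \<comment> \<open>The conditions on one variable are visible only in a constraint with another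
      one; a second moment exists as \<open>T \<ge> 2\<close>.\<close>
    define r :: nat where "r = (if s = 0 then 1 else 0)"
    have r: "r < T" "r \<noteq> s" using T by (simp_all add: r_def)
    have "s * tps + k \<noteq> r * tps + k" using r K_pos by simp
    then show ?thesis using t[OF xl[OF that] xl[OF r(1) that(2)]] unfolding tableau_rel_def v_def by simp
  qed
  have rule: "v_rule T (v s k) = i s" if "s < T" "k < tps" for s k
  proof (cases "k = 0")
    case True
    then show ?thesis by (simp add: i_def)
  next
    case False
    then show ?thesis using fit[OF that(1) K_pos that] unfolding steps_fit_def i_def
      by (simp only: dm[OF that(2)] dm[OF K_pos]) simp
  qed
  have ok': "i s < length ds" "v_last T (v s k) \<le> s"
    "v_last T (v s k) = s \<Longrightarrow> rl_read ds (i s) k = init_sym w T k (v_head T (v s k))"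
    "s = 0 \<Longrightarrow> v_head T (v s k) = T \<and> rl_src ds (i s) = start M"
    "s + 1 = T \<Longrightarrow> rl_idle M ds (i s)" if "s < T" "k < tps" for s k
    using ok[OF that] unfolding step_ok_def dm[OF that(2)] rule[OF that] by simp_all
  define H where "H s k = (\<Sum>r<s. int (rl_move ds (i r) k) - 1)" for s k
  define F where "F s k = rec_nat (init_tape k) (\<lambda>r f. f(H r k := rl_write ds (i r) k)) s" for s k
  have FS: "F (Suc s) k = (F s k)(H s k := rl_write ds (i s) k)" for s k by (simp add: F_def)
  have HS: "H (Suc s) k + 1 = H s k + int (rl_move ds (i s) k)" for s k by (simp add: H_def)
  have head: "int (v_head T (v s k)) = H s k + int T" if "s < T" "k < tps" for s k
    using that(1)
  proof (induction s)
    case 0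
    then show ?case using ok'(4)[OF 0 that(2)] by (simp add: H_def)
  next
    case (Suc s)
    then have s: "s < T" "Suc s < T" by simp_all
    have "v_head T (v (Suc s) k) + 1 = v_head T (v s k) + rl_move ds (i s) k"
      using fit[OF s(1) that(2) s(2) that(2)]
        unfolding steps_fit_def dm[OF that(2)] rule[OF s(1) that(2)] by simp
    then show ?case using Suc.IH[OF s(1)] HS[of s k] by linarith
  qed
  have last: "(v_head T (v s k) = v_head T (v r k) \<longrightarrow> r \<le> v_last T (v s k) \<and> \<not> v_last T (v s k) = s) \<and>
      (v_last T (v s k) = r \<longrightarrow> v_head T (v s k) = v_head T (v r k) \<and> rl_write ds (i r) k = rl_read ds (i s) k)"
    if "s < T" "k < tps" "r < s" for s k r
  proof -
    have r: "r < T" using that by simp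
    show ?thesis using fit[OF that(1,2) r that(2)] that(3)
      unfolding steps_fit_def dm[OF that(2)] rule[OF that(1,2)] rule[OF r that(2)] by simp
  qed
  \<comment> \<open>The stored last visit is the true one, so \<open>last_write\<close> determines
    the scanned symbol.\<close>
  have read: "F s k (H s k) = rl_read ds (i s) k" if "s < T" "k < tps" for s k
  proof (cases "v_last T (v s k) = s")
    case True
    have nv: "H r k \<noteq> H s k" if "r < s" for r
      using last[OF \<open>s < T\<close> \<open>k < tps\<close> that] True head[OF \<open>s < T\<close> \<open>k < tps\<close>] head[of r k] that \<open>s < T\<close> \<open>k
        < tps\<close>
      by auto
    have "F s k (H s k) = F 0 k (H s k)"
      by (rule last_write(1)[where F = "\<lambda>s. F s k" and H = "\<lambda>s. H s k" and T = T])
        (use FS that nv in simp_all)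
    also have "\<dots> = init_sym w T k (nat (H s k + int T))"
      using init_sym_eq[of "H s k" k] head[OF that] by (simp add: F_def)
    also have "\<dots> = rl_read ds (i s) k"
      using ok'(3)[OF that True] unfolding head[OF that, symmetric] by simp
    finally show ?thesis .
  next
    case False
    let ?l = "v_last T (v s k)"
    have l: "?l < s" using ok'(2)[OF that] False by simp
    have lT: "?l < T" using l that(1) by simp
    have "v_head T (v s k) = v_head T (v ?l k)" and wr: "rl_write ds (i ?l) k = rl_read ds (i s) k"
      using last[OF that l] by blast+
    then have Hl: "H ?l k = H s k" using head[OF that] head[OF lT that(2)] by simp
    have nv: "H r k \<noteq> H s k" if r: "?l < r" "r < s" for r
    proof -
      have "r < T" using r(2) \<open>s < T\<close> by simp
      have "v_head T (v s k) \<noteq> v_head T (v r k)" using last[OF \<open>s < T\<close> \<open>k < tps\<close> r(2)] r(1) by auto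
      then show ?thesis using head[OF \<open>s < T\<close> \<open>k < tps\<close>] head[OF \<open>r < T\<close> \<open>k < tps\<close>] by auto
    qed
    have "F s k (H s k) = rl_write ds (i ?l) k"
      by (rule last_write(2)[where F = "\<lambda>s. F s k" and H = "\<lambda>s. H s k" and T = T and wr =
        "\<lambda>s. rl_write ds (i s) k"])
        (use FS that l Hl nv in simp_all)
    with wr show ?thesis by simp
  qed
  have "trace i H F" unfolding trace_def
  proof (intro conjI allI impI)
    show "i s < length ds" if "s < T" for s by (rule ok'(1)[OF that K_pos])
    show "rl_src ds (i 0) = start M" using ok'(4)[OF _ K_pos, of 0] T by simp
    show "ds ! i (T - 1) \<in> idle M" using ok'(5)[OF _ K_pos, of "T - 1"] T by (simp add: rl_idle_def)
    show "rl_dst ds (i s) = rl_src ds (i (Suc s))" if "Suc s < T" for s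
    proof -
      have s: "s < T" using that by simp
      show ?thesis using fit[OF s K_pos that K_pos]
        unfolding steps_fit_def dm[OF K_pos] rule[OF s K_pos] rule[OF that K_pos] by simp
    qed
    show "H 0 k = 0" "F 0 k = init_tape k" for k by (simp_all add: H_def F_def)
    show "F s k (H s k) = rl_read ds (i s) k" if "s < T" "k < tps" for s k by (rule read[OF that])
    show "H (Suc s) k + 1 = H s k + int (rl_move ds (i s) k)" for s k by (rule HS)
    show "F (Suc s) k = (F s k)(H s k := rl_write ds (i s) k)" for s k by (rule FS)
  qed
  then show ?thesis by blast
qed

lemma accepts_iff_solution:
  assumes bound: "\<And>t c. (step M ^^ t) (init_config M w) c \<Longrightarrow> t < T"
  shows "accepts M w \<longleftrightarrow> csp_solvable (T * tps) num_vals var_rel"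
proof -
  have "accepts M w \<longleftrightarrow> (\<exists>i H F. trace i H F)"
    by (rule trans[OF accepts_iff_run[OF M] run_iff_trace]) (rule bound)
  also have "\<dots> \<longleftrightarrow> csp_solvable (T * tps) num_vals var_rel"
  proof
    assume "\<exists>i H F. trace i H F"
    then show "csp_solvable (T * tps) num_vals var_rel" by (elim exE) (rule solution_of_trace)
  next
    assume "csp_solvable (T * tps) num_vals var_rel"
    then obtain t where t: "\<forall>x<T * tps. t x < num_vals \<and> (\<forall>y<T * tps. x \<noteq> y \<longrightarrow> var_rel x (t x) y (t y))"
      unfolding csp_solvable_def ..
    show "\<exists>i H F. trace i H F" by (rule trace_of_solution[of t]) (use t in simp)
  qed
  finally show ?thesis .
qed

end

section \<open>The reduction\<close>

lemma expressible_table: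
  assumes "\<And>i. i \<ge> m \<Longrightarrow> h i = 0" "expressible f"
  shows "expressible (\<lambda>w v. h (f w v))"
proof -
  have *: "(if i < m then h i else 0) = h i" for i using assms(1)[of i] by simp
  show ?thesis using expressible_finite[OF assms(2), of m h] unfolding * .
qed

lemma expressible_table2:
  assumes h: "\<And>i k. i \<ge> m \<Longrightarrow> h i k = 0" "\<And>i k. k \<ge> l \<Longrightarrow> h i k = 0"
    and f: "expressible f" "expressible g"
  shows "expressible (\<lambda>w v. h (f w v) (g w v))"
proof -
  have zero: "h (j div l) (j mod l) = 0" if "j \<ge> m * l" for j
  proof (cases "l = 0")
    case True
    then show ?thesis using h(2)[of "j mod l"] by simp
  next
    case False
    then have "j div l \<ge> m" using that less_eq_div_iff_mult_less_eq[of l m j] by simp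
    then show ?thesis by (rule h(1))
  qed
  have *: "h i k = (if k < l then h ((i * l + k) div l) ((i * l + k) mod l) else 0)" for i k
    using h(2)[of k i] by simp
  have "expressible (\<lambda>w v. if g w v < l then h ((f w v * l + g w v) div l) ((f w v * l + g w v) mod l)
    else 0)"
    by (intro expressible_if decidable_less expressible_const f
      expressible_table[of "m * l" "\<lambda>j. h (j div l) (j mod l)"] zero expressible_add expressible_mult)
  then show ?thesis unfolding *[symmetric] .
qed

lemma expressible_rules:
  fixes ds :: "rule list"
  assumes "expressible f"
  shows "expressible (\<lambda>w v. rl_src ds (f w v))" "expressible (\<lambda>w v. rl_dst ds (f w v))"
    "decidable (\<lambda>w v. rl_idle M ds (f w v))"
  by (rule expressible_table[OF _ assms, of "length ds"], simp add: rl_src_def rl_dst_def rl_idle_def)+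

lemma expressible_rules2:
  fixes ds :: "rule list"
  assumes fg: "expressible f" "expressible g"
  shows "expressible (\<lambda>w v. rl_read ds (f w v) (g w v))" "expressible (\<lambda>w v. rl_write ds (f w v) (g w v))"
    "expressible (\<lambda>w v. rl_move ds (f w v) (g w v))"
proof -
  \<comment> \<open>This sum bounds the lengths of all lists in the rules and so serves as a common
    limit for the tape index.\<close>
  let ?l = "\<Sum>d\<leftarrow>ds. length (fst (snd d)) + length (snd (snd (snd d)))"
  have l: "length (fst (snd (ds ! i))) + length (snd (snd (snd (ds ! i)))) \<le> ?l" if "i < length ds" for i
    by (rule member_le_sum_list) (use that in auto)
  have *: "expressible (\<lambda>w v. h (f w v) (g w v))"
    if "\<And>i k. i \<ge> length ds \<Longrightarrow> h i k = 0" "\<And>i k. i < length ds \<Longrightarrow> k \<ge> ?l \<Longrightarrow> h i k = 0" for h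
    by (rule expressible_table2[OF _ _ fg, of "length ds" _ ?l]) (use that not_le in blast)+
  show "expressible (\<lambda>w v. rl_read ds (f w v) (g w v))" "expressible (\<lambda>w v. rl_write ds (f w v) (g w v))"
    "expressible (\<lambda>w v. rl_move ds (f w v) (g w v))"
    by (rule *; use l in \<open>fastforce simp: rl_read_def rl_write_def rl_move_def\<close>)+
qed

lemma decidable_tableau_rel:
  assumes "expressible (\<lambda>w v. T w)" "expressible x" "expressible a" "expressible y" "expressible b"
  shows "decidable (\<lambda>w v. tableau_rel M ds w (T w) (x w v) (a w v) (y w v) (b w v))"
  unfolding tableau_rel_def step_ok_def steps_fit_def v_rule_def v_head_def v_last_def init_sym_def
  by (intro expressible_intros expressible_rules expressible_rules2 assms)

lemma decidable_if:
  assumes "decidable Q" "decidable Q1" "decidable Q2"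
  shows "decidable (\<lambda>w v. if Q w v then Q1 w v else Q2 w v)"
  unfolding if_bool_eq_conj by (intro expressible_intros assms)

lemma decidable_csp_conf:
  assumes R: "\<And>x a y b. expressible x \<Longrightarrow> expressible a \<Longrightarrow> expressible y \<Longrightarrow> expressible b \<Longrightarrow>
      decidable (\<lambda>w v. R w (x w v) (a w v) (y w v) (b w v))"
    and "expressible (\<lambda>w v. D w)" "expressible p" "expressible q"
  shows "decidable (\<lambda>w v. csp_conf (D w) (R w) (p w v) (q w v))"
  unfolding csp_conf_def
  by (intro decidable_if expressible_intros R assms)

lemma expressible_denom:
  assumes C: "\<And>p q. expressible p \<Longrightarrow> expressible q \<Longrightarrow> decidable (\<lambda>w v. C w (p w v) (q w v))"
    and V: "\<And>p. expressible p \<Longrightarrow> decidable (\<lambda>w v. V w (p w v))"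
    and U: "expressible (\<lambda>w v. U w)" and ij: "expressible i" "expressible j"
  shows "expressible (\<lambda>w v. denom (U w) (V w) (C w) (i w v) (j w v))"
  unfolding denom_def is_vertex_def is_gadget_def pair_code_def side_def
  by (intro expressible_intros C V U ij)

lemma printable_matrix:
  assumes N: "expressible (\<lambda>w v. N w)" and d: "expressible (\<lambda>w v. d w (v 0) (v 1))"
  shows "printable (\<lambda>w v. concat (map (\<lambda>(i, j). enc_rat (mat (N w) (N w) (\<lambda>(i, j). 1 / of_nat (d w i j))
    $$ (i, j)))
    (List.product [0..<N w] [0..<N w])))"
proof -
  have product: "concat (map g (List.product xs ys)) = concat (map (\<lambda>i. concat (map (\<lambda>j. g (i, j)) ys)) xs)"
    for g :: "nat \<times> nat \<Rightarrow> bool list" and xs ys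
    by (induction xs) (simp_all add: comp_def)
  have "printable (\<lambda>w v. enc_rat (1 / of_nat (d w (v 0) (v 1))))"
    by (rule printable_enc_rat[OF d])
  from printable_for[OF N printable_for[OF N this, of 1], of 0]
  have "printable (\<lambda>w v. concat (map (\<lambda>i. concat (map (\<lambda>j. enc_rat (1 / of_nat (d w i j))) [0..<N w]))
    [0..<N w]))"
    by simp
  moreover have "concat (map (\<lambda>i. concat (map (\<lambda>j. enc_rat (1 / of_nat (d w i j))) [0..<N w])) [0..<N w]) =
    concat (map (\<lambda>(i, j). enc_rat (mat (N w) (N w) (\<lambda>(i, j). 1 / of_nat (d w i j)) $$ (i, j)))
      (List.product [0..<N w] [0..<N w]))" for w
    unfolding product by (intro arg_cong[of _ _ concat] map_cong refl) simp
  ultimately show ?thesis by (simp only:)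
qed

theorem theorem4p5:
  shows "NP_hard_promise (enc_instance ` COR_promise) (enc_instance ` COR_rank_yes)"
  unfolding NP_hard_promise_def
proof
  fix L assume "L \<in> NP"
  then obtain M where M: "wf_tm M" "poly_time M" and L: "L = {w. accepts M w}"
    unfolding NP_def by auto
  from M(2) obtain b :: "nat poly"
    where b: "\<forall>w t c. (step M ^^ t) (init_config M w) c \<longrightarrow> t \<le> poly b (length w)"
    unfolding poly_time_def ..
  obtain ds where ds: "set ds = trans M \<union> idle M" using finite_list[OF finite_ext[OF M(1)]] ..
  \<comment> \<open>The summand 2 makes the time bound strict and ensures
    \<open>T w \<ge> 2\<close>.\<close>
  define T where "T w = poly b (length w) + 2" for w :: "bool list"
  define D where "D w = (length ds + 1) * ((2 * T w + 1) * T w)" for w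
  define X where "X w = T w * tapes M" for w
  define U where "U w = X w * (2 * D w)" for w
  define R where "R w = tableau_rel M ds w (T w)" for w
  define N where "N w = side (U w) * side (U w)" for w
  \<comment> \<open>X * (D - 1) + 1 colours, plus the square of the number X * (2 * D - 1) of
    vertices, plus 2 for the empty atom and the singleton of the special index.\<close>
  define \<rho> where "\<rho> w = X w * (D w - 1) + 1 + (X w * (2 * D w - 1)) * (X w * (2 * D w - 1)) + 2" for w
  define G where "G w = colour_mat (U w) (csp_vertex (D w)) (csp_conf (D w) (R w))" for w
  define f where "f w = enc_instance (N w, \<rho> w, G w)" for w
  have T: "T w \<ge> 2" and D: "D w > 0" for w by (simp_all add: T_def D_def)
  have bound: "t < T w" if "(step M ^^ t) (init_config M w) c" for w t c
    using b that unfolding T_def by fastforce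
  have promise: "(N w, \<rho> w, G w) \<in> COR_promise" for w
    unfolding N_def G_def by (rule colour_mat_promise[OF csp_conf_sym]) (simp add: \<rho>_def)
  have yes: "(N w, \<rho> w, G w) \<in> COR_rank_yes \<longleftrightarrow> w \<in> L" for w
  proof -
    let ?V = "{u. u < U w \<and> csp_vertex (D w) u}"
    have card: "card ?V = X w * (2 * D w - 1)" unfolding U_def by (rule card_vertices[OF D])
    have "(N w, \<rho> w, G w) \<in> COR_rank_yes \<longleftrightarrow>
        (N w, X w * (D w - 1) + 1 + card ?V * card ?V + 2, G w) \<in> COR_rank_yes"
      unfolding \<rho>_def card ..
    also have "\<dots> \<longleftrightarrow> independent_cover (X w * (D w - 1) + 1) ?V (csp_conf (D w) (R w))"
      unfolding N_def G_def by (rule colour_mat_yes[OF csp_conf_sym])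
    also have "\<dots> \<longleftrightarrow> csp_solvable (X w) (D w) (R w)"
      unfolding U_def by (rule independent_cover_iff_solvable[OF D])
    also have "\<dots> \<longleftrightarrow> accepts M w"
      unfolding X_def D_def R_def by (rule accepts_iff_solution[OF M(1) ds T bound, symmetric])
    finally show ?thesis by (simp add: L)
  qed
  have xT: "expressible (\<lambda>w v. T w)"
    unfolding T_def by (intro expressible_add expressible_poly expressible_const)
  have xD: "expressible (\<lambda>w v. D w)" and xX: "expressible (\<lambda>w v. X w)" and xU: "expressible (\<lambda>w v. U w)"
    and xN: "expressible (\<lambda>w v. N w)" and x\<rho>: "expressible (\<lambda>w v. \<rho> w)"
    unfolding \<rho>_def N_def side_def U_def X_def D_def by (intro expressible_intros xT)+
  have xR: "decidable (\<lambda>w v. R w (x w v) (a w v) (y w v) (b w v))"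
    if "expressible x" "expressible a" "expressible y" "expressible b" for x a y b
    unfolding R_def by (rule decidable_tableau_rel[OF xT that])
  have xd: "expressible (\<lambda>w v. denom (U w) (csp_vertex (D w)) (csp_conf (D w) (R w)) (v 0) (v 1))"
  proof (rule expressible_denom)
    show "decidable (\<lambda>w v. csp_conf (D w) (R w) (p w v) (q w v))" if "expressible p" "expressible q" for p q
      by (rule decidable_csp_conf[OF xR xD that])
    show "decidable (\<lambda>w v. csp_vertex (D w) (p w v))" if "expressible p" for p
      unfolding csp_vertex_def by (intro expressible_intros xD that)
  qed (intro xU expressible_var)+
  have "printable (\<lambda>w v. f w)"
    unfolding f_def enc_instance.simps
    by (intro printable_append printable_enc_nat xN x\<rho>)
      (unfold G_def colour_mat_def N_def[symmetric], rule printable_matrix[OF xN xd])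
  then have "poly_time_computable f" by (rule poly_time_computable_printable)
  moreover have "f w \<in> enc_instance ` COR_promise" for w
    unfolding f_def using promise by (rule imageI)
  moreover have "w \<in> L \<longleftrightarrow> f w \<in> enc_instance ` COR_rank_yes" for w
  proof -
    \<comment> \<open>Injectivity of the encoding excludes that \<open>f w\<close> encodes some
      other yes-instance.\<close>
    have "COR_rank_yes \<subseteq> {(n, \<rho>, \<Gamma>). \<Gamma> \<in> carrier_mat n n}"
      "(N w, \<rho> w, G w) \<in> {(n, \<rho>, \<Gamma>). \<Gamma> \<in> carrier_mat n n}"
      using promise[of w] unfolding COR_rank_yes_def COR_promise_def by auto
    then have "f w \<in> enc_instance ` COR_rank_yes \<longleftrightarrow> (N w, \<rho> w, G w) \<in> COR_rank_yes"
      unfolding f_def using inj_on_image_mem_iff[OF inj_on_enc_instance] by blast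
    then show ?thesis using yes by simp
  qed
  ultimately show "\<exists>f. poly_time_computable f \<and>
      (\<forall>w. f w \<in> enc_instance ` COR_promise \<and> (w \<in> L \<longleftrightarrow> f w \<in> enc_instance ` COR_rank_yes))"
    by (intro exI[of _ f] conjI allI)
qed

end
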